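(* Let $d\ge2$. There exist $c>0$ and, for every $2\le q<+\infty$, a constant $C_q>0$ such that for all $r\ge0$, $$\nu\big(\{B=(b_{k,l})_{k\in\mathbb N,\,l=1,\dots,N_k}\in\mathcal B:\ \exists k,l,\ \big|\|b_{k,l}\|_{L^q(\mathbb S^d)}-\mathcal M_{q,k}\big|>r\}\big)\le C_qe^{-cr^2},$$ $$\widetilde\nu\big(\{B=(b_{k,l})_{k\in\mathbb N,\,l=1,\dots,N_k}\in\widetilde{\mathcal B}:\ \exists k,l,\ \big|\|b_{k,l}\|_{L^q(\mathbb S^d)}-\mathcal M_{q,k}\big|>r\}\big)\le C_qe^{-cr^2},$$ where $\mathcal M_{q,k}$ is the median of $u\mapsto\|u\|_{L^q(\mathbb S^d)}$ on the unit sphere of $E^k$ (over $\mathbb C$ in the first estimate, over $\mathbb R$ in the second), and where in the complex case $\mathcal M_{q,k}$ satisfies, with $C$ independent of $q,k$, $$\big|\mathcal A_{q,k}-\mathcal M_{q,k}\big|\le\frac{C}{N_k^{1/q}}\sqrt q,\qquad\mathcal A_{q,k}=\frac{N_k^{1/2}}{(\mathrm{Vol}(\mathbb S^d))^{\frac12-\frac1q}}\Big(q\,\frac{\Gamma(q/2)\Gamma(N_k)}{2\,\Gamma(q/2+N_k)}\Big)^{1/q}.$$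
   Context: $\mathbb S^d\subset\mathbb R^{d+1}$ is the unit sphere with its standard metric. For $k\in\mathbb N$ and $\mathbb K=\mathbb C$ or $\mathbb R$, $E^k$ is the $\mathbb K$-vector space of spherical harmonics of degree $k$ (restrictions to $\mathbb S^d$ of homogeneous harmonic polynomials of degree $k$ with coefficients in $\mathbb K$), with the $L^2(\mathbb S^d)$ norm; its dimension is $N_k=\binom{k+d}{d}-\binom{k+d-2}{d}$. Fixing a reference orthonormal basis, the set of orthonormal bases of $E^k$ is identified with $U(N_k)$ ($\mathbb K=\mathbb C$) or $O(N_k)$ ($\mathbb K=\mathbb R$), with Haar probability measure $\nu_k$ or $\widetilde\nu_k$. Hilbert bases of $L^2(\mathbb S^d;\mathbb K)$ made of spherical harmonics, $B=(b_{k,l})$ with $(b_{k,l})_{1\le l\le N_k}$ an orthonormal basis of $E^k$, are identified with $\mathcal B=\prod_kU(N_k)$ (resp. $\widetilde{\mathcal B}=\prod_kO(N_k)$), with product probability $\nu=\otimes_k\nu_k$ (resp. $\widetilde\nu=\otimes_k\widetilde\nu_k$). The median $\mathcal M$ of $F$ on the unit sphere of $E^k$ with its uniform probability $P$ is defined by $P(F\ge\mathcal M)\ge\frac12$ and $P(F\le\mathcal M)\ge\frac12$. *)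

theory Defs
  imports "HOL-Probability.Probability" "Jordan_Normal_Form.Conjugate"
begin

text \<open>
  The sphere \<open>S^d\<close> is \<^term>\<open>sphere 0 1 :: (real^'n) set\<close> with \<open>CARD('n) = d + 1\<close>. The scalar field
  is a type \<open>'k\<close>, used for \<^typ>\<open>complex\<close> and \<^typ>\<open>real\<close> only; \<^const>\<open>conjugate\<close> is complex
  conjugation on the former and the identity on the latter.
\<close>

subsection \<open>Surface measure and norms on the sphere\<close>

text \<open>
  Polar-coordinate formula for the surface measure of the unit sphere of \<open>R^n\<close>: a Borel subset \<open>A\<close>
  of the sphere has measure \<open>n\<close> times the volume of the cone \<open>{t x. x \<in> A, 0 < t < 1}\<close>.
  It is realised as a measure on the whole space, concentrated on the sphere.
\<close>

definition sphere_measure :: "(real^'n) measure" where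
  "sphere_measure =
     scale_measure (of_nat CARD('n)) (distr (restrict_space lborel (ball 0 1)) borel sgn)"

definition Lq_norm :: "real \<Rightarrow> (real^'n \<Rightarrow> 'k::real_normed_vector) \<Rightarrow> real" where
  "Lq_norm q f = (LINT x|sphere_measure. norm (f x) powr q) powr (1 / q)"

definition L2_inner ::
    "(real^'n \<Rightarrow> 'k::{real_normed_field,euclidean_space,conjugatable_field}) \<Rightarrow> (real^'n \<Rightarrow> 'k) \<Rightarrow> 'k" where
  "L2_inner f g = (LINT x|sphere_measure. f x * conjugate (g x))"

subsection \<open>Spherical harmonics\<close>

definition homogeneous_polynomials :: "nat \<Rightarrow> (real^'n \<Rightarrow> 'k::real_normed_field) set" where
  "homogeneous_polynomials k =
     {p. \<exists>c. p = (\<lambda>x. \<Sum>\<alpha> | (\<Sum>i\<in>UNIV. \<alpha> i) = k. c \<alpha> * (\<Prod>i\<in>UNIV. of_real (x $ i) ^ \<alpha> i))}"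

definition partial_deriv :: "'n \<Rightarrow> (real^'n \<Rightarrow> 'k::real_normed_vector) \<Rightarrow> real^'n \<Rightarrow> 'k" where
  "partial_deriv i f x = vector_derivative (\<lambda>t. f (x + t *\<^sub>R axis i 1)) (at 0)"

definition laplacian :: "(real^'n \<Rightarrow> 'k::real_normed_vector) \<Rightarrow> real^'n \<Rightarrow> 'k" where
  "laplacian f x = (\<Sum>i\<in>UNIV. partial_deriv i (partial_deriv i f) x)"

text \<open>
  A function on the sphere is represented by its extension by zero (rather than by \<^const>\<open>restrict\<close>),
  so that pointwise linear combinations stay in the space.
\<close>

definition spherical_harmonics :: "nat \<Rightarrow> (real^'n \<Rightarrow> 'k::real_normed_field) set" where
  "spherical_harmonics k =
     {\<lambda>x. if x \<in> sphere 0 1 then p x else 0 |p.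
        p \<in> homogeneous_polynomials k \<and> (\<forall>x. laplacian p x = 0)}"

definition harm_dim :: "nat \<Rightarrow> nat \<Rightarrow> nat" where
  "harm_dim d k = ((k + d) choose d) - ((k + d - 2) choose d)"

definition lin_comb :: "nat \<Rightarrow> (nat \<Rightarrow> 'a \<Rightarrow> 'k::comm_ring_1) \<Rightarrow> (nat \<Rightarrow> 'k) \<Rightarrow> 'a \<Rightarrow> 'k" where
  "lin_comb N e a = (\<lambda>x. \<Sum>m<N. a m * e m x)"

text \<open>Families of \<open>N\<close> objects are indexed by \<open>0, \<dots>, N - 1\<close>.\<close>

definition orthonormal_basis_harm ::
    "nat \<Rightarrow> nat \<Rightarrow> (nat \<Rightarrow> real^'n \<Rightarrow> 'k::{real_normed_field,euclidean_space,conjugatable_field}) \<Rightarrow> bool" where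
  "orthonormal_basis_harm k N e \<longleftrightarrow>
     (\<forall>l<N. e l \<in> spherical_harmonics k) \<and>
     (\<forall>l<N. \<forall>m<N. L2_inner (e l) (e m) = (if l = m then 1 else 0)) \<and>
     (\<forall>f\<in>spherical_harmonics k. \<exists>a. f = lin_comb N e a)"

subsection \<open>Unitary and orthogonal groups, Haar measure, random bases\<close>

text \<open>For \<^typ>\<open>complex\<close> this is \<open>U(N)\<close>, for \<^typ>\<open>real\<close> it is \<open>O(N)\<close>.\<close>

definition unitary_group :: "nat \<Rightarrow> (nat \<times> nat \<Rightarrow> 'k::conjugatable_field) set" where
  "unitary_group N =
     {U \<in> extensional ({..<N} \<times> {..<N}).
        \<forall>i<N. \<forall>j<N. (\<Sum>m<N. conjugate (U (m, i)) * U (m, j)) = (if i = j then 1 else 0)}"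

definition matrix_prod ::
    "nat \<Rightarrow> (nat \<times> nat \<Rightarrow> 'k::comm_ring_1) \<Rightarrow> (nat \<times> nat \<Rightarrow> 'k) \<Rightarrow> nat \<times> nat \<Rightarrow> 'k" where
  "matrix_prod N A B = (\<lambda>(i, j)\<in>{..<N} \<times> {..<N}. \<Sum>m<N. A (i, m) * B (m, j))"

definition haar_prob ::
    "nat \<Rightarrow> (nat \<times> nat \<Rightarrow> 'k::{real_normed_field,conjugatable_field}) measure \<Rightarrow> bool" where
  "haar_prob N \<mu> \<longleftrightarrow>
     prob_space \<mu> \<and>
     sets \<mu> = sets (restrict_space (\<Pi>\<^sub>M _\<in>{..<N} \<times> {..<N}. borel) (unitary_group N)) \<and>
     (\<forall>V\<in>unitary_group N. distr \<mu> \<mu> (matrix_prod N V) = \<mu>)"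

text \<open>
  A reference orthonormal basis \<open>e\<close> identifies a unitary matrix \<open>U\<close> with the orthonormal basis whose
  \<open>l\<close>-th element has the \<open>l\<close>-th column of \<open>U\<close> as its coordinates.
\<close>

definition basis_of ::
    "nat \<Rightarrow> (nat \<Rightarrow> 'a \<Rightarrow> 'k::comm_ring_1) \<Rightarrow> (nat \<times> nat \<Rightarrow> 'k) \<Rightarrow> nat \<Rightarrow> 'a \<Rightarrow> 'k" where
  "basis_of N e U l = lin_comb N e (\<lambda>m. U (m, l))"

text \<open>
  The event that some element of the random basis has an \<open>L^q\<close> norm deviating by more than \<open>r\<close> from
  the prescribed values \<open>M k\<close>. The sample space \<open>\<Pi>\<^sub>M k. \<nu> k\<close> consists of sequences of matrices.
\<close>

definition deviation_event ::
    "nat \<Rightarrow> (nat \<Rightarrow> nat \<Rightarrow> real^'n \<Rightarrow> 'k::real_normed_field) \<Rightarrow> (nat \<Rightarrow> (nat \<times> nat \<Rightarrow> 'k) measure)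
      \<Rightarrow> real \<Rightarrow> (nat \<Rightarrow> real) \<Rightarrow> real \<Rightarrow> (nat \<Rightarrow> nat \<times> nat \<Rightarrow> 'k) set" where
  "deviation_event d e \<nu> q M r =
     {U \<in> space (\<Pi>\<^sub>M k\<in>UNIV. \<nu> k).
        \<exists>k. \<exists>l<harm_dim d k. \<bar>Lq_norm q (basis_of (harm_dim d k) (e k) (U k) l) - M k\<bar> > r}"

subsection \<open>Uniform probability on the unit sphere and medians\<close>

text \<open>
  The uniform probability on the unit sphere of \<open>'k^N\<close> is the law of \<open>a / |a|\<close> for \<open>a\<close> uniform in the
  unit ball. It is transported to the unit sphere of the spherical harmonics of degree \<open>k\<close> by the
  isometry \<^term>\<open>lin_comb N e\<close>.
\<close>

definition uniform_unit_sphere :: "nat \<Rightarrow> (nat \<Rightarrow> 'k::euclidean_space) measure" where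
  "uniform_unit_sphere N =
     distr
       (uniform_measure (\<Pi>\<^sub>M _\<in>{..<N}. lborel)
          {a \<in> space (\<Pi>\<^sub>M _\<in>{..<N}. lborel). L2_set (\<lambda>i. norm (a i)) {..<N} \<le> 1})
       (\<Pi>\<^sub>M _\<in>{..<N}. borel)
       (\<lambda>a. \<lambda>i\<in>{..<N}. a i /\<^sub>R L2_set (\<lambda>j. norm (a j)) {..<N})"

definition is_median :: "'a measure \<Rightarrow> ('a \<Rightarrow> real) \<Rightarrow> real \<Rightarrow> bool" where
  "is_median P F m \<longleftrightarrow>
     measure P {a \<in> space P. F a \<ge> m} \<ge> 1 / 2 \<and> measure P {a \<in> space P. F a \<le> m} \<ge> 1 / 2"

definition is_Lq_median ::
    "nat \<Rightarrow> (nat \<Rightarrow> real^'n \<Rightarrow> 'k::{real_normed_field,euclidean_space}) \<Rightarrow> real \<Rightarrow> real \<Rightarrow> bool" where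
  "is_Lq_median N e q m \<longleftrightarrow>
     is_median (uniform_unit_sphere N) (\<lambda>a. Lq_norm q (lin_comb N e a)) m"

text \<open>\<open>V\<close> stands for the volume of the sphere and \<open>N\<close> for the dimension of the space of harmonics.\<close>

definition A_const :: "real \<Rightarrow> nat \<Rightarrow> real \<Rightarrow> real" where
  "A_const V N q =
     real N powr (1 / 2) / V powr (1 / 2 - 1 / q) *
     (q * (Gamma (q / 2) * Gamma (real N) / (2 * Gamma (q / 2 + real N)))) powr (1 / q)"

end

theory Submission
  imports Defs
begin

text \<open>
  On the unit sphere of the space \<open>E^k\<close> of dimension \<open>N\<close>, the \<open>L^q\<close> norm is Lipschitz with constant
  \<open>(N / Vol) powr (1/2 - 1/q)\<close>: by rotation invariance \<open>\<Sum>\<^sub>m \<bar>e\<^sub>m(x)\<bar>^2 = N / Vol\<close> for every \<open>x\<close>, which bounds the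
  supremum norm by the \<open>L^2\<close> norm. Levy's inequality therefore gives deviations of probability at most
  \<open>16 exp (-c N^(2/q) r^2)\<close>. Each column of a Haar distributed matrix is uniform on the sphere, so a
  union bound over the \<open>N\<close> columns and over \<open>k\<close>, with \<open>N \<ge> k + 1\<close>, gives the first two estimates.
  For the third one, \<open>A\<^sub>q\<^sub>,\<^sub>k\<close> is the \<open>L^q\<close> mean of the \<open>L^q\<close> norm: by Fubini and unitary invariance it reduces
  to the moment of a single coordinate. By Minkowski's inequality its distance to the median is at
  most the \<open>L^q\<close> mean of the deviation, which the tail estimate bounds by \<open>C sqrt q / N^(1/q)\<close>.
\<close>

subsection \<open>The Prekopa--Leindler inequality\<close>

text \<open>The invariance of Lebesgue measure under unitary and orthogonal maps and the law of the
  columns of a Haar matrix both come from one device: a double integral evaluated in two orders.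
  Levy's inequality rests on Brunn--Minkowski in the product form \<open>|A| |B| \<le> |C|^2\<close>
  for midpoints, in which no dimension occurs. It is derived from Prekopa--Leindler because that
  inequality, unlike the additive Brunn--Minkowski inequality on the line, passes to product
  measures by induction on the coordinates. Two obstacles shape the union bound. Its rate must not
  depend on \<open>q\<close>, although \<open>N^(2/q)\<close> grows ever more slowly; beating the
  polynomial factors is paid for by the constant \<open>C_q\<close>. For small \<open>r\<close> the
  sum gives nothing, so \<open>r < 1\<close> is left to the trivial bound 1, while for
  \<open>r \<ge> 1\<close> the inequality \<open>N^(2/q) r^2 \<ge> (N^(2/q) + r^2) / 2\<close>
  separates dimension from \<open>r\<close> at the cost of half the rate. Both scalar fields are
  treated together up to the Gamma formula, which is complex: there the real dimension is
  \<open>2 N\<close>, and the squared radius brings it back to \<open>N\<close>.\<close>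

lemma ennreal_am_gm:
  fixes a b c :: ennreal
  assumes "a + b \<le> 2 * c"
  shows "a * b \<le> c\<^sup>2"
proof (cases "c = top")
  case False
  hence fin: "2 * c < top" by (simp add: ennreal_mult_less_top less_top)
  have "a \<le> a + b" "b \<le> a + b" by auto
  hence "a < top" "b < top" using assms fin by (meson order_trans le_less_trans)+
  then obtain x y where xy: "a = ennreal x" "b = ennreal y" "x \<ge> 0" "y \<ge> 0"
    by (metis enn2real_nonneg ennreal_enn2real)
  obtain z where z: "c = ennreal z" "z \<ge> 0" using False by (metis ennreal_cases)
  have "ennreal (x + y) \<le> ennreal (2 * z)"
    using assms xy z by (simp add: ennreal_plus ennreal_mult)
  hence s: "x + y \<le> 2 * z" using z by (simp add: ennreal_le_iff)
  have "4 * (x * y) \<le> (x + y)\<^sup>2" using zero_le_power2[of "x - y"] by (simp add: power2_eq_square algebra_simps)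
  also have "\<dots> \<le> (2 * z)\<^sup>2" using s xy by (intro power_mono) auto
  finally have "x * y \<le> z\<^sup>2" by (simp add: power_mult_distrib)
  thus ?thesis using xy z by (simp flip: ennreal_mult add: ennreal_power)
qed (simp add: power2_eq_square ennreal_top_mult)

section \<open>Brunn--Minkowski on the real line\<close>

lemma emeasure_lborel_affine_vimage:
  fixes t :: "'a::euclidean_space"
  assumes "c \<noteq> 0" "A \<in> sets borel"
  shows "ennreal (\<bar>c\<bar> ^ DIM('a)) * emeasure lborel ((\<lambda>x. t + c *\<^sub>R x) -` A) = emeasure lborel A"
proof -
  have "emeasure lborel A = emeasure (density (distr lborel borel (\<lambda>x. t + c *\<^sub>R x)) (\<lambda>_. \<bar>c\<bar> ^ DIM('a))) A"
    using lborel_affine[OF assms(1), of t] by simp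
  also have "\<dots> = ennreal (\<bar>c\<bar> ^ DIM('a)) * emeasure (distr lborel borel (\<lambda>x. t + c *\<^sub>R x)) A"
    using assms(2) by (subst emeasure_density) (simp_all add: nn_integral_cmult_indicator)
  also have "emeasure (distr lborel borel (\<lambda>x. t + c *\<^sub>R x)) A = emeasure lborel ((\<lambda>x. t + c *\<^sub>R x) -` A)"
    using assms(2) by (subst emeasure_distr) auto
  finally show ?thesis by simp
qed

text \<open>Inside each ball \<open>cball 0 n\<close> the closed inner approximations are bounded,
  hence compact; monotone convergence in \<open>n\<close> removes the truncation. Compact sets are
  wanted because they have a greatest and a least element.\<close>

lemma lborel_inner_regular:
  fixes A :: "'a::euclidean_space set"
  assumes A: "A \<in> sets borel"
  shows "emeasure lborel A = (SUP K\<in>{K. compact K \<and> K \<subseteq> A}. emeasure lborel K)"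
proof (rule antisym)
  let ?S = "SUP K\<in>{K. compact K \<and> K \<subseteq> A}. emeasure lborel K"
  have fin: "emeasure lborel (A \<inter> cball 0 (real n)) \<le> ?S" for n
  proof (rule ennreal_le_epsilon)
    fix \<epsilon> :: real assume "\<epsilon> > 0"
    let ?B = "A \<inter> cball 0 (real n)"
    have B: "?B \<in> sets borel" using A by auto
    hence "?B \<in> sets lebesgue" by (simp add: sets_completionI_sets)
    then obtain T where T: "closed T" "T \<subseteq> ?B" "?B - T \<in> lmeasurable" "emeasure lebesgue (?B - T) < ennreal \<epsilon>"
      using sets_lebesgue_inner_closed \<open>\<epsilon> > 0\<close> by metis
    have "compact T" using T(1,2) by (meson bounded_cball bounded_subset compact_eq_bounded_closed le_inf_iff)
    have Ts: "T \<in> sets borel" using T(1) by auto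
    have "emeasure lborel ?B \<le> emeasure lborel T + emeasure lborel (?B - T)"
      using B Ts by (metis Diff_partition T(2) emeasure_subadditive sets.Diff sets_lborel)
    also have "emeasure lborel (?B - T) = emeasure lebesgue (?B - T)"
      using B Ts by (simp add: emeasure_completion main_part_sets)
    also have "emeasure lborel T + emeasure lebesgue (?B - T) \<le> ?S + ennreal \<epsilon>"
      using T(2,4) \<open>compact T\<close> by (intro add_mono SUP_upper) auto
    finally show "emeasure lborel ?B \<le> ?S + ennreal \<epsilon>" .
  qed
  have "emeasure lborel A = emeasure lborel (\<Union>n. A \<inter> cball 0 (real n))"
    by (intro arg_cong[where f = "emeasure lborel"]) (use real_arch_simple in auto)
  also have "\<dots> = (SUP n. emeasure lborel (A \<inter> cball 0 (real n)))"
    using A by (subst SUP_emeasure_incseq) (auto simp: incseq_def)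
  also have "\<dots> \<le> ?S" using fin by (auto intro: SUP_least)
  finally show "emeasure lborel A \<le> ?S" .
next
  show "(SUP K\<in>{K. compact K \<and> K \<subseteq> A}. emeasure lborel K) \<le> emeasure lborel A"
    using A by (intro SUP_least emeasure_mono) auto
qed

text \<open>With \<open>a = Max K\<close> and \<open>b = Min L\<close>, the half-size copies
  \<open>P = (K + b) / 2\<close> and \<open>Q = (a + L) / 2\<close> consist of midpoints, so both
  lie in \<open>C\<close>. \<open>P\<close> lies to the left of \<open>midpoint a b\<close> and
  \<open>Q\<close> to the right, so they overlap in at most one point and their measures add up. A
  Borel set \<open>C\<close> containing the midpoints stands in for the half-sum, whose
  measurability is thus never an issue.\<close>

lemma brunn_minkowski_compact:
  fixes K L C :: "real set"
  assumes "compact K" "compact L" "K \<noteq> {}" "L \<noteq> {}"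
    and C: "C \<in> sets borel" "\<And>x y. x \<in> K \<Longrightarrow> y \<in> L \<Longrightarrow> midpoint x y \<in> C"
  shows "emeasure lborel K + emeasure lborel L \<le> 2 * emeasure lborel C"
proof -
  obtain a where a: "a \<in> K" "\<And>x. x \<in> K \<Longrightarrow> x \<le> a"
    using compact_attains_sup[OF assms(1,3)] by auto
  obtain b where b: "b \<in> L" "\<And>x. x \<in> L \<Longrightarrow> b \<le> x"
    using compact_attains_inf[OF assms(2,4)] by auto
  have KL: "K \<in> sets borel" "L \<in> sets borel" using assms by (auto simp: compact_imp_closed)
  define P where "P = (\<lambda>z. - b + 2 *\<^sub>R z) -` K"
  define Q where "Q = (\<lambda>z. - a + 2 *\<^sub>R z) -` L"
  let ?m = "midpoint a b"
  have PQ: "P \<in> sets borel" "Q \<in> sets borel"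
    unfolding P_def Q_def using KL by (auto intro!: measurable_sets_borel[of _ borel])
  have mP: "2 * emeasure lborel P = emeasure lborel K" and mQ: "2 * emeasure lborel Q = emeasure lborel L"
    using emeasure_lborel_affine_vimage[of 2 K "-b"] emeasure_lborel_affine_vimage[of 2 L "-a"] KL
    by (auto simp: P_def Q_def)
  have PC: "P \<subseteq> C"
  proof
    fix z assume "z \<in> P"
    hence "midpoint (- b + 2 *\<^sub>R z) b \<in> C" using C(2) b by (auto simp: P_def)
    thus "z \<in> C" by (simp add: midpoint_def)
  qed
  have QC: "Q \<subseteq> C"
  proof
    fix z assume "z \<in> Q"
    hence "midpoint a (- a + 2 *\<^sub>R z) \<in> C" using C(2) a by (auto simp: Q_def)
    thus "z \<in> C" by (simp add: midpoint_def)
  qed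
  have "P \<inter> Q \<subseteq> {?m}"
  proof
    fix z assume "z \<in> P \<inter> Q"
    hence "- b + 2 * z \<le> a" "b \<le> - a + 2 * z" using a b by (auto simp: P_def Q_def)
    thus "z \<in> {?m}" by (simp add: midpoint_def)
  qed
  hence "emeasure lborel (P - {?m}) + emeasure lborel (Q - {?m}) = emeasure lborel ((P - {?m}) \<union> (Q - {?m}))"
    using PQ by (intro plus_emeasure) auto
  also have "\<dots> \<le> emeasure lborel C" using PC QC C by (intro emeasure_mono) auto
  finally have "emeasure lborel P + emeasure lborel Q \<le> emeasure lborel C"
    using PQ finite_imp_null_set_lborel[of "{?m}"] emeasure_Diff_null_set[of "{?m}" lborel P] emeasure_Diff_null_set[of "{?m}" lborel Q] by simp
  hence "2 * (emeasure lborel P + emeasure lborel Q) \<le> 2 * emeasure lborel C" by (intro mult_left_mono) auto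
  thus ?thesis by (simp add: distrib_left mP mQ)
qed

lemma brunn_minkowski_real:
  fixes A B C :: "real set"
  assumes A: "A \<in> sets borel" "A \<noteq> {}" and B: "B \<in> sets borel" "B \<noteq> {}"
    and C: "C \<in> sets borel" "\<And>x y. x \<in> A \<Longrightarrow> y \<in> B \<Longrightarrow> midpoint x y \<in> C"
  shows "emeasure lborel A + emeasure lborel B \<le> 2 * emeasure lborel C"
proof -
  obtain a b where ab: "a \<in> A" "b \<in> B" using A B by auto
  have KL: "emeasure lborel K + emeasure lborel L \<le> 2 * emeasure lborel C"
    if "compact K" "K \<subseteq> A" "compact L" "L \<subseteq> B" for K L
  proof -
    \<comment> \<open>Inserting \<open>a\<close> and \<open>b\<close> makes both compact sets
      nonempty without leaving \<open>A\<close> and \<open>B\<close>; for an empty set the compact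
      inequality would be false.\<close>
    have "emeasure lborel K + emeasure lborel L \<le> emeasure lborel (insert a K) + emeasure lborel (insert b L)"
      using that by (intro add_mono emeasure_mono) (auto simp: compact_imp_closed)
    also have "\<dots> \<le> 2 * emeasure lborel C"
      using that ab C by (intro brunn_minkowski_compact) auto
    finally show ?thesis .
  qed
  have AL: "emeasure lborel A + emeasure lborel L \<le> 2 * emeasure lborel C" if "compact L" "L \<subseteq> B" for L
  proof -
    have "emeasure lborel A + emeasure lborel L
      = (SUP K\<in>{K. compact K \<and> K \<subseteq> A}. emeasure lborel K + emeasure lborel L)"
      unfolding lborel_inner_regular[OF A(1)] by (rule ennreal_SUP_add_left[symmetric]) (auto intro: exI[of _ "{}"])
    also have "\<dots> \<le> 2 * emeasure lborel C" using KL that by (auto intro: SUP_least)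
    finally show ?thesis .
  qed
  have "emeasure lborel A + emeasure lborel B
    = (SUP L\<in>{K. compact K \<and> K \<subseteq> B}. emeasure lborel A + emeasure lborel L)"
    unfolding lborel_inner_regular[OF B(1)] by (rule ennreal_SUP_add_right) (auto intro: exI[of _ "{}"])
  also have "\<dots> \<le> 2 * emeasure lborel C" using AL by (auto intro: SUP_least)
  finally show ?thesis .
qed

section \<open>Prekopa--Leindler on the real line\<close>

lemma nn_integral_layer_cake:
  fixes f :: "'a \<Rightarrow> ennreal"
  assumes "sigma_finite_measure M" and f[measurable]: "f \<in> borel_measurable M"
  shows "(\<integral>\<^sup>+x. f x \<partial>M) = (\<integral>\<^sup>+u. indicator {0..} u * emeasure M {x\<in>space M. ennreal u < f x} \<partial>lborel)"
proof -
  interpret sigma_finite_measure M by fact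
  interpret pair_sigma_finite lborel M by unfold_locales
  have 1: "(\<integral>\<^sup>+u. indicator {0..} u * indicator {u. ennreal u < y} u \<partial>lborel) = y" for y :: ennreal
  proof (cases y)
    case (real r)
    have "(\<integral>\<^sup>+u. indicator {0..} u * indicator {u. ennreal u < y} u \<partial>lborel) = (\<integral>\<^sup>+u. indicator {0..<r} u \<partial>lborel)"
      using real by (intro nn_integral_cong) (auto split: split_indicator simp: ennreal_less_iff)
    thus ?thesis using real by simp
  next
    case top
    have "(\<integral>\<^sup>+u. indicator {0..} u * indicator {u. ennreal u < y} u \<partial>lborel) = (\<integral>\<^sup>+u. indicator {0::real..} u \<partial>lborel)"
      using top by (intro nn_integral_cong) (auto split: split_indicator)
    also have "\<dots> = emeasure lborel {0::real..}" by (rule nn_integral_indicator) auto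
    also have "\<dots> = top"
    proof (rule ccontr)
      assume "emeasure lborel {0::real..} \<noteq> top"
      then obtain r where r: "emeasure lborel {0::real..} = ennreal r" "r \<ge> 0" by (metis ennreal_cases)
      have "emeasure lborel {0..r+1} \<le> emeasure lborel {0::real..}" by (intro emeasure_mono) auto
      thus False using r by (simp add: ennreal_le_iff)
    qed
    finally show ?thesis using top by simp
  qed
  have "(\<integral>\<^sup>+x. f x \<partial>M) = (\<integral>\<^sup>+x. (\<integral>\<^sup>+u. indicator {0..} u * indicator {u. ennreal u < f x} u \<partial>lborel) \<partial>M)"
    by (simp add: 1)
  also have "\<dots> = (\<integral>\<^sup>+u. (\<integral>\<^sup>+x. indicator {0..} u * indicator {u. ennreal u < f x} u \<partial>M) \<partial>lborel)"
    by (rule Fubini') measurable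
  also have "\<dots> = (\<integral>\<^sup>+u. indicator {0..} u * emeasure M {x\<in>space M. ennreal u < f x} \<partial>lborel)"
  proof (rule nn_integral_cong)
    fix u :: real
    have "(\<integral>\<^sup>+x. indicator {0..} u * indicator {u. ennreal u < f x} u \<partial>M)
      = (\<integral>\<^sup>+x. indicator {0..} u * indicator {x\<in>space M. ennreal u < f x} x \<partial>M)"
      by (intro nn_integral_cong) (auto split: split_indicator)
    also have "\<dots> = indicator {0..} u * emeasure M {x\<in>space M. ennreal u < f x}"
      by (rule nn_integral_cmult_indicator) measurable
    finally show "(\<integral>\<^sup>+x. indicator {0..} u * indicator {u. ennreal u < f x} u \<partial>M)
      = indicator {0..} u * emeasure M {x\<in>space M. ennreal u < f x}" .
  qed
  finally show ?thesis .
qed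

text \<open>Midpoints of the level sets \<open>f > u\<close> and \<open>g > u\<close> lie in
  \<open>h > u\<close>, so Brunn--Minkowski applies at each level and integrating over
  \<open>u\<close> gives the stronger additive bound
  \<open>\<integral> f + \<integral> g \<le> 2 \<integral> h\<close>. Equal suprema are essential:
  both level sets are nonempty for \<open>u < 1\<close> and both are empty from 1 on.\<close>

lemma prekopa_leindler_normalized:
  fixes f g h :: "real \<Rightarrow> ennreal"
  assumes [measurable]: "f \<in> borel_measurable borel" "g \<in> borel_measurable borel" "h \<in> borel_measurable borel"
    and sup: "(SUP x. f x) = 1" "(SUP x. g x) = 1"
    and h: "\<And>x y. f x * g y \<le> (h (midpoint x y))\<^sup>2"
  shows "(\<integral>\<^sup>+x. f x \<partial>lborel) * (\<integral>\<^sup>+x. g x \<partial>lborel) \<le> (\<integral>\<^sup>+x. h x \<partial>lborel)\<^sup>2"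
proof (rule ennreal_am_gm)
  have f1: "f x \<le> 1" and g1: "g x \<le> 1" for x
    using SUP_upper[of x UNIV f] SUP_upper[of x UNIV g] sup by auto
  let ?e = "\<lambda>f u. indicator {0..} u * emeasure lborel {x\<in>space lborel. ennreal u < f x}"
  have meas: "?e f \<in> borel_measurable lborel" if [measurable]: "f \<in> borel_measurable borel"
    for f :: "real \<Rightarrow> ennreal"
  proof -
    have "{x\<in>space lborel. ennreal u < f x} = Pair u -` {(u,x). ennreal u < f x}" for u by auto
    moreover have "{(u,x). ennreal u < f x} \<in> sets (lborel \<Otimes>\<^sub>M lborel)"
    proof -
      have "{p\<in>space (lborel \<Otimes>\<^sub>M lborel). ennreal (fst p) < f (snd p)} \<in> sets (lborel \<Otimes>\<^sub>M lborel)" by measurable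
      thus ?thesis by (simp add: space_pair_measure case_prod_unfold)
    qed
    hence "(\<lambda>u. emeasure lborel (Pair u -` {(u,x). ennreal u < f x})) \<in> borel_measurable lborel"
      by (rule lborel.measurable_emeasure_Pair)
    ultimately show ?thesis by (intro borel_measurable_times_ennreal) auto
  qed
  have le: "?e f u + ?e g u \<le> 2 * ?e h u" for u
  proof (cases "0 \<le> u \<and> u < 1")
    case True
    have "emeasure lborel {x\<in>space lborel. ennreal u < f x} + emeasure lborel {x\<in>space lborel. ennreal u < g x}
      \<le> 2 * emeasure lborel {x\<in>space lborel. ennreal u < h x}"
    proof (rule brunn_minkowski_real)
      have u1: "ennreal u < 1" using True by (simp add: ennreal_less_one_iff)
      have "\<exists>x. ennreal u < k x" if "(SUP x. k x) = 1" for k :: "real \<Rightarrow> ennreal"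
        using u1 unfolding that[symmetric] less_SUP_iff by blast
      thus "{x\<in>space lborel. ennreal u < f x} \<noteq> {}" "{x\<in>space lborel. ennreal u < g x} \<noteq> {}"
        using sup by simp_all
      show "midpoint x y \<in> {x\<in>space lborel. ennreal u < h x}"
        if "x \<in> {x\<in>space lborel. ennreal u < f x}" "y \<in> {x\<in>space lborel. ennreal u < g x}" for x y
      proof (rule ccontr)
        assume "midpoint x y \<notin> {x\<in>space lborel. ennreal u < h x}"
        hence "h (midpoint x y) \<le> ennreal u" by auto
        hence "(h (midpoint x y))\<^sup>2 \<le> ennreal u * ennreal u"
          unfolding power2_eq_square by (intro mult_mono) auto
        moreover have "ennreal u * ennreal u < f x * g y"
        \<comment> \<open>Multiplying a strict inequality by \<open>u\<close> stays strict only for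
          \<open>u > 0\<close>; at \<open>u = 0\<close> both factors on the right are
          positive.\<close>
        proof (cases "u = 0")
          case False
          hence "ennreal u * ennreal u < f x * ennreal u"
            using that True by (intro ennreal_mult_strict_right_mono) auto
          also have "\<dots> \<le> f x * g y" using that by (intro mult_left_mono) auto
          finally show ?thesis .
        qed (use that in \<open>auto simp: ennreal_zero_less_mult_iff\<close>)
        ultimately show False using h[of x y] by auto
      qed
    qed (measurable)
    thus ?thesis using True by simp
  next
    case False
    then consider "u < 0" | "u \<ge> 1" by linarith
    thus ?thesis
    proof cases
      case 2
      hence u1: "1 \<le> ennreal u" by (simp add: ennreal_ge_1)
      have "\<not> ennreal u < f x" "\<not> ennreal u < g x" for x
        using order_trans[OF f1 u1, of x] order_trans[OF g1 u1, of x] by (simp_all only: not_less)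
      thus ?thesis by simp
    qed simp
  qed
  have layer: "(\<integral>\<^sup>+x. f x \<partial>lborel) = (\<integral>\<^sup>+u. ?e f u \<partial>lborel)" if "f \<in> borel_measurable borel"
    for f :: "real \<Rightarrow> ennreal"
    by (rule nn_integral_layer_cake[OF lborel.sigma_finite_measure_axioms]) (use that in simp)
  have "(\<integral>\<^sup>+x. f x \<partial>lborel) + (\<integral>\<^sup>+x. g x \<partial>lborel) = (\<integral>\<^sup>+u. ?e f u + ?e g u \<partial>lborel)"
    unfolding layer[OF assms(1)] layer[OF assms(2)]
    by (rule nn_integral_add[symmetric]) (intro meas assms)+
  also have "\<dots> \<le> (\<integral>\<^sup>+u. 2 * ?e h u \<partial>lborel)" by (intro nn_integral_mono le)
  also have "\<dots> = 2 * (\<integral>\<^sup>+u. ?e h u \<partial>lborel)" by (intro nn_integral_cmult meas assms)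
  also have "\<dots> = 2 * (\<integral>\<^sup>+x. h x \<partial>lborel)" by (simp only: layer[OF assms(3)])
  finally show "(\<integral>\<^sup>+x. f x \<partial>lborel) + (\<integral>\<^sup>+x. g x \<partial>lborel) \<le> 2 * (\<integral>\<^sup>+x. h x \<partial>lborel)" .
qed

text \<open>Homogeneity: dividing \<open>f\<close>, \<open>g\<close>, \<open>h\<close> by
  \<open>s\<close>, \<open>t\<close>, \<open>sqrt (s * t)\<close> preserves the hypothesis and
  normalises both suprema. If one supremum is 0, the left-hand side vanishes.\<close>

lemma prekopa_leindler_bounded:
  fixes f g h :: "real \<Rightarrow> ennreal"
  assumes [measurable]: "f \<in> borel_measurable borel" "g \<in> borel_measurable borel" "h \<in> borel_measurable borel"
    and sup: "(SUP x. f x) < top" "(SUP x. g x) < top"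
    and h: "\<And>x y. f x * g y \<le> (h (midpoint x y))\<^sup>2"
  shows "(\<integral>\<^sup>+x. f x \<partial>lborel) * (\<integral>\<^sup>+x. g x \<partial>lborel) \<le> (\<integral>\<^sup>+x. h x \<partial>lborel)\<^sup>2"
proof -
  obtain s t where s: "(SUP x. f x) = ennreal s" "s \<ge> 0" and t: "(SUP x. g x) = ennreal t" "t \<ge> 0"
    using sup by (metis ennreal_cases less_irrefl)
  show ?thesis
  proof (cases "s = 0 \<or> t = 0")
    case True
    have "f x \<le> ennreal s" "g x \<le> ennreal t" for x
      using SUP_upper[of x UNIV f] SUP_upper[of x UNIV g] s t by auto
    hence "f = (\<lambda>_. 0) \<or> g = (\<lambda>_. 0)" using True by fastforce
    thus ?thesis by auto
  next
    case False
    hence pos: "s > 0" "t > 0" using s t by auto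
    let ?S = "ennreal (1/s)" and ?T = "ennreal (1/t)" and ?R = "ennreal (1 / sqrt (s*t))"
    have R2: "?R\<^sup>2 = ?S * ?T"
      using pos by (simp add: ennreal_power power_divide flip: ennreal_mult)
    have "(\<integral>\<^sup>+x. ?S * f x \<partial>lborel) * (\<integral>\<^sup>+x. ?T * g x \<partial>lborel) \<le> (\<integral>\<^sup>+x. ?R * h x \<partial>lborel)\<^sup>2"
    proof (rule prekopa_leindler_normalized)
      show "(SUP x. ?S * f x) = 1" using s pos by (simp flip: SUP_mult_left_ennreal ennreal_mult)
      show "(SUP x. ?T * g x) = 1" using t pos by (simp flip: SUP_mult_left_ennreal ennreal_mult)
      show "?S * f x * (?T * g y) \<le> (?R * h (midpoint x y))\<^sup>2" for x y
        using mult_left_mono[OF h[of x y], of "?S * ?T"] by (simp add: power_mult_distrib R2 mult_ac)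
    qed measurable
    hence "(?S * ?T) * ((\<integral>\<^sup>+x. f x \<partial>lborel) * (\<integral>\<^sup>+x. g x \<partial>lborel)) \<le> (?S * ?T) * (\<integral>\<^sup>+x. h x \<partial>lborel)\<^sup>2"
      by (subst (asm) (1 2 3) nn_integral_cmult) (auto simp: power_mult_distrib R2 mult_ac)
    thus ?thesis using pos by (subst (asm) ennreal_mult_le_mult_iff) (auto simp flip: ennreal_mult)
  qed
qed

text \<open>Truncating \<open>f\<close> and \<open>g\<close> at integer heights, with
  \<open>h\<close> unchanged, only weakens the hypothesis; the two heights then tend to infinity
  separately.\<close>

lemma prekopa_leindler_unbounded:
  fixes f g h :: "real \<Rightarrow> ennreal"
  assumes [measurable]: "f \<in> borel_measurable borel" "g \<in> borel_measurable borel" "h \<in> borel_measurable borel"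
    and h: "\<And>x y. f x * g y \<le> (h (midpoint x y))\<^sup>2"
  shows "(\<integral>\<^sup>+x. f x \<partial>lborel) * (\<integral>\<^sup>+x. g x \<partial>lborel) \<le> (\<integral>\<^sup>+x. h x \<partial>lborel)\<^sup>2"
proof -
  have trunc: "(\<integral>\<^sup>+x. f x \<partial>lborel) = (SUP n. \<integral>\<^sup>+x. min (f x) (of_nat n) \<partial>lborel)"
    if [measurable]: "f \<in> borel_measurable borel" for f :: "real \<Rightarrow> ennreal"
  proof -
    have "(SUP n. min (f x) (of_nat n)) = f x" for x
    proof -
      have "(SUP n. min (f x) (of_nat n)) = min (f x) (SUP n. of_nat n)"
        by (simp add: inf_min[symmetric] inf_SUP)
      thus ?thesis by (simp add: ennreal_SUP_of_nat_eq_top)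
    qed
    hence "(\<integral>\<^sup>+x. f x \<partial>lborel) = (\<integral>\<^sup>+x. (SUP n. min (f x) (of_nat n)) \<partial>lborel)" by simp
    also have "\<dots> = (SUP n. \<integral>\<^sup>+x. min (f x) (of_nat n) \<partial>lborel)"
      by (intro nn_integral_monotone_convergence_SUP) (auto simp: incseq_def le_fun_def min.coboundedI2)
    finally show ?thesis .
  qed
  have b: "(\<integral>\<^sup>+x. min (f x) (of_nat n) \<partial>lborel) * (\<integral>\<^sup>+x. min (g x) (of_nat m) \<partial>lborel) \<le> (\<integral>\<^sup>+x. h x \<partial>lborel)\<^sup>2" for n m
  proof (rule prekopa_leindler_bounded)
    have "(SUP x. min (f x) (of_nat n)) \<le> of_nat n" "(SUP x. min (g x) (of_nat m)) \<le> of_nat m"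
      by (auto intro: SUP_least)
    thus "(SUP x. min (f x) (of_nat n)) < top" "(SUP x. min (g x) (of_nat m)) < top"
      by (auto intro: le_less_trans simp: of_nat_less_top)
    show "min (f x) (of_nat n) * min (g y) (of_nat m) \<le> (h (midpoint x y))\<^sup>2" for x y
      using h by (rule order_trans[rotated]) (intro mult_mono; simp)
  qed measurable
  show ?thesis
    unfolding trunc[OF assms(1)] trunc[OF assms(2)]
    by (auto simp: SUP_mult_left_ennreal SUP_mult_right_ennreal intro!: SUP_least b)
qed

text \<open>The midpoint operation is a parameter because the spaces of product measures consist of
  extensional functions, where midpoints must be restricted to the index set. In this form the
  property passes to image measures and to finite products.\<close>

definition prekopa_leindler :: "'a measure \<Rightarrow> ('a \<Rightarrow> 'a \<Rightarrow> 'a) \<Rightarrow> bool" where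
  "prekopa_leindler M mid \<longleftrightarrow>
     (\<forall>x\<in>space M. \<forall>y\<in>space M. mid x y \<in> space M) \<and>
     (\<forall>f\<in>borel_measurable M. \<forall>g\<in>borel_measurable M. \<forall>h\<in>borel_measurable M.
        (\<forall>x\<in>space M. \<forall>y\<in>space M. f x * g y \<le> (h (mid x y) :: ennreal)\<^sup>2) \<longrightarrow>
        (\<integral>\<^sup>+x. f x \<partial>M) * (\<integral>\<^sup>+x. g x \<partial>M) \<le> (\<integral>\<^sup>+x. h x \<partial>M)\<^sup>2)"

lemma prekopa_leindlerD:
  fixes f g h :: "'a \<Rightarrow> ennreal"
  assumes "prekopa_leindler M mid" "f \<in> borel_measurable M" "g \<in> borel_measurable M" "h \<in> borel_measurable M"
    and "\<And>x y. x \<in> space M \<Longrightarrow> y \<in> space M \<Longrightarrow> f x * g y \<le> (h (mid x y))\<^sup>2"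
  shows "(\<integral>\<^sup>+x. f x \<partial>M) * (\<integral>\<^sup>+x. g x \<partial>M) \<le> (\<integral>\<^sup>+x. h x \<partial>M)\<^sup>2"
  using assms unfolding prekopa_leindler_def by blast

lemma prekopa_leindler_real: "prekopa_leindler (lborel :: real measure) midpoint"
  unfolding prekopa_leindler_def using prekopa_leindler_unbounded by auto

lemma prekopa_leindler_distr:
  assumes M: "prekopa_leindler M mid" and T: "T \<in> measurable M N"
    and mid: "\<And>x y. x \<in> space M \<Longrightarrow> y \<in> space M \<Longrightarrow> T (mid x y) = mid' (T x) (T y)"
    and "\<And>x y. x \<in> space N \<Longrightarrow> y \<in> space N \<Longrightarrow> mid' x y \<in> space N"
  shows "prekopa_leindler (distr M N T) mid'"
  unfolding prekopa_leindler_def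
proof (intro conjI ballI impI)
  fix f g h :: "'b \<Rightarrow> ennreal"
  assume "f \<in> borel_measurable (distr M N T)" "g \<in> borel_measurable (distr M N T)" "h \<in> borel_measurable (distr M N T)"
    and h: "\<forall>x\<in>space (distr M N T). \<forall>y\<in>space (distr M N T). f x * g y \<le> (h (mid' x y))\<^sup>2"
  hence [measurable]: "f \<in> borel_measurable N" "g \<in> borel_measurable N" "h \<in> borel_measurable N" by auto
  note T[measurable]
  have "(\<integral>\<^sup>+x. f (T x) \<partial>M) * (\<integral>\<^sup>+x. g (T x) \<partial>M) \<le> (\<integral>\<^sup>+x. h (T x) \<partial>M)\<^sup>2"
    using h measurable_space[OF T] by (intro prekopa_leindlerD[OF M]) (auto simp: mid)
  thus "(\<integral>\<^sup>+x. f x \<partial>distr M N T) * (\<integral>\<^sup>+x. g x \<partial>distr M N T) \<le> (\<integral>\<^sup>+x. h x \<partial>distr M N T)\<^sup>2"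
    by (simp add: nn_integral_distr)
qed (use assms in auto)

text \<open>Freezing one coordinate at \<open>u\<close>, \<open>v\<close> and
  \<open>mid i u v\<close>, the induction hypothesis for the sections is exactly the pointwise
  hypothesis for the partial integrals \<open>?s f\<close>, \<open>?s g\<close>,
  \<open>?s h\<close>, to which the one-coordinate inequality then applies.\<close>

lemma prekopa_leindler_PiM:
  assumes "\<And>i. sigma_finite_measure (M i)" and M: "\<And>i. i \<in> I \<Longrightarrow> prekopa_leindler (M i) (mid i)" and "finite I"
  shows "prekopa_leindler (\<Pi>\<^sub>M i\<in>I. M i) (\<lambda>x y. \<lambda>i\<in>I. mid i (x i) (y i))"
  using \<open>finite I\<close> M
proof (induction I rule: finite_induct)
  case empty
  show ?case by (auto simp: prekopa_leindler_def PiM_empty space_PiM power2_eq_square nn_integral_count_space_finite)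
next
  case (insert i I)
  interpret product_sigma_finite M by (rule product_sigma_finite.intro) (rule assms(1))
  let ?m = "\<lambda>I x y. \<lambda>i\<in>I. mid i (x i) (y i)"
  have mi: "mid i x y \<in> space (M i)" if "x \<in> space (M i)" "y \<in> space (M i)" for x y
    using insert.prems[of i] that by (auto simp: prekopa_leindler_def)
  have IH: "prekopa_leindler (\<Pi>\<^sub>M i\<in>I. M i) (?m I)" using insert.IH insert.prems by blast
  show ?case unfolding prekopa_leindler_def
  proof (intro conjI ballI impI)
    fix x y assume "x \<in> space (\<Pi>\<^sub>M i\<in>insert i I. M i)" "y \<in> space (\<Pi>\<^sub>M i\<in>insert i I. M i)"
    thus "?m (insert i I) x y \<in> space (\<Pi>\<^sub>M i\<in>insert i I. M i)"
      using insert.prems by (auto simp: space_PiM PiE_iff prekopa_leindler_def)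
  next
    fix f g h :: "('a \<Rightarrow> 'b) \<Rightarrow> ennreal"
    assume fgh: "f \<in> borel_measurable (\<Pi>\<^sub>M i\<in>insert i I. M i)" "g \<in> borel_measurable (\<Pi>\<^sub>M i\<in>insert i I. M i)"
      "h \<in> borel_measurable (\<Pi>\<^sub>M i\<in>insert i I. M i)"
      and h: "\<forall>x\<in>space (\<Pi>\<^sub>M i\<in>insert i I. M i). \<forall>y\<in>space (\<Pi>\<^sub>M i\<in>insert i I. M i). f x * g y \<le> (h (?m (insert i I) x y))\<^sup>2"
    interpret I: finite_product_sigma_finite M I by standard fact
    have m2: "(\<lambda>(u, x). f (x(i := u))) \<in> borel_measurable (M i \<Otimes>\<^sub>M (\<Pi>\<^sub>M i\<in>I. M i))"
      if [measurable]: "f \<in> borel_measurable (\<Pi>\<^sub>M i\<in>insert i I. M i)" for f :: "('a \<Rightarrow> 'b) \<Rightarrow> ennreal"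
      by measurable
    let ?s = "\<lambda>f u. \<integral>\<^sup>+x. f (x(i := u)) \<partial>(\<Pi>\<^sub>M i\<in>I. M i)"
    have ms: "?s f \<in> borel_measurable (M i)" if "f \<in> borel_measurable (\<Pi>\<^sub>M i\<in>insert i I. M i)" for f
      using I.borel_measurable_nn_integral_fst[OF m2[OF that]] by simp
    have "(\<integral>\<^sup>+u. ?s f u \<partial>M i) * (\<integral>\<^sup>+u. ?s g u \<partial>M i) \<le> (\<integral>\<^sup>+u. ?s h u \<partial>M i)\<^sup>2"
    proof (rule prekopa_leindlerD[OF insert.prems[of i]])
      fix u v assume uv: "u \<in> space (M i)" "v \<in> space (M i)"
      have mc: "(\<lambda>x. f (x(i := w))) \<in> borel_measurable (\<Pi>\<^sub>M i\<in>I. M i)"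
        if "w \<in> space (M i)" "f \<in> borel_measurable (\<Pi>\<^sub>M i\<in>insert i I. M i)" for f :: "('a \<Rightarrow> 'b) \<Rightarrow> ennreal" and w
        using measurable_compose[OF measurable_Pair1'[OF that(1)] m2[OF that(2)]] by simp
      show "?s f u * ?s g v \<le> (?s h (mid i u v))\<^sup>2"
      proof (rule prekopa_leindlerD[OF IH])
        fix x y assume xy: "x \<in> space (\<Pi>\<^sub>M i\<in>I. M i)" "y \<in> space (\<Pi>\<^sub>M i\<in>I. M i)"
        have "x(i := u) \<in> space (\<Pi>\<^sub>M i\<in>insert i I. M i)" "y(i := v) \<in> space (\<Pi>\<^sub>M i\<in>insert i I. M i)"
          using xy uv by (auto simp: space_PiM PiE_iff extensional_def)
        moreover have "?m (insert i I) (x(i := u)) (y(i := v)) = (?m I x y)(i := mid i u v)"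
          using insert.hyps(2) by (auto simp: fun_eq_iff)
        ultimately show "f (x(i := u)) * g (y(i := v)) \<le> (h ((?m I x y)(i := mid i u v)))\<^sup>2"
          using h[rule_format, of "x(i := u)" "y(i := v)"] by (simp only:)
      qed (use mc uv mi fgh in auto)
    qed (use ms fgh in auto)
    thus "(\<integral>\<^sup>+x. f x \<partial>(\<Pi>\<^sub>M i\<in>insert i I. M i)) * (\<integral>\<^sup>+x. g x \<partial>(\<Pi>\<^sub>M i\<in>insert i I. M i))
        \<le> (\<integral>\<^sup>+x. h x \<partial>(\<Pi>\<^sub>M i\<in>insert i I. M i))\<^sup>2"
      using fgh by (simp add: product_nn_integral_insert_rev[OF insert.hyps(1,2)])
  qed
qed

text \<open>Lebesgue measure is the image of a product of real Lebesgue measures under a linear map,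
  and linear maps commute with midpoints.\<close>

lemma prekopa_leindler_lborel: "prekopa_leindler (lborel :: 'a::euclidean_space measure) midpoint"
proof -
  have "prekopa_leindler (\<Pi>\<^sub>M b\<in>Basis. lborel) (\<lambda>x y. \<lambda>b\<in>(Basis :: 'a set). midpoint (x b) (y b :: real))"
    by (intro prekopa_leindler_PiM prekopa_leindler_real lborel.sigma_finite_measure_axioms) auto
  hence "prekopa_leindler (distr (\<Pi>\<^sub>M b\<in>Basis. lborel) borel (\<lambda>f. \<Sum>b\<in>Basis. f b *\<^sub>R (b :: 'a))) midpoint"
    by (rule prekopa_leindler_distr)
      (auto simp: midpoint_def sum.distrib add_divide_distrib scaleR_sum_right scaleR_add_left scaleR_add_right intro!: sum.cong)
  thus ?thesis by (simp flip: lborel_eq)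
qed

text \<open>Prekopa--Leindler applied to indicator functions.\<close>

lemma brunn_minkowski_PiM:
  fixes A B C :: "('i \<Rightarrow> 'a::euclidean_space) set" and I :: "'i set"
  defines "M \<equiv> \<Pi>\<^sub>M _\<in>I. (lborel :: 'a measure)"
  assumes "finite I" and [measurable]: "A \<in> sets M" "B \<in> sets M" "C \<in> sets M"
    and C: "\<And>a b. a \<in> A \<Longrightarrow> b \<in> B \<Longrightarrow> (\<lambda>i\<in>I. midpoint (a i) (b i)) \<in> C"
  shows "emeasure M A * emeasure M B \<le> (emeasure M C)\<^sup>2"
proof -
  have "prekopa_leindler M (\<lambda>x y. \<lambda>i\<in>I. midpoint (x i) (y i))"
    unfolding M_def by (intro prekopa_leindler_PiM prekopa_leindler_lborel lborel.sigma_finite_measure_axioms) fact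
  hence "(\<integral>\<^sup>+x. indicator A x \<partial>M) * (\<integral>\<^sup>+x. indicator B x \<partial>M) \<le> (\<integral>\<^sup>+x. indicator C x \<partial>M)\<^sup>2"
    by (rule prekopa_leindlerD) (auto split: split_indicator simp: C)
  thus ?thesis by simp
qed

subsection \<open>Vectors and unitary matrices\<close>

text \<open>The common properties of \<^typ>\<open>real\<close> and \<^typ>\<open>complex\<close> that let both cases be treated at once.\<close>

class rc_field = real_normed_field + euclidean_space + conjugatable_field +
  assumes mult_conjugate_scaleR: "x * conjugate x = (norm x)\<^sup>2 *\<^sub>R 1"

instance real :: rc_field
  by standard (simp add: power2_eq_square)

instance complex :: rc_field
  by standard (simp add: complex_norm_square[symmetric] scaleR_conv_of_real del: of_real_power)

lemma mult_conjugate: "x * conjugate x = of_real ((norm (x :: 'k::rc_field))\<^sup>2)"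
  by (simp add: mult_conjugate_scaleR of_real_def)

lemma norm_conjugate [simp]: "norm (conjugate (x :: 'k::rc_field)) = norm x"
proof (cases "x = 0")
  case False
  have "norm x * norm (conjugate x) = norm x * norm x"
    using arg_cong[OF mult_conjugate[of x], of norm] by (simp add: norm_mult power2_eq_square)
  thus ?thesis using False by simp
qed simp

text \<open>For \<open>r \<ge> 0\<close> the scalar is \<open>x * conjugate x\<close> with
  \<open>x = of_real (sqrt r)\<close>, and such products are fixed by conjugation; negative
  \<open>r\<close> follow by the sign rule. The class itself says nothing about conjugation of real
  scalars.\<close>

lemma conjugate_of_real [simp]: "conjugate (of_real r :: 'k::rc_field) = of_real r"
proof -
  have nn: "conjugate (of_real r :: 'k) = of_real r" if "r \<ge> 0" for r :: real
  proof -
    have r: "(of_real r :: 'k) = of_real (sqrt r) * conjugate (of_real (sqrt r))"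
      using that by (simp add: mult_conjugate del: of_real_power)
    show ?thesis by (subst (1 2) r) (simp add: conjugate_dist_mul mult.commute)
  qed
  show ?thesis
  proof (cases "r \<ge> 0")
    case False
    hence "conjugate (of_real (- r) :: 'k) = of_real (- r)" by (intro nn) auto
    thus ?thesis by (simp add: conjugate_neg)
  qed (rule nn)
qed

lemma conjugate_1 [simp]: "conjugate (1 :: 'k::rc_field) = 1"
  using conjugate_of_real[of 1] by (simp del: conjugate_of_real)

lemma conjugate_diff: "conjugate (x - y :: 'k::rc_field) = conjugate x - conjugate y"
  using conjugate_dist_add[of x "- y"] by (simp add: conjugate_neg)

lemma conjugate_divide: "conjugate (x / y :: 'k::rc_field) = conjugate x / conjugate y"
proof (cases "y = 0")
  case False
  hence "conjugate (x / y) * conjugate y = conjugate x" by (simp flip: conjugate_dist_mul)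
  thus ?thesis using False by (simp add: field_simps)
qed simp

lemma continuous_conjugate: "continuous_on A (conjugate :: 'k::rc_field \<Rightarrow> 'k)"
  by (rule continuous_onI) (metis conjugate_diff dist_norm norm_conjugate order_less_imp_le)

lemma measurable_conjugate [measurable]: "(conjugate :: 'k::rc_field \<Rightarrow> 'k) \<in> borel_measurable borel"
  by (intro borel_measurable_continuous_onI continuous_conjugate)

text \<open>Entries from \<open>N\<close> on are ignored, so sums and differences such as
  \<open>\<lambda>i. a i - b i\<close> need no restriction to the index set.\<close>

definition vec_norm :: "nat \<Rightarrow> (nat \<Rightarrow> 'k::real_normed_vector) \<Rightarrow> real" where
  "vec_norm N a = L2_set (\<lambda>i. norm (a i)) {..<N}"

lemma vec_norm_nonneg [simp]: "vec_norm N a \<ge> 0"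
  by (simp add: vec_norm_def L2_set_nonneg)

lemma vec_norm_power2: "(vec_norm N a)\<^sup>2 = (\<Sum>i<N. (norm (a i))\<^sup>2)"
  by (simp add: vec_norm_def L2_set_def sum_nonneg)

lemma vec_norm_cong: "(\<And>i. i < N \<Longrightarrow> a i = b i) \<Longrightarrow> vec_norm N a = vec_norm N b"
  by (simp add: vec_norm_def L2_set_def)

lemma vec_norm_scaleR: "vec_norm N (\<lambda>i. c *\<^sub>R a i) = \<bar>c\<bar> * vec_norm N a"
  by (simp add: vec_norm_def L2_set_left_distrib[symmetric] L2_set_right_distrib)

lemma vec_norm_add_le: "vec_norm N (\<lambda>i. a i + b i) \<le> vec_norm N a + vec_norm N b"
proof -
  have "vec_norm N (\<lambda>i. a i + b i) \<le> L2_set (\<lambda>i. norm (a i) + norm (b i)) {..<N}"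
    unfolding vec_norm_def by (intro L2_set_mono norm_triangle_ineq) auto
  also have "\<dots> \<le> vec_norm N a + vec_norm N b" unfolding vec_norm_def by (rule L2_set_triangle_ineq)
  finally show ?thesis .
qed

lemma vec_norm_eq_0_iff: "vec_norm N a = 0 \<longleftrightarrow> (\<forall>i<N. a i = 0)"
  by (auto simp: vec_norm_def L2_set_eq_0_iff)

lemma norm_le_vec_norm: "i < N \<Longrightarrow> norm (a i) \<le> vec_norm N a"
  unfolding vec_norm_def using member_le_L2_set[of "{..<N}" i "\<lambda>i. norm (a i)"] by simp

lemma vec_norm_inner: "of_real ((vec_norm N a)\<^sup>2) = (\<Sum>i<N. a i * conjugate (a i :: 'k::rc_field))"
  by (simp add: vec_norm_power2 mult_conjugate del: of_real_power)

lemma norm_sum_mult_le: "norm (\<Sum>i<N. a i * b i :: 'k::real_normed_field) \<le> vec_norm N a * vec_norm N b"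
proof -
  have "norm (\<Sum>i<N. a i * b i) \<le> (\<Sum>i<N. \<bar>norm (a i)\<bar> * \<bar>norm (b i)\<bar>)"
    by (intro order_trans[OF norm_sum]) (simp add: norm_mult)
  also have "\<dots> \<le> vec_norm N a * vec_norm N b" unfolding vec_norm_def by (rule L2_set_mult_ineq)
  finally show ?thesis .
qed

lemma vec_norm_parallelogram:
  fixes a b :: "nat \<Rightarrow> 'k::real_inner"
  shows "(vec_norm N (\<lambda>i. midpoint (a i) (b i)))\<^sup>2
    = ((vec_norm N a)\<^sup>2 + (vec_norm N b)\<^sup>2) / 2 - (vec_norm N (\<lambda>i. a i - b i))\<^sup>2 / 4"
proof -
  have "(norm (midpoint x y))\<^sup>2 = ((norm x)\<^sup>2 + (norm y)\<^sup>2) / 2 - (norm (x - y))\<^sup>2 / 4" for x y :: 'k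
    unfolding midpoint_def power2_norm_eq_inner
    by (simp add: inner_add_left inner_add_right inner_diff_left inner_diff_right inner_commute field_simps)
  thus ?thesis by (simp add: vec_norm_power2 sum.distrib sum_subtractf sum_divide_distrib[symmetric] add_divide_distrib[symmetric])
qed

text \<open>The restriction keeps the result in the extensional functions, the space of the product
  measure.\<close>

definition mat_vec :: "nat \<Rightarrow> (nat \<times> nat \<Rightarrow> 'k::comm_ring_1) \<Rightarrow> (nat \<Rightarrow> 'k) \<Rightarrow> nat \<Rightarrow> 'k" where
  "mat_vec N V a = (\<lambda>i\<in>{..<N}. \<Sum>m<N. V (i, m) * a m)"

definition mat_adjoint :: "nat \<Rightarrow> (nat \<times> nat \<Rightarrow> 'k::conjugatable_field) \<Rightarrow> nat \<times> nat \<Rightarrow> 'k" where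
  "mat_adjoint N V = (\<lambda>(i, j)\<in>{..<N} \<times> {..<N}. conjugate (V (j, i)))"

lemma unitary_groupD:
  assumes "V \<in> unitary_group N" "i < N" "j < N"
  shows "(\<Sum>m<N. conjugate (V (m, i)) * V (m, j)) = (if i = j then 1 else 0)"
  using assms by (auto simp: unitary_group_def)

lemma sum_swap4:
  "(\<Sum>i\<in>A. \<Sum>j\<in>B. \<Sum>m\<in>C. \<Sum>n\<in>D. F i j m n) = (\<Sum>m\<in>C. \<Sum>n\<in>D. \<Sum>i\<in>A. \<Sum>j\<in>B. F i j m n)"
proof -
  have "(\<Sum>i\<in>A. \<Sum>j\<in>B. \<Sum>m\<in>C. \<Sum>n\<in>D. F i j m n) = (\<Sum>i\<in>A. \<Sum>m\<in>C. \<Sum>j\<in>B. \<Sum>n\<in>D. F i j m n)"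
    by (rule sum.cong[OF refl], rule sum.swap)
  also have "\<dots> = (\<Sum>m\<in>C. \<Sum>i\<in>A. \<Sum>j\<in>B. \<Sum>n\<in>D. F i j m n)" by (rule sum.swap)
  also have "\<dots> = (\<Sum>m\<in>C. \<Sum>i\<in>A. \<Sum>n\<in>D. \<Sum>j\<in>B. F i j m n)"
    by (rule sum.cong[OF refl], rule sum.cong[OF refl], rule sum.swap)
  also have "\<dots> = (\<Sum>m\<in>C. \<Sum>n\<in>D. \<Sum>i\<in>A. \<Sum>j\<in>B. F i j m n)"
    by (rule sum.cong[OF refl], rule sum.swap)
  finally show ?thesis .
qed

text \<open>\<open>unitary_group\<close> only says that the columns are orthonormal. For the Gram
  matrix \<open>P\<close> of the rows this gives \<open>tr P = N\<close> and squared Frobenius norm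
  \<open>N\<close>, so the squared Frobenius norm of \<open>P - I\<close> is
  \<open>N - 2 N + N = 0\<close>.\<close>

lemma unitary_group_rows:
  fixes V :: "nat \<times> nat \<Rightarrow> 'k::rc_field"
  assumes V: "V \<in> unitary_group N" and ij: "i < N" "j < N"
  shows "(\<Sum>m<N. V (i, m) * conjugate (V (j, m))) = (if i = j then 1 else 0)"
proof -
  define P where "P = (\<lambda>i j. \<Sum>m<N. V (i, m) * conjugate (V (j, m)))"
  define \<delta> :: "nat \<Rightarrow> nat \<Rightarrow> 'k" where "\<delta> = (\<lambda>i j. if i = j then 1 else 0)"
  have d: "(\<Sum>m<N. conjugate (V (m, i)) * V (m, j)) = \<delta> i j" if "i < N" "j < N" for i j
    using unitary_groupD[OF V that] by (simp add: \<delta>_def)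
  have tr: "(\<Sum>i<N. P i i) = of_nat N"
  proof -
    have "(\<Sum>i<N. P i i) = (\<Sum>m<N. \<Sum>i<N. conjugate (V (i, m)) * V (i, m))"
      unfolding P_def by (subst sum.swap) (simp add: mult.commute)
    also have "\<dots> = of_nat N" by (simp add: d \<delta>_def)
    finally show ?thesis .
  qed
  have PP: "(\<Sum>i<N. \<Sum>j<N. P i j * conjugate (P i j)) = of_nat N"
  proof -
    have "(\<Sum>i<N. \<Sum>j<N. P i j * conjugate (P i j))
      = (\<Sum>i<N. \<Sum>j<N. \<Sum>m<N. \<Sum>m'<N. (V (i, m) * conjugate (V (i, m'))) * (conjugate (V (j, m)) * V (j, m')))"
      by (simp add: P_def sum_conjugate sum_product conjugate_dist_mul mult_ac)
    also have "\<dots> = (\<Sum>m<N. \<Sum>m'<N. (\<Sum>i<N. V (i, m) * conjugate (V (i, m'))) * (\<Sum>j<N. conjugate (V (j, m)) * V (j, m')))"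
      unfolding sum_product by (rule sum_swap4)
    also have "\<dots> = (\<Sum>m<N. \<Sum>m'<N. \<delta> m' m * \<delta> m m')"
      by (intro sum.cong refl) (simp add: d mult.commute[of "V _"])
    also have "\<dots> = (\<Sum>m<N. \<Sum>m'<N. if m' = m then 1 else 0)"
      by (intro sum.cong refl) (simp add: \<delta>_def)
    also have "\<dots> = of_nat N" by simp
    finally show ?thesis .
  qed
  \<comment> \<open>Expansion of the squared Frobenius norm of \<open>P - I\<close>; only the
    diagonal contributes mixed terms.\<close>
  have "of_real (\<Sum>i<N. \<Sum>j<N. (norm (P i j - \<delta> i j))\<^sup>2)
    = (\<Sum>i<N. \<Sum>j<N. (P i j - \<delta> i j) * conjugate (P i j - \<delta> i j))"
    by (simp add: mult_conjugate del: of_real_power)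
  also have "\<dots> = (\<Sum>i<N. \<Sum>j<N. P i j * conjugate (P i j) - (if i = j then P i i + conjugate (P i i) - 1 else 0))"
    by (intro sum.cong refl) (simp add: \<delta>_def conjugate_diff algebra_simps)
  also have "\<dots> = (\<Sum>i<N. \<Sum>j<N. P i j * conjugate (P i j)) - (\<Sum>i<N. P i i + conjugate (P i i) - 1)"
    by (simp add: sum_subtractf)
  also have "\<dots> = of_nat N - ((\<Sum>i<N. P i i) + conjugate (\<Sum>i<N. P i i) - of_nat N)"
    by (simp add: PP sum_subtractf sum.distrib sum_conjugate)
  also have "\<dots> = 0" using conjugate_of_real[of "real N", where 'k='k] by (simp add: tr)
  finally have "(\<Sum>i<N. \<Sum>j<N. (norm (P i j - \<delta> i j))\<^sup>2) = 0" by (simp only: of_real_eq_0_iff)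
  hence "norm (P i j - \<delta> i j) = 0"
    using ij by (simp add: sum_nonneg_eq_0_iff sum_nonneg)
  thus ?thesis by (simp add: P_def \<delta>_def)
qed

lemma mat_adjoint_unitary:
  fixes V :: "nat \<times> nat \<Rightarrow> 'k::rc_field"
  assumes V: "V \<in> unitary_group N"
  shows "mat_adjoint N V \<in> unitary_group N"
  using unitary_group_rows[OF V] by (simp add: unitary_group_def mat_adjoint_def)

lemma mat_vec_cong: "(\<And>m. m < N \<Longrightarrow> a m = b m) \<Longrightarrow> mat_vec N V a = mat_vec N V b"
  by (auto simp: mat_vec_def fun_eq_iff)

lemma mat_vec_mat_vec:
  "mat_vec N V (mat_vec N W a) = mat_vec N (matrix_prod N V W) a"
proof
  fix i
  have "(\<Sum>m<N. V (i, m) * (\<Sum>j<N. W (m, j) * a j)) = (\<Sum>j<N. (\<Sum>m<N. V (i, m) * W (m, j)) * a j)"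
    by (simp add: sum_distrib_left sum_distrib_right mult.assoc) (rule sum.swap)
  thus "mat_vec N V (mat_vec N W a) i = mat_vec N (matrix_prod N V W) a i"
    by (simp add: mat_vec_def matrix_prod_def)
qed

lemma mat_vec_adjoint:
  fixes V :: "nat \<times> nat \<Rightarrow> 'k::rc_field"
  assumes V: "V \<in> unitary_group N" and a: "a \<in> extensional {..<N}"
  shows "mat_vec N (mat_adjoint N V) (mat_vec N V a) = a" "mat_vec N V (mat_vec N (mat_adjoint N V) a) = a"
proof -
  have id: "mat_vec N P a = a" if P: "\<And>i j. i < N \<Longrightarrow> j < N \<Longrightarrow> P (i, j) = (if i = j then 1 else 0)"
    for P :: "nat \<times> nat \<Rightarrow> 'k"
  proof
    fix i
    show "mat_vec N P a i = a i"
    proof (cases "i < N")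
      case True
      have "(\<Sum>m<N. P (i, m) * a m) = (\<Sum>m<N. if m = i then a m else 0)"
        using True by (intro sum.cong refl) (auto simp: P)
      thus ?thesis using True by (simp add: mat_vec_def)
    qed (use a in \<open>simp add: mat_vec_def extensional_def\<close>)
  qed
  show "mat_vec N (mat_adjoint N V) (mat_vec N V a) = a"
    unfolding mat_vec_mat_vec
    by (rule id) (simp add: matrix_prod_def mat_adjoint_def unitary_groupD[OF V])
  show "mat_vec N V (mat_vec N (mat_adjoint N V) a) = a"
    unfolding mat_vec_mat_vec
    by (rule id) (simp add: matrix_prod_def mat_adjoint_def unitary_group_rows[OF V])
qed

lemma vec_norm_mat_vec:
  fixes V :: "nat \<times> nat \<Rightarrow> 'k::rc_field"
  assumes V: "V \<in> unitary_group N"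
  shows "vec_norm N (mat_vec N V a) = vec_norm N a"
proof -
  have "(of_real ((vec_norm N (mat_vec N V a))\<^sup>2) :: 'k)
    = (\<Sum>i<N. \<Sum>m<N. \<Sum>m'<N. (a m * conjugate (a m')) * (conjugate (V (i, m')) * V (i, m)))"
    by (simp add: vec_norm_inner mat_vec_def sum_conjugate sum_product conjugate_dist_mul mult_ac del: of_real_power)
  also have "\<dots> = (\<Sum>m<N. \<Sum>m'<N. (a m * conjugate (a m')) * (\<Sum>i<N. conjugate (V (i, m')) * V (i, m)))"
    unfolding sum_distrib_left by (subst sum.swap) (intro sum.cong refl sum.swap)
  also have "\<dots> = (\<Sum>m<N. \<Sum>m'<N. if m' = m then a m * conjugate (a m) else 0)"
    using unitary_groupD[OF V] by (intro sum.cong refl) auto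
  also have "\<dots> = of_real ((vec_norm N a)\<^sup>2)" by (simp add: vec_norm_inner del: of_real_power)
  finally have "(vec_norm N (mat_vec N V a))\<^sup>2 = (vec_norm N a)\<^sup>2" by (simp only: of_real_eq_iff)
  thus ?thesis by (simp add: power2_eq_iff_nonneg)
qed

text \<open>
  A variant of the Householder reflection: with \<open>w = e\<^sub>l - x\<close>, the matrix \<open>I - w w\<^sup>* / (1 - conjugate x\<^sub>l)\<close>
  is unitary also over the complex numbers, and maps \<open>e\<^sub>l\<close> to \<open>x\<close>.
\<close>

lemma exists_unitary_column:
  fixes x :: "nat \<Rightarrow> 'k::rc_field"
  assumes x: "vec_norm N x = 1" and l: "l < N"
  obtains V where "V \<in> unitary_group N" "\<And>m. m < N \<Longrightarrow> V (m, l) = x m"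
proof (cases "x l = 1")
  \<comment> \<open>The reflection divides by \<open>1 - conjugate (x l)\<close>. When this is zero,
    the unit norm forces all other entries of \<open>x\<close> to vanish, and the identity matrix
    serves.\<close>
  case True
  have "(\<Sum>i\<in>{..<N} - {l}. (norm (x i))\<^sup>2) = 0"
    using x l True vec_norm_power2[of N x] by (simp add: sum.remove[of _ l])
  hence z: "\<forall>i\<in>{..<N} - {l}. x i = 0" by (subst (asm) sum_nonneg_eq_0_iff) auto
  define V :: "nat \<times> nat \<Rightarrow> 'k" where "V = (\<lambda>(i, j)\<in>{..<N} \<times> {..<N}. if i = j then 1 else 0)"
  have "(\<Sum>m<N. conjugate (V (m, i)) * V (m, j)) = (if i = j then 1 else 0)" if "i < N" "j < N" for i j
  proof -
    have "(\<Sum>m<N. conjugate (V (m, i)) * V (m, j)) = (\<Sum>m<N. if m = i then (if i = j then 1 else 0) else 0)"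
      using that by (intro sum.cong refl) (auto simp: V_def)
    thus ?thesis using that by simp
  qed
  hence "V \<in> unitary_group N" by (auto simp: unitary_group_def V_def)
  moreover have "V (m, l) = x m" if "m < N" for m using that l True z by (auto simp: V_def)
  ultimately show ?thesis by (rule that)
next
  case False
  define w where "w = (\<lambda>i. (if i = l then 1 else 0) - x i)"
  define \<tau> where "\<tau> = 1 / (1 - conjugate (x l))"
  define V where "V = (\<lambda>(i, j)\<in>{..<N} \<times> {..<N}. (if i = j then 1 else 0) - \<tau> * w i * conjugate (w j))"
  have nz: "1 - x l \<noteq> 0" "1 - conjugate (x l) \<noteq> 0"
    using False conjugate_cancel_iff[of 1 "x l"] by auto
  have "(\<Sum>i<N. x i * conjugate (x i)) = 1" using vec_norm_inner[of N x] x by simp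
  moreover have "(\<Sum>i<N. w i * conjugate (w i))
    = (\<Sum>i<N. (if i = l then 1 - x l - conjugate (x l) else 0) + x i * conjugate (x i))"
    by (intro sum.cong refl) (simp add: w_def conjugate_diff conjugate_neg algebra_simps)
  ultimately have ww: "(\<Sum>i<N. w i * conjugate (w i)) = (1 - x l) + (1 - conjugate (x l))"
    using l by (simp add: sum.distrib)
  \<comment> \<open>For a matrix of the form \<open>I - \<tau> w w\<^sup>*\<close> unitarity is
    equivalent to this identity; it holds because \<open>|w|^2 = 2 - 2 Re (x l)\<close> for a unit
    vector \<open>x\<close>.\<close>
  have \<tau>: "\<tau> + conjugate \<tau> = \<tau> * conjugate \<tau> * (\<Sum>i<N. w i * conjugate (w i))"
    using nz by (simp add: ww \<tau>_def conjugate_divide conjugate_diff field_simps)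
  have "V \<in> unitary_group N"
  proof -
    have "(\<Sum>m<N. conjugate (V (m, i)) * V (m, j)) = (if i = j then 1 else 0)" if ij: "i < N" "j < N" for i j
    proof -
      have "(\<Sum>m<N. conjugate (V (m, i)) * V (m, j))
        = (\<Sum>m<N. (if m = i then (if i = j then 1 else 0) - \<tau> * w i * conjugate (w j) else 0)
            - (if m = j then conjugate \<tau> * w i * conjugate (w j) else 0)
            + \<tau> * conjugate \<tau> * (w m * conjugate (w m)) * (w i * conjugate (w j)))"
        using ij by (intro sum.cong refl) (auto simp: V_def conjugate_diff conjugate_dist_mul algebra_simps)
      also have "\<dots> = (if i = j then 1 else 0) - \<tau> * w i * conjugate (w j) - conjugate \<tau> * w i * conjugate (w j)
          + (\<tau> * conjugate \<tau> * (\<Sum>m<N. w m * conjugate (w m))) * (w i * conjugate (w j))"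
        using ij by (simp add: sum.distrib sum_subtractf sum_distrib_left sum_distrib_right)
      also have "\<dots> = (if i = j then 1 else 0)" unfolding \<tau>[symmetric] by (simp add: algebra_simps)
      finally show ?thesis .
    qed
    thus ?thesis by (auto simp: unitary_group_def V_def)
  qed
  moreover have "V (m, l) = x m" if "m < N" for m
  proof -
    have "V (m, l) = (if m = l then 1 else 0) - w m"
      using that l nz by (simp add: V_def \<tau>_def w_def conjugate_diff)
    thus ?thesis by (simp add: w_def)
  qed
  ultimately show ?thesis by (rule that)
qed

subsection \<open>Lebesgue measure and the uniform measure on the sphere\<close>

definition vec_space :: "nat \<Rightarrow> (nat \<Rightarrow> 'k::euclidean_space) measure" where
  "vec_space N = (\<Pi>\<^sub>M _\<in>{..<N}. lborel)"

abbreviation vec_borel :: "nat \<Rightarrow> (nat \<Rightarrow> 'k::euclidean_space) measure" where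
  "vec_borel N \<equiv> \<Pi>\<^sub>M _\<in>{..<N}. borel"

definition unit_ball :: "nat \<Rightarrow> (nat \<Rightarrow> 'k::euclidean_space) set" where
  "unit_ball N = {a\<in>space (vec_space N). vec_norm N a \<le> 1}"

definition vec_sgn :: "nat \<Rightarrow> (nat \<Rightarrow> 'k::euclidean_space) \<Rightarrow> nat \<Rightarrow> 'k" where
  "vec_sgn N a = (\<lambda>i\<in>{..<N}. a i /\<^sub>R vec_norm N a)"

lemma space_vec_space: "space (vec_space N) = extensional {..<N}"
  by (simp add: vec_space_def space_PiM PiE_UNIV_domain) (auto simp: PiE_def)

lemma sets_vec_space: "sets (vec_space N) = sets (vec_borel N)"
  unfolding vec_space_def by (intro sets_PiM_cong) auto

lemma measurable_vec_space_cong [measurable_cong]: "sets (vec_space N) = sets (vec_borel N)"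
  by (rule sets_vec_space)

lemma borel_measurable_vec_norm [measurable]: "vec_norm N \<in> borel_measurable (vec_borel N)"
  unfolding vec_norm_def L2_set_def by measurable

lemma measurable_vec_sgn [measurable]:
  "vec_sgn N \<in> measurable (vec_borel N) (vec_borel N)"
  unfolding vec_sgn_def by measurable

lemma measurable_mat_vec [measurable]:
  "mat_vec N (V :: nat \<times> nat \<Rightarrow> 'k::{real_normed_field,euclidean_space}) \<in> measurable (vec_borel N) (vec_borel N)"
  unfolding mat_vec_def by measurable

lemma sets_unit_ball [measurable]: "unit_ball N \<in> sets (vec_borel N)"
proof -
  have "{a\<in>space (vec_borel N). vec_norm N (a :: nat \<Rightarrow> 'a) \<le> 1} \<in> sets (vec_borel N)" by measurable
  thus ?thesis by (simp add: unit_ball_def sets_eq_imp_space_eq[OF sets_vec_space])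
qed

interpretation lborel_prod: product_sigma_finite "\<lambda>_::nat. lborel :: 'k::euclidean_space measure"
  by standard

interpretation vec_space: sigma_finite_measure "vec_space N :: (nat \<Rightarrow> 'k::euclidean_space) measure" for N
  unfolding vec_space_def by (rule lborel_prod.sigma_finite) simp

lemma vec_space_eqI:
  fixes P :: "(nat \<Rightarrow> 'k::euclidean_space) measure"
  assumes "sets P = sets (vec_space N)"
    and "\<And>A. (\<And>i. i < N \<Longrightarrow> A i \<in> sets borel) \<Longrightarrow> emeasure P (PiE {..<N} A) = (\<Prod>i<N. emeasure lborel (A i))"
  shows "P = vec_space N"
  unfolding vec_space_def
  by (rule lborel_prod.PiM_eqI) (use assms in \<open>auto simp: vec_space_def\<close>)

lemma emeasure_vec_space_PiE:
  assumes "\<And>i. i < N \<Longrightarrow> A i \<in> sets borel"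
  shows "emeasure (vec_space N) (PiE {..<N} A) = (\<Prod>i<N. emeasure lborel (A i))"
  unfolding vec_space_def by (rule lborel_prod.emeasure_PiM) (use assms in auto)

lemma distr_vec_space_affine:
  fixes t :: "nat \<Rightarrow> 'k::euclidean_space"
  assumes c: "c \<noteq> 0"
  shows "scale_measure (ennreal (\<bar>c\<bar> ^ (N * DIM('k)))) (distr (vec_space N) (vec_space N) (\<lambda>x. \<lambda>i\<in>{..<N}. t i + c *\<^sub>R x i)) = vec_space N"
    (is "scale_measure _ (distr _ _ ?T) = _")
proof (rule vec_space_eqI)
  fix A :: "nat \<Rightarrow> 'k set" assume A: "\<And>i. i < N \<Longrightarrow> A i \<in> sets borel"
  let ?B = "\<lambda>i. (\<lambda>x. t i + c *\<^sub>R x) -` A i"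
  have B: "?B i \<in> sets borel" if "i < N" for i
    using A[OF that] by (auto intro!: measurable_sets_borel[of _ borel])
  have "PiE {..<N} A \<in> sets (vec_space N)"
    unfolding vec_space_def using A by (intro sets_PiM_I_finite) auto
  moreover have "?T \<in> measurable (vec_space N) (vec_space N)" by measurable
  moreover have "?T -` PiE {..<N} A \<inter> space (vec_space N) = PiE {..<N} ?B"
    unfolding space_vec_space set_eq_iff Int_iff vimage_eq PiE_iff by simp
  ultimately have "emeasure (distr (vec_space N) (vec_space N) ?T) (PiE {..<N} A) = (\<Prod>i<N. emeasure lborel (?B i))"
    using B by (simp add: emeasure_distr emeasure_vec_space_PiE)
  moreover have "ennreal (\<bar>c\<bar> ^ (N * DIM('k))) = (\<Prod>i<N. ennreal (\<bar>c\<bar> ^ DIM('k)))"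
  proof -
    have "\<bar>c\<bar> ^ (N * DIM('k)) = (\<bar>c\<bar> ^ DIM('k)) ^ N" by (simp only: power_mult[symmetric] mult.commute)
    thus ?thesis by (simp add: ennreal_power del: power_abs)
  qed
  ultimately have "emeasure (scale_measure (ennreal (\<bar>c\<bar> ^ (N * DIM('k)))) (distr (vec_space N) (vec_space N) ?T)) (PiE {..<N} A)
    = (\<Prod>i<N. ennreal (\<bar>c\<bar> ^ DIM('k)) * emeasure lborel (?B i))"
    by (simp only: prod.distrib emeasure_scale_measure)
  also have "\<dots> = (\<Prod>i<N. emeasure lborel (A i))"
    by (intro prod.cong refl emeasure_lborel_affine_vimage c) (use A in auto)
  finally show "emeasure (scale_measure (ennreal (\<bar>c\<bar> ^ (N * DIM('k)))) (distr (vec_space N) (vec_space N) ?T)) (PiE {..<N} A)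
    = (\<Prod>i<N. emeasure lborel (A i))" .
qed simp

lemma nn_integral_vec_space_affine:
  fixes f :: "(nat \<Rightarrow> 'k::euclidean_space) \<Rightarrow> ennreal"
  assumes [measurable]: "f \<in> borel_measurable (vec_borel N)" and c: "c \<noteq> 0"
  shows "(\<integral>\<^sup>+x. f x \<partial>vec_space N)
    = ennreal (\<bar>c\<bar> ^ (N * DIM('k))) * (\<integral>\<^sup>+x. f (\<lambda>i\<in>{..<N}. t i + c *\<^sub>R x i) \<partial>vec_space N)"
  by (subst distr_vec_space_affine[OF c, of N t, symmetric])
    (simp add: nn_integral_scale_measure nn_integral_distr ennreal_power)

lemma emeasure_unit_ball:
  "emeasure (vec_space N) (unit_ball N :: (nat \<Rightarrow> 'k::euclidean_space) set) \<noteq> 0"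
  "emeasure (vec_space N) (unit_ball N :: (nat \<Rightarrow> 'k::euclidean_space) set) < top"
proof -
  \<comment> \<open>With this radius the sum of the entry norms is at most
    \<open>N / (N + 1)\<close>, so the box lies in the ball; the \<open>+ 1\<close> also keeps the
    radius positive for \<open>N = 0\<close>.\<close>
  let ?A = "\<lambda>_::nat. ball (0::'k) (1 / (real N + 1))" and ?B = "\<lambda>_::nat. cball (0::'k) 1"
  have "(PiE {..<N} ?A :: (nat \<Rightarrow> 'k) set) \<subseteq> unit_ball N"
  proof
    fix a :: "nat \<Rightarrow> 'k" assume a: "a \<in> PiE {..<N} ?A"
    have "vec_norm N a \<le> (\<Sum>i<N. norm (a i))"
      unfolding vec_norm_def by (rule order_trans[OF L2_set_le_sum]) auto
    also have "\<dots> \<le> (\<Sum>i<N. 1 / (real N + 1))"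
      using a by (intro sum_mono) (auto simp: PiE_iff dist_norm less_imp_le)
    also have "\<dots> \<le> 1" by simp
    finally show "a \<in> unit_ball N" using a by (auto simp: unit_ball_def space_vec_space PiE_iff)
  qed
  hence "(\<Prod>i<N. emeasure lborel (?A i)) \<le> emeasure (vec_space N) (unit_ball N :: (nat \<Rightarrow> 'k) set)"
    by (subst emeasure_vec_space_PiE[symmetric]) (auto intro!: emeasure_mono simp: sets_vec_space)
  moreover have "emeasure lborel (?A i) \<noteq> 0" for i :: nat
  proof
    assume "emeasure lborel (?A i) = 0"
    hence "measure lborel (?A i) = 0" by (simp add: measure_def)
    thus False using content_ball_pos[of "1 / (real N + 1)" "0::'k"] by simp
  qed
  ultimately show "emeasure (vec_space N) (unit_ball N :: (nat \<Rightarrow> 'k) set) \<noteq> 0" by auto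
  have "unit_ball N \<subseteq> PiE {..<N} ?B"
  proof
    fix a :: "nat \<Rightarrow> 'k" assume "a \<in> unit_ball N"
    thus "a \<in> PiE {..<N} ?B"
      using norm_le_vec_norm[of _ N a] by (auto simp: unit_ball_def space_vec_space PiE_iff intro: order_trans)
  qed
  hence "emeasure (vec_space N) (unit_ball N :: (nat \<Rightarrow> 'k) set) \<le> (\<Prod>i<N. emeasure lborel (?B i))"
    by (subst emeasure_vec_space_PiE[symmetric])
      (auto intro!: emeasure_mono sets_PiM_I_finite simp: vec_space_def)
  also have "\<dots> < top" using emeasure_lborel_cball_finite[of "0::'k" 1] by (simp add: power_less_top_ennreal)
  finally show "emeasure (vec_space N) (unit_ball N :: (nat \<Rightarrow> 'k) set) < top" .
qed

lemma nn_integral_vec_space_translate: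
  fixes f :: "(nat \<Rightarrow> 'k::euclidean_space) \<Rightarrow> ennreal"
  assumes "f \<in> borel_measurable (vec_borel N)"
  shows "(\<integral>\<^sup>+x. f (\<lambda>i\<in>{..<N}. t i + x i) \<partial>vec_space N) = (\<integral>\<^sup>+x. f x \<partial>vec_space N)"
  using nn_integral_vec_space_affine[OF assms, of 1 t] by simp

lemma mat_vec_add: "mat_vec N V (\<lambda>i\<in>{..<N}. a i + b i) = (\<lambda>i\<in>{..<N}. mat_vec N V a i + mat_vec N V b i)"
  by (auto simp: mat_vec_def fun_eq_iff algebra_simps sum.distrib)

lemma mat_vec_scaleR:
  "mat_vec N (V :: nat \<times> nat \<Rightarrow> 'k::real_normed_field) (\<lambda>i\<in>{..<N}. c *\<^sub>R a i) = (\<lambda>i\<in>{..<N}. c *\<^sub>R mat_vec N V a i)"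
  by (auto simp: mat_vec_def fun_eq_iff scaleR_sum_right)

text \<open>
  The image of Lebesgue measure under a unitary map is again translation invariant; Fubini compares it
  with Lebesgue measure through the unit ball, which the map preserves.
\<close>

lemma nn_integral_vec_space_unitary:
  fixes f :: "(nat \<Rightarrow> 'k::rc_field) \<Rightarrow> ennreal"
  assumes V: "V \<in> unitary_group N" and f[measurable]: "f \<in> borel_measurable (vec_borel N)"
  shows "(\<integral>\<^sup>+x. f (mat_vec N V x) \<partial>vec_space N) = (\<integral>\<^sup>+x. f x \<partial>vec_space N)"
proof -
  interpret pair_sigma_finite "vec_space N :: (nat \<Rightarrow> 'k) measure" "vec_space N :: (nat \<Rightarrow> 'k) measure" ..
  let ?M = "vec_space N :: (nat \<Rightarrow> 'k) measure"
  let ?D = "indicator (unit_ball N) :: (nat \<Rightarrow> 'k) \<Rightarrow> ennreal"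
  let ?W = "mat_adjoint N V"
  note mat_adjoint_unitary[OF V]
  have [measurable]: "?D \<in> borel_measurable (vec_borel N)" by measurable
  have "emeasure ?M (unit_ball N) * (\<integral>\<^sup>+y. f (mat_vec N V y) \<partial>?M)
    = (\<integral>\<^sup>+x. ?D x * (\<integral>\<^sup>+y. f (mat_vec N V y) \<partial>?M) \<partial>?M)"
    by (subst nn_integral_multc) (auto simp: sets_vec_space)
  also have "\<dots> = (\<integral>\<^sup>+x. (\<integral>\<^sup>+y. ?D x * f (\<lambda>i\<in>{..<N}. mat_vec N V y i + x i) \<partial>?M) \<partial>?M)"
  proof (rule nn_integral_cong)
    fix x assume "x \<in> space ?M"
    hence "x \<in> extensional {..<N}" by (simp add: space_vec_space)
    \<comment> \<open>A translation of \<open>y\<close> by the preimage of \<open>x\<close> becomes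
      a translation by \<open>x\<close> after applying \<open>V\<close>, so the image measure
      inherits translation invariance.\<close>
    hence "mat_vec N V (\<lambda>i\<in>{..<N}. mat_vec N ?W x i + y i) = (\<lambda>i\<in>{..<N}. mat_vec N V y i + x i)" for y
      using mat_vec_adjoint(2)[OF V] by (simp add: mat_vec_add add.commute cong: restrict_cong)
    moreover have "(\<integral>\<^sup>+y. f (mat_vec N V (\<lambda>i\<in>{..<N}. mat_vec N ?W x i + y i)) \<partial>?M) = (\<integral>\<^sup>+y. f (mat_vec N V y) \<partial>?M)"
      by (rule nn_integral_vec_space_translate) measurable
    ultimately show "?D x * (\<integral>\<^sup>+y. f (mat_vec N V y) \<partial>?M) = (\<integral>\<^sup>+y. ?D x * f (\<lambda>i\<in>{..<N}. mat_vec N V y i + x i) \<partial>?M)"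
      by (subst nn_integral_cmult) simp_all
  qed
  also have "\<dots> = (\<integral>\<^sup>+y. (\<integral>\<^sup>+x. ?D x * f (\<lambda>i\<in>{..<N}. mat_vec N V y i + x i) \<partial>?M) \<partial>?M)"
    by (rule Fubini') measurable
  also have "\<dots> = (\<integral>\<^sup>+y. (\<integral>\<^sup>+x. ?D (\<lambda>i\<in>{..<N}. x i - mat_vec N V y i) * f x \<partial>?M) \<partial>?M)"
  proof (rule nn_integral_cong)
    fix y
    let ?g = "\<lambda>x. ?D (\<lambda>i\<in>{..<N}. x i - mat_vec N V y i) * f x"
    have "(\<integral>\<^sup>+x. ?g (\<lambda>i\<in>{..<N}. mat_vec N V y i + x i) \<partial>?M) = (\<integral>\<^sup>+x. ?g x \<partial>?M)"
      by (rule nn_integral_vec_space_translate) measurable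
    moreover have "(\<lambda>i\<in>{..<N}. (\<lambda>i\<in>{..<N}. mat_vec N V y i + x i) i - mat_vec N V y i) = x" if "x \<in> space ?M" for x
      using that by (auto simp: space_vec_space extensional_def fun_eq_iff)
    ultimately show "(\<integral>\<^sup>+x. ?D x * f (\<lambda>i\<in>{..<N}. mat_vec N V y i + x i) \<partial>?M) = (\<integral>\<^sup>+x. ?g x \<partial>?M)"
      by (simp cong: nn_integral_cong_simp)
  qed
  also have "\<dots> = (\<integral>\<^sup>+x. (\<integral>\<^sup>+y. ?D (\<lambda>i\<in>{..<N}. x i - mat_vec N V y i) * f x \<partial>?M) \<partial>?M)"
    by (rule Fubini'[symmetric]) measurable
  also have "\<dots> = (\<integral>\<^sup>+x. emeasure ?M (unit_ball N) * f x \<partial>?M)"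
  proof (rule nn_integral_cong)
    fix x assume x: "x \<in> space ?M"
    \<comment> \<open>\<open>x - V y\<close> is the image under \<open>V\<close> of the vector
      \<open>?W x - y\<close>, and \<open>V\<close> preserves the norm. The unit ball condition thus
      becomes a translated ball condition on \<open>y\<close>, whose integral no longer depends on
      \<open>x\<close>.\<close>
    have D: "?D (\<lambda>i\<in>{..<N}. x i - mat_vec N V y i) = ?D (\<lambda>i\<in>{..<N}. - mat_vec N ?W x i + y i)" if y: "y \<in> space ?M" for y
    proof -
      have "mat_vec N V (\<lambda>i\<in>{..<N}. - mat_vec N ?W x i + y i) = (\<lambda>i\<in>{..<N}. - 1 *\<^sub>R x i + mat_vec N V y i)"
      proof -
        have "mat_vec N V (\<lambda>i\<in>{..<N}. - mat_vec N ?W x i + y i)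
          = mat_vec N V (\<lambda>i\<in>{..<N}. (\<lambda>i\<in>{..<N}. (-1) *\<^sub>R mat_vec N ?W x i) i + y i)"
          by (intro mat_vec_cong) auto
        also have "\<dots> = (\<lambda>i\<in>{..<N}. - 1 *\<^sub>R x i + mat_vec N V y i)"
          unfolding mat_vec_add mat_vec_scaleR
          using x mat_vec_adjoint(2)[OF V, of x] by (auto simp: space_vec_space fun_eq_iff)
        finally show ?thesis .
      qed
      hence "vec_norm N (\<lambda>i\<in>{..<N}. - mat_vec N ?W x i + y i) = vec_norm N (\<lambda>i\<in>{..<N}. - 1 *\<^sub>R x i + mat_vec N V y i)"
        using vec_norm_mat_vec[OF V] by metis
      also have "\<dots> = vec_norm N (\<lambda>i. (-1) *\<^sub>R (\<lambda>i\<in>{..<N}. x i - mat_vec N V y i) i)"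
        by (intro vec_norm_cong) auto
      also have "\<dots> = vec_norm N (\<lambda>i\<in>{..<N}. x i - mat_vec N V y i)" unfolding vec_norm_scaleR by (simp add: restrict_def)
      finally show ?thesis by (auto simp: unit_ball_def space_vec_space split: split_indicator)
    qed
    have "(\<integral>\<^sup>+y. ?D (\<lambda>i\<in>{..<N}. x i - mat_vec N V y i) * f x \<partial>?M)
      = (\<integral>\<^sup>+y. ?D (\<lambda>i\<in>{..<N}. - mat_vec N ?W x i + y i) * f x \<partial>?M)"
      by (intro nn_integral_cong) (simp only: D)
    also have "\<dots> = (\<integral>\<^sup>+y. ?D (\<lambda>i\<in>{..<N}. - mat_vec N ?W x i + y i) \<partial>?M) * f x"
      by (rule nn_integral_multc) measurable
    also have "(\<integral>\<^sup>+y. ?D (\<lambda>i\<in>{..<N}. - mat_vec N ?W x i + y i) \<partial>?M) = (\<integral>\<^sup>+y. ?D y \<partial>?M)"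
      by (rule nn_integral_vec_space_translate) measurable
    also have "\<dots> = emeasure ?M (unit_ball N)" by (simp add: sets_vec_space)
    finally show "(\<integral>\<^sup>+y. ?D (\<lambda>i\<in>{..<N}. x i - mat_vec N V y i) * f x \<partial>?M) = emeasure ?M (unit_ball N) * f x" .
  qed
  also have "\<dots> = emeasure ?M (unit_ball N) * (\<integral>\<^sup>+x. f x \<partial>?M)" by (rule nn_integral_cmult) measurable
  finally have "emeasure ?M (unit_ball N) * (\<integral>\<^sup>+y. f (mat_vec N V y) \<partial>?M)
    = emeasure ?M (unit_ball N) * (\<integral>\<^sup>+x. f x \<partial>?M)" .
  thus ?thesis using emeasure_unit_ball[where 'k='k, of N] by (subst (asm) ennreal_mult_cancel_left) auto
qed

lemma uniform_unit_sphere_eq: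
  "uniform_unit_sphere N = distr (uniform_measure (vec_space N) (unit_ball N)) (vec_borel N) (vec_sgn N)"
proof -
  have "vec_sgn N = (\<lambda>a :: nat \<Rightarrow> 'a. \<lambda>i\<in>{..<N}. a i /\<^sub>R L2_set (\<lambda>j. norm (a j)) {..<N})"
    by (rule ext) (simp add: vec_sgn_def vec_norm_def)
  moreover have "unit_ball N = {a \<in> space (\<Pi>\<^sub>M _\<in>{..<N}. lborel :: 'a measure). L2_set (\<lambda>i. norm (a i)) {..<N} \<le> 1}"
    by (simp add: unit_ball_def vec_norm_def vec_space_def)
  ultimately show ?thesis by (simp only: uniform_unit_sphere_def vec_space_def)
qed

lemma sets_uniform_unit_sphere [simp, measurable_cong]:
  "sets (uniform_unit_sphere N) = sets (vec_borel N)"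
  by (simp add: uniform_unit_sphere_eq)

lemma space_uniform_unit_sphere: "space (uniform_unit_sphere N) = extensional {..<N}"
  using sets_eq_imp_space_eq[OF sets_uniform_unit_sphere] sets_eq_imp_space_eq[OF sets_vec_space]
  by (metis space_vec_space)

lemma measurable_vec_sgn_uniform:
  "vec_sgn N \<in> measurable (uniform_measure (vec_space N) (unit_ball N)) (vec_borel N)"
proof -
  have "vec_sgn N \<in> measurable (vec_space N) (vec_borel N)" by measurable
  thus ?thesis by (simp cong: measurable_cong_sets)
qed

lemma prob_space_uniform_unit_sphere: "prob_space (uniform_unit_sphere N :: (nat \<Rightarrow> 'k::euclidean_space) measure)"
  unfolding uniform_unit_sphere_eq
  by (intro prob_space.prob_space_distr prob_space_uniform_measure measurable_vec_sgn_uniform)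
    (use emeasure_unit_ball[where 'k='k, of N] in auto)

text \<open>The normalising volume is kept as a factor rather than a divisor, so that later
  identities can be compared and cancelled without division in \<open>ennreal\<close>.\<close>

lemma nn_integral_uniform_unit_sphere:
  fixes f :: "(nat \<Rightarrow> 'k::euclidean_space) \<Rightarrow> ennreal"
  assumes [measurable]: "f \<in> borel_measurable (vec_borel N)"
  shows "(\<integral>\<^sup>+a. f a \<partial>uniform_unit_sphere N) * emeasure (vec_space N) (unit_ball N :: (nat \<Rightarrow> 'k) set)
    = (\<integral>\<^sup>+a. f (vec_sgn N a) * indicator (unit_ball N) a \<partial>vec_space N)"
proof -
  have "(\<integral>\<^sup>+a. f a \<partial>uniform_unit_sphere N)
    = (\<integral>\<^sup>+a. f (vec_sgn N a) \<partial>uniform_measure (vec_space N) (unit_ball N))"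
    unfolding uniform_unit_sphere_eq by (subst nn_integral_distr) (simp_all add: measurable_vec_sgn_uniform assms)
  also have "\<dots> = (\<integral>\<^sup>+a. f (vec_sgn N a) * indicator (unit_ball N) a \<partial>vec_space N) / emeasure (vec_space N) (unit_ball N :: (nat \<Rightarrow> 'k) set)"
  proof (rule nn_integral_uniform_measure)
    show "(\<lambda>a. f (vec_sgn N a)) \<in> borel_measurable (vec_space N)" by measurable
  qed (simp add: sets_vec_space)
  moreover have "x / b * b = x" if "b \<noteq> 0" "b < top" for x b :: ennreal
    using that by (metis ennreal_times_divide mult.commute mult_divide_eq_ennreal less_irrefl)
  ultimately show ?thesis using emeasure_unit_ball[where 'k='k, of N] by simp
qed

lemma AE_vec_norm_nonzero:
  assumes "N > 0"
  shows "AE a in vec_space N. vec_norm N (a :: nat \<Rightarrow> 'k::euclidean_space) \<noteq> 0"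
proof -
  have "(PiE {..<N} (\<lambda>_. {0}) :: (nat \<Rightarrow> 'k) set) \<in> null_sets (vec_space N)"
  proof (rule null_setsI)
    show "emeasure (vec_space N) (PiE {..<N} (\<lambda>_. {0 :: 'k})) = 0"
      using assms by (subst emeasure_vec_space_PiE) (auto simp: prod_zero_iff)
    show "(PiE {..<N} (\<lambda>_. {0}) :: (nat \<Rightarrow> 'k) set) \<in> sets (vec_space N)"
      unfolding vec_space_def by (intro sets_PiM_I_finite) auto
  qed
  moreover have "{a\<in>space (vec_space N). \<not> vec_norm N a \<noteq> 0} \<subseteq> (PiE {..<N} (\<lambda>_. {0}) :: (nat \<Rightarrow> 'k) set)"
    by (auto simp: space_vec_space PiE_iff vec_norm_eq_0_iff extensional_def fun_eq_iff)
  ultimately show ?thesis by (rule AE_I')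
qed

lemma vec_norm_vec_sgn: "vec_norm N a \<noteq> 0 \<Longrightarrow> vec_norm N (vec_sgn N a) = 1"
proof -
  assume "vec_norm N a \<noteq> 0"
  have "vec_norm N (vec_sgn N a) = vec_norm N (\<lambda>i. inverse (vec_norm N a) *\<^sub>R a i)"
    by (intro vec_norm_cong) (simp add: vec_sgn_def)
  thus ?thesis using \<open>vec_norm N a \<noteq> 0\<close> by (simp add: vec_norm_scaleR)
qed

text \<open>\<open>vec_sgn\<close> sends the zero vector to zero, so the norm is 1 only off the
  origin, which is a null set because \<open>N > 0\<close>.\<close>

lemma AE_uniform_unit_sphere:
  assumes "N > 0"
  shows "AE a in uniform_unit_sphere N. vec_norm N (a :: nat \<Rightarrow> 'k::euclidean_space) = 1"
proof -
  have "AE a in uniform_measure (vec_space N) (unit_ball N). vec_norm N (a :: nat \<Rightarrow> 'k) \<noteq> 0"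
    using AE_vec_norm_nonzero[OF assms, where 'k='k]
    by (intro AE_uniform_measureI) (auto simp: sets_vec_space)
  hence "AE a in uniform_measure (vec_space N) (unit_ball N). vec_norm N (vec_sgn N (a :: nat \<Rightarrow> 'k)) = 1"
    by eventually_elim (rule vec_norm_vec_sgn)
  moreover have "{a\<in>space (vec_borel N). vec_norm N (a :: nat \<Rightarrow> 'k) = 1} \<in> sets (vec_borel N)"
    by measurable
  ultimately show ?thesis
    unfolding uniform_unit_sphere_eq by (subst AE_distr_iff) (auto intro: measurable_vec_sgn_uniform)
qed

lemma nn_integral_uniform_unit_sphere_unitary:
  fixes f :: "(nat \<Rightarrow> 'k::rc_field) \<Rightarrow> ennreal"
  assumes V: "V \<in> unitary_group N" and f[measurable]: "f \<in> borel_measurable (vec_borel N)"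
  shows "(\<integral>\<^sup>+a. f (mat_vec N V a) \<partial>uniform_unit_sphere N) = (\<integral>\<^sup>+a. f a \<partial>uniform_unit_sphere N)"
proof -
  have sgn: "vec_sgn N (mat_vec N V a) = mat_vec N V (vec_sgn N a)" for a
    unfolding vec_sgn_def mat_vec_scaleR vec_norm_mat_vec[OF V] by simp
  have ball: "mat_vec N V a \<in> unit_ball N \<longleftrightarrow> a \<in> unit_ball N" if "a \<in> space (vec_space N)" for a
    using that vec_norm_mat_vec[OF V, of a] by (simp add: unit_ball_def space_vec_space) (simp add: mat_vec_def)
  have "(\<integral>\<^sup>+a. f (mat_vec N V a) \<partial>uniform_unit_sphere N) * emeasure (vec_space N) (unit_ball N :: (nat \<Rightarrow> 'k) set)
    = (\<integral>\<^sup>+a. f (mat_vec N V (vec_sgn N a)) * indicator (unit_ball N) a \<partial>vec_space N)"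
    by (rule nn_integral_uniform_unit_sphere) measurable
  also have "\<dots> = (\<integral>\<^sup>+a. f (vec_sgn N (mat_vec N V a)) * indicator (unit_ball N) (mat_vec N V a) \<partial>vec_space N)"
    by (intro nn_integral_cong) (auto simp: sgn ball split: split_indicator)
  also have "\<dots> = (\<integral>\<^sup>+a. f (vec_sgn N a) * indicator (unit_ball N) a \<partial>vec_space N)"
    by (rule nn_integral_vec_space_unitary[OF V]) measurable
  also have "\<dots> = (\<integral>\<^sup>+a. f a \<partial>uniform_unit_sphere N) * emeasure (vec_space N) (unit_ball N :: (nat \<Rightarrow> 'k) set)"
    by (rule nn_integral_uniform_unit_sphere[symmetric]) measurable
  finally have eq: "(\<integral>\<^sup>+a. f (mat_vec N V a) \<partial>uniform_unit_sphere N) * emeasure (vec_space N) (unit_ball N :: (nat \<Rightarrow> 'k) set)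
    = (\<integral>\<^sup>+a. f a \<partial>uniform_unit_sphere N) * emeasure (vec_space N) (unit_ball N :: (nat \<Rightarrow> 'k) set)" .
  show ?thesis
    using eq emeasure_unit_ball[where 'k='k, of N]
    by (simp only: ennreal_mult_cancel_left mult.commute[of _ "emeasure (vec_space N) (unit_ball N :: (nat \<Rightarrow> 'k) set)"]) auto
qed

text \<open>A positive dilation leaves \<open>vec_sgn\<close> unchanged and scales Lebesgue measure
  by the power given by the real dimension \<open>N * DIM('k)\<close>. This homogeneity does the
  work of polar coordinates here, in the concentration argument as well as for the Gaussian
  integrals.\<close>

lemma nn_integral_cone_scale:
  fixes g :: "(nat \<Rightarrow> 'k::euclidean_space) \<Rightarrow> ennreal"
  assumes g[measurable]: "g \<in> borel_measurable (vec_borel N)" and s: "s > 0"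
  shows "(\<integral>\<^sup>+a. g (vec_sgn N a) * indicator {a. vec_norm N a \<le> s} a \<partial>vec_space N)
    = ennreal (s ^ (N * DIM('k))) * (\<integral>\<^sup>+a. g (vec_sgn N a) * indicator (unit_ball N) a \<partial>vec_space N)"
proof -
  let ?T = "\<lambda>x :: nat \<Rightarrow> 'k. \<lambda>i\<in>{..<N}. 0 + s *\<^sub>R x i"
  have norm: "vec_norm N (?T x) = s * vec_norm N x" for x
  proof -
    have "vec_norm N (?T x) = vec_norm N (\<lambda>i. s *\<^sub>R x i)" by (intro vec_norm_cong) auto
    thus ?thesis using s by (simp add: vec_norm_scaleR)
  qed
  have sgn: "vec_sgn N (?T x) = vec_sgn N x" for x
    unfolding vec_sgn_def norm using s by (auto simp: fun_eq_iff)
  have [measurable]: "(\<lambda>a. indicator {a. vec_norm N a \<le> s} a :: ennreal) \<in> borel_measurable (\<Pi>\<^sub>M _\<in>{..<N}. borel :: 'k measure)"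
  proof -
    have "(\<lambda>a. if vec_norm N a \<le> s then 1 else 0 :: ennreal) \<in> borel_measurable (\<Pi>\<^sub>M _\<in>{..<N}. borel :: 'k measure)" by measurable
    thus ?thesis by (simp add: indicator_def)
  qed
  have "(\<integral>\<^sup>+a. g (vec_sgn N a) * indicator {a. vec_norm N a \<le> s} a \<partial>vec_space N)
    = ennreal (\<bar>s\<bar> ^ (N * DIM('k))) * (\<integral>\<^sup>+a. g (vec_sgn N (?T a)) * indicator {a. vec_norm N a \<le> s} (?T a) \<partial>vec_space N)"
    using s by (intro nn_integral_vec_space_affine) auto
  also have "(\<integral>\<^sup>+a. g (vec_sgn N (?T a)) * indicator {a. vec_norm N a \<le> s} (?T a) \<partial>vec_space N)
    = (\<integral>\<^sup>+a. g (vec_sgn N a) * indicator (unit_ball N) a \<partial>vec_space N)"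
    unfolding sgn using s
    by (intro nn_integral_cong) (auto simp only: norm unit_ball_def indicator_def mem_Collect_eq mult_le_cancel_left1, auto)
  finally show ?thesis using s by simp
qed

text \<open>\<open>vec_sgn\<close> is Lipschitz only away from the origin, so the part of the cone
  over \<open>S\<close> with norm at most 1/2 is discarded. By homogeneity it is the fraction
  \<open>2^(-n)\<close> of the cone, with \<open>n \<ge> 1\<close> the real dimension, so at least
  half of the cone remains.\<close>

lemma measure_cone_annulus:
  fixes S :: "(nat \<Rightarrow> 'k::euclidean_space) set"
  assumes S[measurable]: "S \<in> sets (vec_borel N)" and "N > 0"
  shows "measure (vec_space N) (unit_ball N :: (nat \<Rightarrow> 'k) set) * measure (uniform_unit_sphere N) S / 2
    \<le> measure (vec_space N) {a\<in>unit_ball N. 1/2 < vec_norm N a \<and> vec_sgn N a \<in> S}"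
    and "{a\<in>unit_ball N. 1/2 < vec_norm N a \<and> vec_sgn N a \<in> S} \<in> sets (vec_space N)"
proof -
  let ?M = "vec_space N :: (nat \<Rightarrow> 'k) measure" and ?\<sigma> = "uniform_unit_sphere N :: (nat \<Rightarrow> 'k) measure"
  let ?B = "unit_ball N :: (nat \<Rightarrow> 'k) set"
  let ?C = "{a\<in>?B. vec_sgn N a \<in> S}"
  let ?D = "{a\<in>?B. 1/2 < vec_norm N a \<and> vec_sgn N a \<in> S}" and ?E = "{a\<in>?B. vec_norm N a \<le> 1/2 \<and> vec_sgn N a \<in> S}"
  interpret prob_space ?\<sigma> by (rule prob_space_uniform_unit_sphere)
  have [measurable]: "Measurable.pred ?M (\<lambda>a. vec_sgn N a \<in> S)" by measurable
  have sp: "?B \<subseteq> space ?M" by (auto simp: unit_ball_def)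
  have B: "?B \<in> sets ?M" by (simp add: sets_vec_space)
  have "{a\<in>space ?M. a \<in> ?B \<and> 1/2 < vec_norm N a \<and> vec_sgn N a \<in> S} \<in> sets ?M" by measurable
  also have "{a\<in>space ?M. a \<in> ?B \<and> 1/2 < vec_norm N a \<and> vec_sgn N a \<in> S} = ?D" using sp by auto
  finally show D: "?D \<in> sets ?M" .
  have "{a\<in>space ?M. a \<in> ?B \<and> vec_norm N a \<le> 1/2 \<and> vec_sgn N a \<in> S} \<in> sets ?M" by measurable
  also have "{a\<in>space ?M. a \<in> ?B \<and> vec_norm N a \<le> 1/2 \<and> vec_sgn N a \<in> S} = ?E" using sp by auto
  finally have E: "?E \<in> sets ?M" .
  have CDE: "?C = ?D \<union> ?E" "?D \<inter> ?E = {}" by auto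
  have C: "?C \<in> sets ?M" unfolding CDE using D E by auto
  have eC: "emeasure ?M ?C = emeasure ?\<sigma> S * emeasure ?M ?B"
  proof -
    have "emeasure ?M ?C = (\<integral>\<^sup>+a. indicator S (vec_sgn N a) * indicator ?B a \<partial>?M)"
      by (subst nn_integral_indicator[symmetric, OF C]) (rule nn_integral_cong, auto split: split_indicator)
    also have "\<dots> = (\<integral>\<^sup>+a. indicator S a \<partial>?\<sigma>) * emeasure ?M ?B"
      by (rule nn_integral_uniform_unit_sphere[symmetric]) measurable
    also have "(\<integral>\<^sup>+a. indicator S a \<partial>?\<sigma>) = emeasure ?\<sigma> S" by (rule nn_integral_indicator) simp
    finally show ?thesis .
  qed
  have eE: "emeasure ?M ?E = ennreal ((1/2) ^ (N * DIM('k))) * emeasure ?M ?C"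
  proof -
    have "emeasure ?M ?E = (\<integral>\<^sup>+a. indicator S (vec_sgn N a) * indicator {a. vec_norm N a \<le> 1/2} a \<partial>?M)"
      by (subst nn_integral_indicator[symmetric, OF E]) (rule nn_integral_cong, auto simp: unit_ball_def split: split_indicator)
    also have "\<dots> = ennreal ((1/2) ^ (N * DIM('k))) * (\<integral>\<^sup>+a. indicator S (vec_sgn N a) * indicator ?B a \<partial>?M)"
      by (rule nn_integral_cone_scale) simp_all
    also have "(\<integral>\<^sup>+a. indicator S (vec_sgn N a) * indicator ?B a \<partial>?M) = emeasure ?M ?C"
      by (subst nn_integral_indicator[symmetric, OF C]) (rule nn_integral_cong, auto split: split_indicator)
    finally show ?thesis .
  qed
  have fin: "emeasure ?M ?B < top" by (rule emeasure_unit_ball)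
  have finite: "emeasure ?M X \<noteq> \<infinity>" if "X \<subseteq> ?B" for X
    using emeasure_mono[OF that B] fin by (auto simp: top_unique)
  have mC: "measure ?M ?C = measure ?\<sigma> S * measure ?M ?B"
    by (simp add: measure_def eC enn2real_mult)
  have mE: "measure ?M ?E = (1/2) ^ (N * DIM('k)) * measure ?M ?C"
    unfolding measure_def eE by (simp add: enn2real_mult)
  have "(1/2 :: real) ^ (N * DIM('k)) \<le> (1/2) ^ 1"
    using assms(2) by (intro power_decreasing) (auto simp: Suc_le_eq)
  hence "measure ?M ?E \<le> measure ?M ?C / 2"
    unfolding mE using mult_right_mono[of "(1/2 :: real) ^ (N * DIM('k))" "1/2" "measure ?M ?C"] by simp
  moreover have "measure ?M ?C = measure ?M ?D + measure ?M ?E"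
    unfolding CDE(1) by (rule measure_Union[OF finite finite D E CDE(2)]) auto
  ultimately show "measure ?M ?B * measure ?\<sigma> S / 2 \<le> measure ?M ?D"
    unfolding mC by (simp add: mult.commute)
qed

subsection \<open>Concentration of measure on the sphere\<close>

text \<open>The difference of the normalised vectors is
  \<open>(a - b) / |a| + (1/|a| - 1/|b|) b\<close>; each of the two terms has norm at most
  \<open>|a - b| / |a|\<close>, which is below \<open>2 |a - b|\<close>.\<close>

lemma vec_norm_diff_vec_sgn:
  fixes a b :: "nat \<Rightarrow> 'k::euclidean_space"
  assumes "vec_norm N a > 1/2" "vec_norm N b > 1/2"
  shows "vec_norm N (\<lambda>i. vec_sgn N a i - vec_sgn N b i) \<le> 4 * vec_norm N (\<lambda>i. a i - b i)"
proof -
  let ?a = "vec_norm N a" and ?b = "vec_norm N b" and ?d = "vec_norm N (\<lambda>i. a i - b i)"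
  have minus: "vec_norm N (\<lambda>i. b i - a i) = ?d"
    by (simp add: vec_norm_def norm_minus_commute)
  have "?a \<le> ?d + ?b" "?b \<le> ?d + ?a"
    using vec_norm_add_le[of N "\<lambda>i. a i - b i" b] vec_norm_add_le[of N "\<lambda>i. b i - a i" a] minus by auto
  hence ab: "\<bar>?b - ?a\<bar> \<le> ?d" by linarith
  have "vec_norm N (\<lambda>i. vec_sgn N a i - vec_sgn N b i)
    = vec_norm N (\<lambda>i. (1 / ?a) *\<^sub>R (a i - b i) + (1 / ?a - 1 / ?b) *\<^sub>R b i)"
    by (intro vec_norm_cong) (simp add: vec_sgn_def algebra_simps inverse_eq_divide)
  also have "\<dots> \<le> \<bar>1 / ?a\<bar> * ?d + \<bar>1 / ?a - 1 / ?b\<bar> * ?b"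
    using vec_norm_add_le[of N "\<lambda>i. (1 / ?a) *\<^sub>R (a i - b i)" "\<lambda>i. (1 / ?a - 1 / ?b) *\<^sub>R b i"]
    by (simp only: vec_norm_scaleR)
  also have "\<bar>1 / ?a - 1 / ?b\<bar> * ?b = \<bar>?b - ?a\<bar> / ?a"
  proof -
    have "1 / ?a - 1 / ?b = (?b - ?a) / (?a * ?b)" using assms by (simp add: field_simps)
    thus ?thesis using assms by (simp add: abs_mult)
  qed
  also have "\<bar>1 / ?a\<bar> * ?d + \<bar>?b - ?a\<bar> / ?a \<le> ?d / ?a + ?d / ?a"
    using ab assms by (intro add_mono divide_right_mono) auto
  also have "?d / ?a + ?d / ?a \<le> ?d / (1/2) + ?d / (1/2)"
    using assms by (intro add_mono divide_left_mono) auto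
  finally show ?thesis by simp
qed

text \<open>
  Levy's concentration inequality, by the argument of Arias-de-Reyna, Ball and Villa: the midpoints of
  two distant subsets of the unit ball lie in a smaller ball, so by Brunn--Minkowski one of them is small.
\<close>

lemma sphere_concentration_upper:
  fixes F :: "(nat \<Rightarrow> 'k::euclidean_space) \<Rightarrow> real"
  assumes F[measurable]: "F \<in> borel_measurable (vec_borel N)"
    and lip: "\<And>a b. \<bar>F a - F b\<bar> \<le> L * vec_norm N (\<lambda>i. a i - b i)" and L: "L > 0" and N: "N > 0" and r: "r \<ge> 0"
    and m: "measure (uniform_unit_sphere N) {a\<in>space (uniform_unit_sphere N). F a \<le> m} \<ge> 1/2"
  shows "measure (uniform_unit_sphere N) {a\<in>space (uniform_unit_sphere N). F a > m + r}
    \<le> 8 * exp (- (real N * r\<^sup>2) / (64 * L\<^sup>2))"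
proof -
  let ?M = "vec_space N :: (nat \<Rightarrow> 'k) measure" and ?\<sigma> = "uniform_unit_sphere N :: (nat \<Rightarrow> 'k) measure"
  let ?B = "unit_ball N :: (nat \<Rightarrow> 'k) set"
  let ?n = "N * DIM('k)"
  define S where "S = {a\<in>space ?\<sigma>. F a \<le> m}"
  define T where "T = {a\<in>space ?\<sigma>. F a > m + r}"
  \<comment> \<open>Points of the annulus over the two sets are at distance at least
    \<open>t\<close>: \<open>F\<close> differs by \<open>r\<close> on their projections, which
    expand distances by at most the factor 4.\<close>
  define t where "t = r / (4 * L)"
  \<comment> \<open>By the parallelogram law a midpoint has squared norm at most
    \<open>1 - t^2 / 4\<close>, which is at most \<open>exp (- t^2 / 4)\<close>, the square of
    \<open>s\<close>.\<close>
  define s where "s = exp (- t\<^sup>2 / 8)"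
  have S[measurable]: "S \<in> sets (vec_borel N)" and T[measurable]: "T \<in> sets (vec_borel N)"
    unfolding S_def T_def sets_uniform_unit_sphere[symmetric] by measurable
  let ?A = "{a\<in>?B. 1/2 < vec_norm N a \<and> vec_sgn N a \<in> S}"
  let ?A' = "{a\<in>?B. 1/2 < vec_norm N a \<and> vec_sgn N a \<in> T}"
  let ?C = "{a\<in>space ?M. vec_norm N a \<le> s}"
  have C: "?C \<in> sets ?M" by measurable
  have "emeasure ?M ?A * emeasure ?M ?A' \<le> (emeasure ?M ?C)\<^sup>2"
    unfolding vec_space_def
  proof (rule brunn_minkowski_PiM)
    fix a b assume a: "a \<in> ?A" and b: "b \<in> ?A'"
    have "r \<le> \<bar>F (vec_sgn N b) - F (vec_sgn N a)\<bar>" using a b by (auto simp: S_def T_def)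
    also have "\<dots> \<le> L * vec_norm N (\<lambda>i. vec_sgn N b i - vec_sgn N a i)" by (rule lip)
    also have "\<dots> \<le> L * (4 * vec_norm N (\<lambda>i. b i - a i))"
      using a b L by (intro mult_left_mono vec_norm_diff_vec_sgn) auto
    also have "vec_norm N (\<lambda>i. b i - a i) = vec_norm N (\<lambda>i. a i - b i)"
      by (simp add: vec_norm_def norm_minus_commute)
    finally have t: "t \<le> vec_norm N (\<lambda>i. a i - b i)" using L by (simp add: t_def field_simps)
    have "t \<ge> 0" using r L by (simp add: t_def)
    hence t2: "t\<^sup>2 \<le> (vec_norm N (\<lambda>i. a i - b i))\<^sup>2" using t by (intro power_mono)
    let ?z = "\<lambda>i\<in>{..<N}. midpoint (a i) (b i)"
    have "(vec_norm N ?z)\<^sup>2 = (vec_norm N (\<lambda>i. midpoint (a i) (b i)))\<^sup>2"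
      by (intro arg_cong[where f = "\<lambda>x. x\<^sup>2"] vec_norm_cong) auto
    also have "\<dots> = ((vec_norm N a)\<^sup>2 + (vec_norm N b)\<^sup>2) / 2 - (vec_norm N (\<lambda>i. a i - b i))\<^sup>2 / 4"
      by (rule vec_norm_parallelogram)
    also have "\<dots> \<le> (1 + 1) / 2 - t\<^sup>2 / 4"
      using a b t2 by (intro diff_mono divide_right_mono add_mono) (auto simp: unit_ball_def power_le_one)
    also have "\<dots> \<le> exp (- t\<^sup>2 / 4)" using exp_ge_add_one_self[of "- t\<^sup>2 / 4"] by simp
    also have "\<dots> = s\<^sup>2" by (simp add: s_def exp_double[symmetric])
    finally have "vec_norm N ?z \<le> s" by (rule power2_le_imp_le) (simp add: s_def)
    thus "?z \<in> {a\<in>space (\<Pi>\<^sub>M _\<in>{..<N}. lborel). vec_norm N a \<le> s}" by (simp add: space_PiM PiE_UNIV_domain extensional_def)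
  qed (use measure_cone_annulus(2)[OF S N] measure_cone_annulus(2)[OF T N] C in \<open>simp_all add: vec_space_def\<close>)
  moreover have eC: "emeasure ?M ?C = ennreal (s ^ ?n) * emeasure ?M ?B"
  proof -
    have "emeasure ?M ?C = (\<integral>\<^sup>+a. 1 * indicator {a. vec_norm N a \<le> s} a \<partial>?M)"
      by (subst nn_integral_indicator[symmetric, OF C]) (rule nn_integral_cong, auto split: split_indicator)
    also have "\<dots> = ennreal (s ^ ?n) * (\<integral>\<^sup>+a. 1 * indicator ?B a \<partial>?M)"
      by (rule nn_integral_cone_scale) (simp_all add: s_def)
    finally show ?thesis by (simp add: sets_vec_space)
  qed
  moreover have B: "?B \<in> sets ?M" by (simp add: sets_vec_space)
  have fin: "emeasure ?M ?B < top" by (rule emeasure_unit_ball)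
  have e: "emeasure ?M X = ennreal (measure ?M X)" if "X \<subseteq> ?B" for X
    using emeasure_mono[OF that B] fin by (intro emeasure_eq_ennreal_measure) (auto simp: top_unique)
  let ?b = "measure ?M ?B" and ?P = "measure ?\<sigma> T"
  have b: "?b > 0" using emeasure_unit_ball[where 'k='k, of N] e[of ?B] by (auto simp: zero_less_measure_iff)
  ultimately have "ennreal (measure ?M ?A) * ennreal (measure ?M ?A') \<le> (ennreal (s ^ ?n) * ennreal ?b)\<^sup>2"
    using e[of ?A] e[of ?A'] e[of ?B] by auto
  also have "\<dots> = ennreal ((s ^ ?n * ?b)\<^sup>2)" by (simp add: s_def ennreal_mult[symmetric] ennreal_power)
  finally have AA': "measure ?M ?A * measure ?M ?A' \<le> (s ^ ?n * ?b)\<^sup>2"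
    by (simp add: ennreal_mult[symmetric])
  have "?b * measure ?\<sigma> S / 2 \<le> measure ?M ?A" "?b * ?P / 2 \<le> measure ?M ?A'"
    using measure_cone_annulus(1)[OF S N] measure_cone_annulus(1)[OF T N] by auto
  moreover have "?b * (1/2) / 2 \<le> ?b * measure ?\<sigma> S / 2" using m b by (intro divide_right_mono mult_left_mono) (auto simp: S_def)
  ultimately have "?b * (1/2) / 2 \<le> measure ?M ?A" "?b * ?P / 2 \<le> measure ?M ?A'" by linarith+
  hence "(?b * (1/2) / 2) * (?b * ?P / 2) \<le> measure ?M ?A * measure ?M ?A'"
    using b by (intro mult_mono) auto
  \<comment> \<open>The 8 collects three halves: the annulus keeps half of each cone, and the median
    set has probability at least 1/2.\<close>
  hence "?b\<^sup>2 * ?P / 8 \<le> (s ^ ?n)\<^sup>2 * ?b\<^sup>2" using AA' by (simp add: power2_eq_square mult_ac)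
  hence "?P \<le> 8 * (s ^ ?n)\<^sup>2" using b by (simp add: field_simps)
  also have "(s ^ ?n)\<^sup>2 = exp (- (real ?n * t\<^sup>2) / 4)"
  proof -
    have "(s ^ ?n)\<^sup>2 = exp (2 * (real ?n * (- t\<^sup>2 / 8)))" by (simp only: s_def exp_of_nat_mult exp_double)
    also have "2 * (real ?n * (- t\<^sup>2 / 8)) = - (real ?n * t\<^sup>2) / 4" by simp
    finally show ?thesis .
  qed
  \<comment> \<open>The real dimension is weakened to \<open>N\<close>, so that real and complex
    scalars share one bound.\<close>
  also have "- (real ?n * t\<^sup>2) / 4 \<le> - (real N * t\<^sup>2) / 4"
  proof -
    have "real N * 1 \<le> real N * real DIM('k)" by (intro mult_left_mono) (auto simp: Suc_le_eq)
    hence "real N * t\<^sup>2 \<le> real ?n * t\<^sup>2" by (intro mult_right_mono) auto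
    thus ?thesis by simp
  qed
  also have "- (real N * t\<^sup>2) / 4 = - (real N * r\<^sup>2) / (64 * L\<^sup>2)" by (simp add: t_def power_divide power_mult_distrib)
  finally show ?thesis by (simp add: T_def)
qed

text \<open>The lower tail of \<open>F\<close> is the upper tail of \<open>- F\<close>, for which
  \<open>- m\<close> is a median; the two tails double the factor 8.\<close>

theorem sphere_concentration:
  fixes F :: "(nat \<Rightarrow> 'k::euclidean_space) \<Rightarrow> real"
  assumes F[measurable]: "F \<in> borel_measurable (vec_borel N)"
    and lip: "\<And>a b. \<bar>F a - F b\<bar> \<le> L * vec_norm N (\<lambda>i. a i - b i)" and L: "L > 0" and N: "N > 0" and r: "r \<ge> 0"
    and m: "is_median (uniform_unit_sphere N) F m"
  shows "measure (uniform_unit_sphere N) {a\<in>space (uniform_unit_sphere N). \<bar>F a - m\<bar> > r}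
    \<le> 16 * exp (- (real N * r\<^sup>2) / (64 * L\<^sup>2))"
proof -
  let ?\<sigma> = "uniform_unit_sphere N :: (nat \<Rightarrow> 'k) measure"
  interpret prob_space ?\<sigma> by (rule prob_space_uniform_unit_sphere)
  have "{a\<in>space ?\<sigma>. \<bar>F a - m\<bar> > r} = {a\<in>space ?\<sigma>. F a > m + r} \<union> {a\<in>space ?\<sigma>. - F a > - m + r}"
    by auto
  hence "measure ?\<sigma> {a\<in>space ?\<sigma>. \<bar>F a - m\<bar> > r}
    \<le> measure ?\<sigma> {a\<in>space ?\<sigma>. F a > m + r} + measure ?\<sigma> {a\<in>space ?\<sigma>. - F a > - m + r}"
    by (simp only:) (rule measure_Un_le; measurable)
  also have "\<dots> \<le> 8 * exp (- (real N * r\<^sup>2) / (64 * L\<^sup>2)) + 8 * exp (- (real N * r\<^sup>2) / (64 * L\<^sup>2))"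
  proof (rule add_mono)
    show "measure ?\<sigma> {a\<in>space ?\<sigma>. F a > m + r} \<le> 8 * exp (- (real N * r\<^sup>2) / (64 * L\<^sup>2))"
      using m by (intro sphere_concentration_upper F lip L N r) (simp add: is_median_def)
    show "measure ?\<sigma> {a\<in>space ?\<sigma>. - F a > - m + r} \<le> 8 * exp (- (real N * r\<^sup>2) / (64 * L\<^sup>2))"
    proof (rule sphere_concentration_upper[where F = "\<lambda>a. - F a"])
      show "\<bar>- F a - - F b\<bar> \<le> L * vec_norm N (\<lambda>i. a i - b i)" for a b using lip[of a b] by simp
      show "1/2 \<le> measure ?\<sigma> {a\<in>space ?\<sigma>. - F a \<le> - m}" using m by (simp add: is_median_def)
    qed (use L N r in \<open>simp_all\<close>)
  qed
  finally show ?thesis by simp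
qed

subsection \<open>Columns of Haar distributed matrices\<close>

definition unit_vec :: "nat \<Rightarrow> nat \<Rightarrow> nat \<Rightarrow> 'k::comm_ring_1" where
  "unit_vec N l = (\<lambda>i\<in>{..<N}. if i = l then 1 else 0)"

lemma mat_vec_unit_vec: "l < N \<Longrightarrow> mat_vec N U (unit_vec N l) = (\<lambda>i\<in>{..<N}. U (i, l))"
  by (auto simp: mat_vec_def unit_vec_def fun_eq_iff if_distrib[of "\<lambda>x. _ * x"] cong: if_cong)

lemma mat_vec_extensional: "mat_vec N U a \<in> extensional {..<N}"
  by (simp add: mat_vec_def)

lemma vec_norm_unit_vec: "l < N \<Longrightarrow> vec_norm N (unit_vec N l :: nat \<Rightarrow> 'k::rc_field) = 1"
proof -
  assume l: "l < N"
  have "(vec_norm N (unit_vec N l :: nat \<Rightarrow> 'k))\<^sup>2 = (\<Sum>i<N. if i = l then 1 else 0)"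
    unfolding vec_norm_power2 by (intro sum.cong) (auto simp: unit_vec_def)
  thus ?thesis using l by (simp add: power2_eq_1_iff) (smt (verit) vec_norm_nonneg)
qed

lemma matrix_prod_unitary:
  fixes V W :: "nat \<times> nat \<Rightarrow> 'k::rc_field"
  assumes V: "V \<in> unitary_group N" and W: "W \<in> unitary_group N"
  shows "matrix_prod N V W \<in> unitary_group N"
proof -
  have "(\<Sum>m<N. conjugate (matrix_prod N V W (m, i)) * matrix_prod N V W (m, j)) = (if i = j then 1 else 0)"
    if ij: "i < N" "j < N" for i j
  proof -
    have "(\<Sum>m<N. conjugate (matrix_prod N V W (m, i)) * matrix_prod N V W (m, j))
      = (\<Sum>m<N. \<Sum>p<N. \<Sum>q<N. (W (p, j) * conjugate (W (q, i))) * (conjugate (V (m, q)) * V (m, p)))"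
      using ij by (simp add: matrix_prod_def sum_conjugate sum_product conjugate_dist_mul mult_ac)
    also have "\<dots> = (\<Sum>p<N. \<Sum>m<N. \<Sum>q<N. (W (p, j) * conjugate (W (q, i))) * (conjugate (V (m, q)) * V (m, p)))"
      by (rule sum.swap)
    also have "\<dots> = (\<Sum>p<N. \<Sum>q<N. (W (p, j) * conjugate (W (q, i))) * (\<Sum>m<N. conjugate (V (m, q)) * V (m, p)))"
      unfolding sum_distrib_left by (rule sum.cong[OF refl], rule sum.swap)
    also have "\<dots> = (\<Sum>p<N. \<Sum>q<N. if q = p then conjugate (W (p, i)) * W (p, j) else 0)"
      using unitary_groupD[OF V] by (intro sum.cong refl) (auto simp: mult.commute)
    also have "\<dots> = (if i = j then 1 else 0)" using unitary_groupD[OF W] ij by simp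
    finally show ?thesis .
  qed
  thus ?thesis by (auto simp: unitary_group_def matrix_prod_def)
qed

lemma mat_adjoint_matrix_prod:
  "mat_vec N (mat_adjoint N (matrix_prod N V U)) (x :: nat \<Rightarrow> 'k::rc_field)
    = mat_vec N (mat_adjoint N U) (mat_vec N (mat_adjoint N V) x)"
proof
  fix i
  have "(\<Sum>m<N. (\<Sum>j<N. conjugate (V (m, j)) * conjugate (U (j, i))) * x m)
    = (\<Sum>m<N. conjugate (U (m, i)) * (\<Sum>j<N. conjugate (V (j, m)) * x j))"
    unfolding sum_distrib_left sum_distrib_right by (subst sum.swap) (simp add: mult_ac)
  thus "mat_vec N (mat_adjoint N (matrix_prod N V U)) x i
    = mat_vec N (mat_adjoint N U) (mat_vec N (mat_adjoint N V) x) i"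
    by (simp add: mat_vec_def mat_adjoint_def matrix_prod_def sum_conjugate conjugate_dist_mul)
qed

context
  fixes N :: nat and \<nu> :: "(nat \<times> nat \<Rightarrow> 'k::rc_field) measure"
  assumes haar: "haar_prob N \<nu>"
begin

lemma sets_haar: "sets \<nu> = sets (restrict_space (\<Pi>\<^sub>M _\<in>{..<N} \<times> {..<N}. borel) (unitary_group N))"
  using haar by (simp add: haar_prob_def)

lemma space_haar: "space \<nu> = unitary_group N"
  unfolding sets_eq_imp_space_eq[OF sets_haar] space_restrict_space
  by (auto simp: space_PiM unitary_group_def PiE_def)

lemma measurable_haar_entry:
  assumes "i < N" "j < N"
  shows "(\<lambda>U. U (i, j)) \<in> borel_measurable \<nu>"
proof -
  have "(\<lambda>U. U (i, j)) \<in> borel_measurable (restrict_space (\<Pi>\<^sub>M _\<in>{..<N} \<times> {..<N}. borel :: 'k measure) (unitary_group N))"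
    using assms by (intro measurable_restrict_space1) measurable
  thus ?thesis using sets_haar by (simp cong: measurable_cong_sets)
qed

lemma measurable_haarI:
  assumes "\<And>i j. i < N \<Longrightarrow> j < N \<Longrightarrow> (\<lambda>x. f x (i, j)) \<in> borel_measurable M"
    and "\<And>x. x \<in> space M \<Longrightarrow> f x \<in> unitary_group N"
  shows "f \<in> measurable M \<nu>"
proof -
  have "f \<in> measurable M (restrict_space (\<Pi>\<^sub>M _\<in>{..<N} \<times> {..<N}. borel) (unitary_group N))"
  proof (rule measurable_restrict_space2)
    show "f \<in> space M \<rightarrow> unitary_group N" using assms(2) by auto
    show "f \<in> measurable M (\<Pi>\<^sub>M _\<in>{..<N} \<times> {..<N}. borel)"
    proof (rule measurable_PiM_single')
      have "f x \<in> extensional ({..<N} \<times> {..<N})" if "x \<in> space M" for x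
        using assms(2)[OF that] by (simp add: unitary_group_def)
      thus "f \<in> space M \<rightarrow> (\<Pi>\<^sub>E i\<in>{..<N} \<times> {..<N}. space borel)" by (auto simp: PiE_def)
    qed (use assms(1) in auto)
  qed
  thus ?thesis using sets_haar by (simp cong: measurable_cong_sets)
qed

lemma measurable_matrix_prod:
  assumes "V \<in> unitary_group N"
  shows "matrix_prod N V \<in> measurable \<nu> \<nu>"
proof (rule measurable_haarI)
  show "(\<lambda>U. matrix_prod N V U (i, j)) \<in> borel_measurable \<nu>" if ij: "i < N" "j < N" for i j
  proof -
    have "(\<lambda>U. \<Sum>m<N. V (i, m) * U (m, j)) \<in> borel_measurable \<nu>"
      using ij by (intro borel_measurable_sum borel_measurable_times measurable_haar_entry) auto
    thus ?thesis using ij by (simp add: matrix_prod_def)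
  qed
qed (auto simp: space_haar assms matrix_prod_unitary)

lemma nn_integral_haar_left:
  assumes V: "V \<in> unitary_group N" and f: "f \<in> borel_measurable \<nu>"
  shows "(\<integral>\<^sup>+U. f (matrix_prod N V U) \<partial>\<nu>) = (\<integral>\<^sup>+U. f U \<partial>\<nu>)"
proof -
  have "(\<integral>\<^sup>+U. f U \<partial>\<nu>) = (\<integral>\<^sup>+U. f U \<partial>distr \<nu> \<nu> (matrix_prod N V))"
    using haar V by (simp add: haar_prob_def)
  also have "\<dots> = (\<integral>\<^sup>+U. f (matrix_prod N V U) \<partial>\<nu>)"
    using f by (subst nn_integral_distr) (simp_all add: measurable_matrix_prod V)
  finally show ?thesis by simp
qed

lemma measurable_mat_vec_haar:
  assumes [measurable]: "U \<in> measurable M \<nu>" and [measurable]: "x \<in> measurable M (vec_borel N)"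
  shows "(\<lambda>z. mat_vec N (U z) (x z)) \<in> measurable M (vec_borel N)"
    and "(\<lambda>z. mat_vec N (mat_adjoint N (U z)) (x z)) \<in> measurable M (vec_borel N)"
proof -
  have U: "(\<lambda>z. U z (i, j)) \<in> borel_measurable M" if "i < N" "j < N" for i j
    using measurable_compose[OF assms(1) measurable_haar_entry[OF that]] .
  have x: "(\<lambda>z. x z i) \<in> borel_measurable M" if "i < N" for i
    using that by (intro measurable_compose[OF assms(2) measurable_component_singleton]) auto
  show "(\<lambda>z. mat_vec N (U z) (x z)) \<in> measurable M (vec_borel N)"
    unfolding mat_vec_def
    by (intro measurable_restrict borel_measurable_sum borel_measurable_times U x) auto
  show "(\<lambda>z. mat_vec N (mat_adjoint N (U z)) (x z)) \<in> measurable M (vec_borel N)"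
    unfolding mat_vec_def
  proof (intro measurable_restrict borel_measurable_sum borel_measurable_times x)
    fix i m assume "i \<in> {..<N}" "m \<in> {..<N}"
    thus "(\<lambda>z. mat_adjoint N (U z) (i, m)) \<in> borel_measurable M"
      using measurable_compose[OF U measurable_conjugate, of m i] by (simp add: mat_adjoint_def)
  qed auto
qed

text \<open>Every unit vector \<open>y\<close> is a column of some unitary \<open>V\<close>, whose
  adjoint maps \<open>y\<close> to a coordinate vector. Left invariance, which replaces
  \<open>U\<close> by the product of \<open>V\<close> and \<open>U\<close>, therefore makes the
  integral independent of the unit vector. Averaging over that vector with the uniform measure and
  exchanging integrals, each fixed \<open>U\<close> contributes the right-hand side.\<close>

lemma nn_integral_haar_adjoint:
  fixes f :: "(nat \<Rightarrow> 'k) \<Rightarrow> ennreal"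
  assumes f[measurable]: "f \<in> borel_measurable (vec_borel N)"
    and x: "vec_norm N x = 1" "x \<in> extensional {..<N}"
  shows "(\<integral>\<^sup>+U. f (mat_vec N (mat_adjoint N U) x) \<partial>\<nu>) = (\<integral>\<^sup>+a. f a \<partial>uniform_unit_sphere N)"
proof -
  interpret \<nu>: prob_space \<nu> using haar by (simp add: haar_prob_def)
  interpret \<sigma>: prob_space "uniform_unit_sphere N :: (nat \<Rightarrow> 'k) measure" by (rule prob_space_uniform_unit_sphere)
  interpret pair_sigma_finite \<nu> "uniform_unit_sphere N :: (nat \<Rightarrow> 'k) measure" ..
  have "N > 0" using x(1) by (cases N) (auto simp: vec_norm_def)
  let ?g = "\<lambda>x. \<integral>\<^sup>+U. f (mat_vec N (mat_adjoint N U) x) \<partial>\<nu>"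
  let ?u = "unit_vec N 0 :: nat \<Rightarrow> 'k"
  have const: "?g y = ?g ?u" if y: "vec_norm N y = 1" "y \<in> extensional {..<N}" for y
  proof -
    obtain V where V: "V \<in> unitary_group N" "\<And>m. m < N \<Longrightarrow> V (m, 0) = y m"
      using exists_unitary_column[OF y(1) \<open>N > 0\<close>] by metis
    have "mat_vec N V ?u = y"
      using \<open>N > 0\<close> V(2) y(2) by (auto simp: mat_vec_unit_vec fun_eq_iff extensional_def)
    hence "mat_vec N (mat_adjoint N V) y = ?u"
      using mat_vec_adjoint(1)[OF V(1), of ?u] by (simp add: unit_vec_def)
    hence "?g ?u = (\<integral>\<^sup>+U. f (mat_vec N (mat_adjoint N (matrix_prod N V U)) y) \<partial>\<nu>)"
      by (simp add: mat_adjoint_matrix_prod)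
    also have "\<dots> = ?g y"
    proof (rule nn_integral_haar_left[OF V(1)])
      have "(\<lambda>U. mat_vec N (mat_adjoint N U) y) \<in> measurable \<nu> (vec_borel N)"
        by (rule measurable_mat_vec_haar(2)) (use y in \<open>auto simp: space_PiM PiE_def\<close>)
      thus "(\<lambda>U. f (mat_vec N (mat_adjoint N U) y)) \<in> borel_measurable \<nu>" by measurable
    qed
    finally show ?thesis by simp
  qed
  have "?g ?u = (\<integral>\<^sup>+y. ?g ?u \<partial>(uniform_unit_sphere N :: (nat \<Rightarrow> 'k) measure))" by (simp add: \<sigma>.emeasure_space_1)
  also have "\<dots> = (\<integral>\<^sup>+y. ?g y \<partial>uniform_unit_sphere N)"
  proof (rule nn_integral_cong_AE)
    show "AE y in uniform_unit_sphere N. ?g ?u = ?g y"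
      using AE_uniform_unit_sphere[OF \<open>N > 0\<close>, where 'k='k] AE_space
      by eventually_elim (use const in \<open>auto simp: space_uniform_unit_sphere\<close>)
  qed
  also have "\<dots> = (\<integral>\<^sup>+U. (\<integral>\<^sup>+y. f (mat_vec N (mat_adjoint N U) y) \<partial>uniform_unit_sphere N) \<partial>\<nu>)"
  proof (rule Fubini')
    have "(\<lambda>z. mat_vec N (mat_adjoint N (fst z)) (snd z)) \<in> measurable (\<nu> \<Otimes>\<^sub>M uniform_unit_sphere N) (vec_borel N)"
      by (rule measurable_mat_vec_haar(2)) measurable
    from measurable_compose[OF this f]
    show "(\<lambda>(U, y). f (mat_vec N (mat_adjoint N U) y)) \<in> borel_measurable (\<nu> \<Otimes>\<^sub>M uniform_unit_sphere N)"
      by (simp add: case_prod_unfold)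
  qed
  also have "\<dots> = (\<integral>\<^sup>+U. (\<integral>\<^sup>+y. f y \<partial>uniform_unit_sphere N) \<partial>\<nu>)"
    by (intro nn_integral_cong nn_integral_uniform_unit_sphere_unitary mat_adjoint_unitary f) (simp add: space_haar)
  also have "\<dots> = (\<integral>\<^sup>+y. f y \<partial>uniform_unit_sphere N)" by (simp add: \<nu>.emeasure_space_1)
  finally show ?thesis using const[OF x] by simp
qed

text \<open>
  Only left invariance is assumed, which directly gives the law of the rows of \<open>U\<close>; it is transferred to the
  columns by evaluating \<open>\<integral>\<integral> f (U\<^sup>* W e\<^sub>l)\<close> in both orders.
\<close>

lemma nn_integral_haar_column:
  fixes f :: "(nat \<Rightarrow> 'k) \<Rightarrow> ennreal"
  assumes f[measurable]: "f \<in> borel_measurable (vec_borel N)" and l: "l < N"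
  shows "(\<integral>\<^sup>+U. f (\<lambda>m\<in>{..<N}. U (m, l)) \<partial>\<nu>) = (\<integral>\<^sup>+a. f a \<partial>uniform_unit_sphere N)"
proof -
  interpret \<nu>: prob_space \<nu> using haar by (simp add: haar_prob_def)
  interpret pair_sigma_finite \<nu> \<nu> ..
  let ?u = "unit_vec N l :: nat \<Rightarrow> 'k"
  have u: "?u \<in> space (vec_borel N)" by (simp add: unit_vec_def space_PiM)
  have m1: "(\<lambda>W. mat_vec N W ?u) \<in> measurable \<nu> (vec_borel N)"
    by (rule measurable_mat_vec_haar(1)) (use u in auto)
  have m2: "(\<lambda>z. mat_vec N (mat_adjoint N (fst z)) (mat_vec N (snd z) ?u)) \<in> measurable (\<nu> \<Otimes>\<^sub>M \<nu>) (vec_borel N)"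
    by (intro measurable_mat_vec_haar measurable_fst measurable_compose[OF measurable_snd m1])
  have "(\<integral>\<^sup>+W. f (mat_vec N W ?u) \<partial>\<nu>) = (\<integral>\<^sup>+U. (\<integral>\<^sup>+W. f (mat_vec N W ?u) \<partial>\<nu>) \<partial>\<nu>)"
    by (simp add: \<nu>.emeasure_space_1)
  also have "\<dots> = (\<integral>\<^sup>+U. (\<integral>\<^sup>+W. f (mat_vec N (mat_adjoint N U) (mat_vec N W ?u)) \<partial>\<nu>) \<partial>\<nu>)"
  proof (rule nn_integral_cong)
    fix U assume "U \<in> space \<nu>"
    hence "mat_adjoint N U \<in> unitary_group N" by (simp add: space_haar mat_adjoint_unitary)
    from nn_integral_haar_left[OF this measurable_compose[OF m1 f]]
    show "(\<integral>\<^sup>+W. f (mat_vec N W ?u) \<partial>\<nu>) = (\<integral>\<^sup>+W. f (mat_vec N (mat_adjoint N U) (mat_vec N W ?u)) \<partial>\<nu>)"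
      by (simp only: mat_vec_mat_vec)
  qed
  also have "\<dots> = (\<integral>\<^sup>+W. (\<integral>\<^sup>+U. f (mat_vec N (mat_adjoint N U) (mat_vec N W ?u)) \<partial>\<nu>) \<partial>\<nu>)"
    by (rule Fubini'[symmetric]) (use measurable_compose[OF m2 f] in \<open>simp add: case_prod_unfold\<close>)
  also have "\<dots> = (\<integral>\<^sup>+W. (\<integral>\<^sup>+a. f a \<partial>uniform_unit_sphere N) \<partial>\<nu>)"
    by (intro nn_integral_cong nn_integral_haar_adjoint f)
      (use l in \<open>simp_all add: space_haar vec_norm_mat_vec vec_norm_unit_vec mat_vec_extensional\<close>)
  also have "\<dots> = (\<integral>\<^sup>+a. f a \<partial>uniform_unit_sphere N)" by (simp add: \<nu>.emeasure_space_1)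
  finally show ?thesis using l by (simp add: mat_vec_unit_vec)
qed

lemma distr_haar_column:
  assumes l: "l < N"
  shows "(\<lambda>U. \<lambda>m\<in>{..<N}. U (m, l)) \<in> measurable \<nu> (vec_borel N)"
    and "distr \<nu> (vec_borel N) (\<lambda>U. \<lambda>m\<in>{..<N}. U (m, l)) = uniform_unit_sphere N"
proof -
  show m: "(\<lambda>U. \<lambda>m\<in>{..<N}. U (m, l)) \<in> measurable \<nu> (vec_borel N)"
    using l by (intro measurable_restrict measurable_haar_entry) auto
  show "distr \<nu> (vec_borel N) (\<lambda>U. \<lambda>m\<in>{..<N}. U (m, l)) = uniform_unit_sphere N"
  proof (rule measure_eqI)
    fix A assume "A \<in> sets (distr \<nu> (\<Pi>\<^sub>M _\<in>{..<N}. borel :: 'k measure) (\<lambda>U. \<lambda>m\<in>{..<N}. U (m, l)))"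
    hence A: "A \<in> sets (vec_borel N)" by simp
    have "emeasure (distr \<nu> (vec_borel N) (\<lambda>U. \<lambda>m\<in>{..<N}. U (m, l))) A
      = (\<integral>\<^sup>+a. indicator A a \<partial>distr \<nu> (vec_borel N) (\<lambda>U. \<lambda>m\<in>{..<N}. U (m, l)))"
      using A by simp
    also have "\<dots> = (\<integral>\<^sup>+U. indicator A (\<lambda>m\<in>{..<N}. U (m, l)) \<partial>\<nu>)"
      using A by (subst nn_integral_distr[OF m]) simp_all
    also have "\<dots> = (\<integral>\<^sup>+a. indicator A a \<partial>uniform_unit_sphere N)"
      using A l by (intro nn_integral_haar_column) auto
    also have "\<dots> = emeasure (uniform_unit_sphere N) A" using A by simp
    finally show "emeasure (distr \<nu> (vec_borel N) (\<lambda>U. \<lambda>m\<in>{..<N}. U (m, l))) A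
      = emeasure (uniform_unit_sphere N) A" .
  qed simp
qed

end

subsection \<open>The surface measure\<close>

lemma nn_integral_lborel_translate:
  fixes f :: "'a::euclidean_space \<Rightarrow> ennreal"
  assumes "f \<in> borel_measurable borel"
  shows "(\<integral>\<^sup>+x. f (t + x) \<partial>lborel) = (\<integral>\<^sup>+x. f x \<partial>lborel)"
proof -
  have "(\<integral>\<^sup>+x. f x \<partial>lborel) = (\<integral>\<^sup>+x. f x \<partial>distr lborel borel ((+) t))" by (simp add: lborel_distr_plus)
  also have "\<dots> = (\<integral>\<^sup>+x. f (t + x) \<partial>lborel)" using assms by (subst nn_integral_distr) auto
  finally show ?thesis by simp
qed

lemma measurable_orthogonal_transformation:
  fixes T :: "'a::euclidean_space \<Rightarrow> 'a"
  shows "orthogonal_transformation T \<Longrightarrow> T \<in> borel_measurable borel"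
  by (intro borel_measurable_continuous_onI linear_continuous_on linear_conv_bounded_linear[THEN iffD1]
    orthogonal_transformation_linear)

text \<open>The argument of \<open>nn_integral_vec_space_unitary\<close>, carried out on the
  Euclidean space: the double integral against the indicator of the unit ball is evaluated in both
  orders, using translation invariance and the fact that \<open>T\<close> preserves the
  ball.\<close>

lemma nn_integral_lborel_orthogonal:
  fixes f :: "'a::euclidean_space \<Rightarrow> ennreal" and T :: "'a \<Rightarrow> 'a"
  assumes T: "orthogonal_transformation T" and f[measurable]: "f \<in> borel_measurable borel"
  shows "(\<integral>\<^sup>+x. f (T x) \<partial>lborel) = (\<integral>\<^sup>+x. f x \<partial>lborel)"
proof -
  note mT[measurable] = measurable_orthogonal_transformation[OF T]
  have [measurable]: "ball (0::'a) 1 \<in> sets borel" by simp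
  define W where "W = inv T"
  have TW: "T (W x) = x" for x
    unfolding W_def using orthogonal_transformation_surj[OF T] by (simp add: surj_f_inv_f)
  note lin = orthogonal_transformation_linear[OF T]
  let ?D = "indicator (ball 0 1) :: 'a \<Rightarrow> ennreal" and ?d = "emeasure lborel (ball (0::'a) 1)"
  have d: "?d \<noteq> 0" "?d < top"
    using content_ball_pos[of 1 "0::'a"] emeasure_lborel_ball_finite[of "0::'a" 1] by (auto simp: measure_def)
  have "?d * (\<integral>\<^sup>+y. f (T y) \<partial>lborel) = (\<integral>\<^sup>+x. ?D x * (\<integral>\<^sup>+y. f (T y) \<partial>lborel) \<partial>lborel)"
    by (subst nn_integral_multc) auto
  also have "\<dots> = (\<integral>\<^sup>+x. (\<integral>\<^sup>+y. ?D x * f (T y + x) \<partial>lborel) \<partial>lborel)"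
  proof (rule nn_integral_cong)
    fix x :: 'a
    have "(\<integral>\<^sup>+y. f (T (W x + y)) \<partial>lborel) = (\<integral>\<^sup>+y. f (T y) \<partial>lborel)"
      by (rule nn_integral_lborel_translate) measurable
    moreover have "T (W x + y) = T y + x" for y by (simp add: linear_add[OF lin] TW)
    ultimately show "?D x * (\<integral>\<^sup>+y. f (T y) \<partial>lborel) = (\<integral>\<^sup>+y. ?D x * f (T y + x) \<partial>lborel)"
      by (subst nn_integral_cmult) simp_all
  qed
  also have "\<dots> = (\<integral>\<^sup>+y. (\<integral>\<^sup>+x. ?D x * f (T y + x) \<partial>lborel) \<partial>lborel)"
    by (rule lborel_pair.Fubini') measurable
  also have "\<dots> = (\<integral>\<^sup>+y. (\<integral>\<^sup>+x. ?D (x - T y) * f x \<partial>lborel) \<partial>lborel)"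
  proof (rule nn_integral_cong)
    fix y
    show "(\<integral>\<^sup>+x. ?D x * f (T y + x) \<partial>lborel) = (\<integral>\<^sup>+x. ?D (x - T y) * f x \<partial>lborel)"
      using nn_integral_lborel_translate[of "\<lambda>x. ?D (x - T y) * f x" "T y"] by simp
  qed
  also have "\<dots> = (\<integral>\<^sup>+x. (\<integral>\<^sup>+y. ?D (x - T y) * f x \<partial>lborel) \<partial>lborel)"
    by (rule lborel_pair.Fubini'[symmetric]) measurable
  also have "\<dots> = (\<integral>\<^sup>+x. ?d * f x \<partial>lborel)"
  proof (rule nn_integral_cong)
    fix x :: 'a
    have "norm (x - T y) = norm (- W x + y)" for y
    proof -
      have "T (- W x + y) = - (x - T y)" by (simp add: linear_add[OF lin] linear_neg[OF lin] linear_diff[OF lin] TW)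
      thus ?thesis using orthogonal_transformation_norm[OF T, of "- W x + y"] by (metis norm_minus_cancel)
    qed
    hence "(\<integral>\<^sup>+y. ?D (x - T y) * f x \<partial>lborel) = (\<integral>\<^sup>+y. ?D (- W x + y) * f x \<partial>lborel)"
      by (intro nn_integral_cong) (simp add: indicator_def)
    also have "\<dots> = (\<integral>\<^sup>+y. ?D (- W x + y) \<partial>lborel) * f x" by (rule nn_integral_multc) measurable
    also have "(\<integral>\<^sup>+y. ?D (- W x + y) \<partial>lborel) = (\<integral>\<^sup>+y. ?D y \<partial>lborel)"
      by (rule nn_integral_lborel_translate) measurable
    finally show "(\<integral>\<^sup>+y. ?D (x - T y) * f x \<partial>lborel) = ?d * f x" by simp
  qed
  also have "\<dots> = ?d * (\<integral>\<^sup>+x. f x \<partial>lborel)" by (rule nn_integral_cmult) measurable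
  finally show ?thesis using d by (subst (asm) ennreal_mult_cancel_left) auto
qed

lemma sets_sphere_measure [simp, measurable_cong]: "sets sphere_measure = sets borel"
  by (simp add: sphere_measure_def)

lemma space_sphere_measure [simp]: "space sphere_measure = UNIV"
  using sets_eq_imp_space_eq[OF sets_sphere_measure] by simp

lemma measurable_sgn: "(sgn :: 'a::euclidean_space \<Rightarrow> 'a) \<in> borel_measurable borel"
  unfolding sgn_div_norm[abs_def] by measurable

lemma nn_integral_sphere_measure:
  fixes f :: "real^'n \<Rightarrow> ennreal"
  assumes [measurable]: "f \<in> borel_measurable borel"
  shows "(\<integral>\<^sup>+x. f x \<partial>sphere_measure) = of_nat CARD('n) * (\<integral>\<^sup>+x. f (sgn x) * indicator (ball 0 1) x \<partial>lborel)"
proof -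
  note measurable_sgn[measurable]
  have m: "(sgn :: real^'n \<Rightarrow> _) \<in> measurable (restrict_space lborel (ball 0 1)) borel"
    by (rule measurable_restrict_space1) measurable
  show ?thesis unfolding sphere_measure_def
    by (simp add: nn_integral_scale_measure nn_integral_distr[OF m] nn_integral_restrict_space)
qed

lemma finite_sphere_measure: "finite_measure (sphere_measure :: (real^'n) measure)"
proof
  have "emeasure (sphere_measure :: (real^'n) measure) UNIV = (\<integral>\<^sup>+x. 1 \<partial>(sphere_measure :: (real^'n) measure))"
    by simp
  also have "\<dots> = of_nat CARD('n) * emeasure lborel (ball (0::real^'n) 1)"
    by (subst nn_integral_sphere_measure) simp_all
  also have "\<dots> \<noteq> \<infinity>"
    using emeasure_lborel_ball_finite[of "0::real^'n" 1] by (simp add: ennreal_mult_eq_top_iff of_nat_less_top less_top[symmetric])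
  finally show "emeasure (sphere_measure :: (real^'n) measure) (space sphere_measure) \<noteq> \<infinity>" by simp
qed

interpretation sphere_measure: finite_measure "sphere_measure :: (real^'n) measure"
  by (rule finite_sphere_measure)

text \<open>The only point that \<open>sgn\<close> does not send to the sphere is the origin, which
  has Lebesgue measure zero.\<close>

lemma AE_sphere_measure: "AE x in (sphere_measure :: (real^'n) measure). x \<in> sphere 0 1"
proof -
  have "emeasure (sphere_measure :: (real^'n) measure) (- sphere 0 1)
    = (\<integral>\<^sup>+x. indicator (- sphere 0 1) x \<partial>(sphere_measure :: (real^'n) measure))" by simp
  also have "\<dots> = of_nat CARD('n) * (\<integral>\<^sup>+x. indicator (- sphere 0 1) (sgn x) * indicator (ball 0 1) x \<partial>(lborel :: (real^'n) measure))"
    by (rule nn_integral_sphere_measure) simp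
  also have "(\<integral>\<^sup>+x. indicator (- sphere 0 1) (sgn x) * indicator (ball 0 1) x \<partial>(lborel :: (real^'n) measure))
    = (\<integral>\<^sup>+x. 0 \<partial>(lborel :: (real^'n) measure))"
  proof (rule nn_integral_cong_AE)
    have "AE x in (lborel :: (real^'n) measure). x \<noteq> 0" by (rule AE_lborel_singleton)
    thus "AE x in (lborel :: (real^'n) measure). indicator (- sphere 0 1) (sgn x) * indicator (ball 0 1) x = (0::ennreal)"
      by eventually_elim (simp add: norm_sgn)
  qed
  finally have "- sphere 0 1 \<in> null_sets (sphere_measure :: (real^'n) measure)" by (simp add: null_sets_def)
  from AE_not_in[OF this] show ?thesis by simp
qed

lemma measure_sphere_pos: "measure (sphere_measure :: (real^'n) measure) (sphere 0 1) > 0"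
proof -
  have "emeasure (sphere_measure :: (real^'n) measure) (sphere 0 1) = emeasure (sphere_measure :: (real^'n) measure) UNIV"
    using AE_sphere_measure by (intro emeasure_eq_AE) auto
  also have "\<dots> = (\<integral>\<^sup>+x. 1 \<partial>(sphere_measure :: (real^'n) measure))" by simp
  also have "\<dots> = of_nat CARD('n) * emeasure lborel (ball (0::real^'n) 1)"
    by (subst nn_integral_sphere_measure) simp_all
  finally have "measure (sphere_measure :: (real^'n) measure) (sphere 0 1) = real CARD('n) * measure lborel (ball (0::real^'n) 1)"
    by (simp add: measure_def enn2real_mult)
  thus ?thesis by (simp add: content_ball_pos)
qed

lemma nn_integral_sphere_orthogonal:
  fixes f :: "real^'n \<Rightarrow> ennreal" and T :: "real^'n \<Rightarrow> real^'n"
  assumes T: "orthogonal_transformation T" and [measurable]: "f \<in> borel_measurable borel"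
  shows "(\<integral>\<^sup>+x. f (T x) \<partial>sphere_measure) = (\<integral>\<^sup>+x. f x \<partial>sphere_measure)"
proof -
  note [measurable] = measurable_orthogonal_transformation[OF T] measurable_sgn
  have [measurable]: "ball (0::real^'n) 1 \<in> sets borel" by simp
  have sgn: "T (sgn x) = sgn (T x)" for x
    using orthogonal_transformation_norm[OF T, of x] linear_scale[OF orthogonal_transformation_linear[OF T]]
    by (simp add: sgn_div_norm)
  have "(\<integral>\<^sup>+x. f (T (sgn x)) * indicator (ball 0 1) x \<partial>lborel)
    = (\<integral>\<^sup>+x. f (sgn (T x)) * indicator (ball 0 1) (T x) \<partial>lborel)"
    using orthogonal_transformation_norm[OF T] by (intro nn_integral_cong) (simp add: sgn indicator_def)
  also have "\<dots> = (\<integral>\<^sup>+x. f (sgn x) * indicator (ball 0 1) x \<partial>lborel)"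
    by (rule nn_integral_lborel_orthogonal[OF T]) measurable
  finally show ?thesis by (subst (1 2) nn_integral_sphere_measure) simp_all
qed

subsection \<open>Rotation invariance of the spherical harmonics\<close>

abbreviation monomial :: "('n::finite \<Rightarrow> nat) \<Rightarrow> real^'n \<Rightarrow> 'k::real_normed_field" where
  "monomial \<alpha> x \<equiv> \<Prod>i\<in>UNIV. of_real (x $ i) ^ \<alpha> i"

lemma finite_multi_indices: "finite {\<alpha> :: 'n::finite \<Rightarrow> nat. (\<Sum>i\<in>UNIV. \<alpha> i) = k}"
proof (rule finite_subset)
  show "{\<alpha> :: 'n \<Rightarrow> nat. (\<Sum>i\<in>UNIV. \<alpha> i) = k} \<subseteq> PiE UNIV (\<lambda>_. {..k})"
    by (auto simp: PiE_UNIV_domain intro: member_le_sum)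
qed (simp add: finite_PiE)

lemma homogeneous_polynomialsI:
  "p = (\<lambda>x. \<Sum>\<alpha> | (\<Sum>i\<in>UNIV. \<alpha> i) = k. c \<alpha> * monomial \<alpha> x) \<Longrightarrow> p \<in> homogeneous_polynomials k"
  by (auto simp: homogeneous_polynomials_def)

lemma homogeneous_polynomials_0: "(\<lambda>x. 0) \<in> homogeneous_polynomials k"
  by (rule homogeneous_polynomialsI[where c = "\<lambda>_. 0"]) simp

lemma homogeneous_polynomials_add:
  assumes "p \<in> homogeneous_polynomials k" "q \<in> homogeneous_polynomials k"
  shows "(\<lambda>x. p x + q x) \<in> homogeneous_polynomials k"
proof -
  from assms obtain c c' where
    "p = (\<lambda>x. \<Sum>\<alpha> | (\<Sum>i\<in>UNIV. \<alpha> i) = k. c \<alpha> * monomial \<alpha> x)"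
    "q = (\<lambda>x. \<Sum>\<alpha> | (\<Sum>i\<in>UNIV. \<alpha> i) = k. c' \<alpha> * monomial \<alpha> x)"
    by (auto simp: homogeneous_polynomials_def)
  thus ?thesis
    by (intro homogeneous_polynomialsI[where c = "\<lambda>\<alpha>. c \<alpha> + c' \<alpha>"]) (simp add: algebra_simps sum.distrib)
qed

lemma homogeneous_polynomials_cmult:
  assumes "p \<in> homogeneous_polynomials k"
  shows "(\<lambda>x. b * p x) \<in> homogeneous_polynomials k"
proof -
  from assms obtain c where "p = (\<lambda>x. \<Sum>\<alpha> | (\<Sum>i\<in>UNIV. \<alpha> i) = k. c \<alpha> * monomial \<alpha> x)"
    by (auto simp: homogeneous_polynomials_def)
  thus ?thesis
    by (intro homogeneous_polynomialsI[where c = "\<lambda>\<alpha>. b * c \<alpha>"]) (simp add: algebra_simps sum_distrib_left)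
qed

lemma homogeneous_polynomials_sum:
  assumes "\<And>i. i \<in> I \<Longrightarrow> p i \<in> homogeneous_polynomials k"
  shows "(\<lambda>x. \<Sum>i\<in>I. p i x) \<in> homogeneous_polynomials k"
  using assms
  by (induction I rule: infinite_finite_induct) (auto intro: homogeneous_polynomials_0 homogeneous_polynomials_add)

lemma monomial_homogeneous:
  fixes \<beta> :: "'n::finite \<Rightarrow> nat"
  assumes "(\<Sum>i\<in>UNIV. \<beta> i) = k"
  shows "monomial \<beta> \<in> homogeneous_polynomials k"
proof (rule homogeneous_polynomialsI[where c = "\<lambda>\<alpha>. if \<alpha> = \<beta> then 1 else 0"], rule ext)
  fix x :: "real^'n"
  have "(\<Sum>\<alpha> | (\<Sum>i\<in>UNIV. \<alpha> i) = k. (if \<alpha> = \<beta> then 1 else 0) * (monomial \<alpha> x :: 'a))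
    = (\<Sum>\<alpha> | (\<Sum>i\<in>UNIV. \<alpha> i) = k. if \<alpha> = \<beta> then monomial \<beta> x else 0)"
    by (intro sum.cong) auto
  also have "\<dots> = monomial \<beta> x" using assms finite_multi_indices by (subst sum.delta) auto
  finally show "monomial \<beta> x = (\<Sum>\<alpha> | (\<Sum>i\<in>UNIV. \<alpha> i) = k. (if \<alpha> = \<beta> then 1 else 0) * (monomial \<alpha> x :: 'a))"
    by simp
qed

text \<open>Reindexing of coefficients is avoided: every monomial with one exponent raised lies in
  the next space, which is closed under linear combinations.\<close>

lemma homogeneous_polynomials_coord_mult:
  fixes p :: "real^'n \<Rightarrow> 'k::real_normed_field"
  assumes "p \<in> homogeneous_polynomials k"
  shows "(\<lambda>x. of_real (x $ i) * p x) \<in> homogeneous_polynomials (Suc k)"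
proof -
  from assms obtain c where p: "p = (\<lambda>x. \<Sum>\<alpha> | (\<Sum>i\<in>UNIV. \<alpha> i) = k. c \<alpha> * monomial \<alpha> x)"
    by (auto simp: homogeneous_polynomials_def)
  have m: "of_real (x $ i) * monomial \<alpha> x = (monomial (\<alpha>(i := Suc (\<alpha> i))) x :: 'k)" for \<alpha> and x :: "real^'n"
    by (simp add: prod.remove[of UNIV i] mult.assoc)
  have "(\<lambda>x. of_real (x $ i) * p x)
    = (\<lambda>x. \<Sum>\<alpha> | (\<Sum>i\<in>UNIV. \<alpha> i) = k. c \<alpha> * monomial (\<alpha>(i := Suc (\<alpha> i))) x)"
    unfolding p sum_distrib_left m[symmetric] by (simp only: mult.left_commute)
  also have "\<dots> \<in> homogeneous_polynomials (Suc k)"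
  proof (intro homogeneous_polynomials_sum homogeneous_polynomials_cmult monomial_homogeneous)
    fix \<alpha> :: "'n \<Rightarrow> nat" assume "\<alpha> \<in> {\<alpha>. (\<Sum>i\<in>UNIV. \<alpha> i) = k}"
    thus "(\<Sum>j\<in>UNIV. (\<alpha>(i := Suc (\<alpha> i))) j) = Suc k"
      by (simp add: sum.remove[of UNIV i])
  qed
  finally show ?thesis .
qed

lemma linear_component_sum:
  fixes T :: "real^'n \<Rightarrow> real^'n"
  assumes "linear T"
  shows "T x $ i = (\<Sum>j\<in>UNIV. x $ j * T (axis j 1) $ i)"
proof -
  have "T x = T (\<Sum>j\<in>UNIV. x $ j *\<^sub>R axis j 1)" using basis_expansion[of x] by (simp add: scalar_mult_eq_scaleR)
  also have "\<dots> = (\<Sum>j\<in>UNIV. x $ j *\<^sub>R T (axis j 1))"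
    by (simp add: linear_sum[OF assms] linear_scale[OF assms])
  finally show ?thesis by (simp add: sum_component)
qed

text \<open>Induction on the degree splits off one coordinate factor, which \<open>T\<close> turns
  into a linear form; its terms multiply a polynomial of the previous degree by coordinates.\<close>

lemma monomial_compose_linear:
  fixes T :: "real^'n \<Rightarrow> real^'n"
  assumes T: "linear T" and "(\<Sum>i\<in>UNIV. \<alpha> i) = k"
  shows "(\<lambda>x. monomial \<alpha> (T x) :: 'k::real_normed_field) \<in> homogeneous_polynomials k"
  using assms(2)
proof (induction k arbitrary: \<alpha>)
  case 0
  hence "\<alpha> = (\<lambda>_. 0)" by (auto simp: sum_eq_0_iff)
  thus ?case using monomial_homogeneous[of "\<lambda>_::'n. 0" 0, where 'a='k] by simp
next
  case (Suc k)
  then obtain i where i: "\<alpha> i \<noteq> 0" by (metis Zero_neq_Suc sum.neutral)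
  define \<beta> where "\<beta> = \<alpha>(i := \<alpha> i - 1)"
  have "\<alpha> = \<beta>(i := Suc (\<beta> i))" using i by (auto simp: \<beta>_def)
  hence m: "monomial \<alpha> (T x) = of_real (T x $ i) * (monomial \<beta> (T x) :: 'k)" for x
    by (simp add: prod.remove[of UNIV i] mult.assoc)
  have "(\<Sum>i\<in>UNIV. \<beta> i) = k"
    using Suc.prems i by (simp add: \<beta>_def sum.remove[of UNIV i])
  hence IH: "(\<lambda>x. monomial \<beta> (T x) :: 'k) \<in> homogeneous_polynomials k" by (rule Suc.IH)
  have "(\<lambda>x. monomial \<alpha> (T x) :: 'k)
    = (\<lambda>x. \<Sum>j\<in>UNIV. of_real (T (axis j 1) $ i) * (of_real (x $ j) * monomial \<beta> (T x)))"
  proof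
    fix x
    show "monomial \<alpha> (T x) = (\<Sum>j\<in>UNIV. of_real (T (axis j 1) $ i) * (of_real (x $ j) * (monomial \<beta> (T x) :: 'k)))"
      unfolding m by (subst linear_component_sum[OF T, of x i]) (simp add: sum_distrib_right mult.assoc mult.left_commute)
  qed
  also have "\<dots> \<in> homogeneous_polynomials (Suc k)"
    by (intro homogeneous_polynomials_sum homogeneous_polynomials_cmult homogeneous_polynomials_coord_mult IH)
  finally show ?case .
qed

lemma homogeneous_polynomials_compose_linear:
  fixes T :: "real^'n \<Rightarrow> real^'n"
  assumes T: "linear T" and p: "p \<in> homogeneous_polynomials k"
  shows "(\<lambda>x. p (T x)) \<in> homogeneous_polynomials k"
proof -
  from p obtain c where "p = (\<lambda>x. \<Sum>\<alpha> | (\<Sum>i\<in>UNIV. \<alpha> i) = k. c \<alpha> * monomial \<alpha> x)"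
    by (auto simp: homogeneous_polynomials_def)
  thus ?thesis
    by (auto intro!: homogeneous_polynomials_sum homogeneous_polynomials_cmult monomial_compose_linear[OF T])
qed

text \<open>A description of polynomials suited to differentiation: induction shows that the partial
  derivatives are again of this kind, so they can be differentiated once more, as the Laplacian
  requires.\<close>

inductive poly_fun :: "(real^'n \<Rightarrow> 'k::real_normed_field) \<Rightarrow> bool" where
  poly_fun_const: "poly_fun (\<lambda>x. c)"
| poly_fun_coord: "poly_fun (\<lambda>x. of_real (x $ i))"
| poly_fun_add: "poly_fun f \<Longrightarrow> poly_fun g \<Longrightarrow> poly_fun (\<lambda>x. f x + g x)"
| poly_fun_mult: "poly_fun f \<Longrightarrow> poly_fun g \<Longrightarrow> poly_fun (\<lambda>x. f x * g x)"

lemma poly_fun_sum: "(\<And>i. i \<in> I \<Longrightarrow> poly_fun (f i)) \<Longrightarrow> poly_fun (\<lambda>x. \<Sum>i\<in>I. f i x)"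
  by (induction I rule: infinite_finite_induct) (auto intro: poly_fun.intros)

lemma poly_fun_prod: "(\<And>i. i \<in> I \<Longrightarrow> poly_fun (f i)) \<Longrightarrow> poly_fun (\<lambda>x. \<Prod>i\<in>I. f i x)"
  by (induction I rule: infinite_finite_induct) (auto intro: poly_fun.intros)

lemma poly_fun_power: "poly_fun f \<Longrightarrow> poly_fun (\<lambda>x. f x ^ n)"
  by (induction n) (auto intro: poly_fun.intros)

lemma homogeneous_poly_fun: "p \<in> homogeneous_polynomials k \<Longrightarrow> poly_fun p"
  by (auto simp: homogeneous_polynomials_def intro!: poly_fun_sum poly_fun_prod poly_fun_power poly_fun_mult poly_fun_const poly_fun_coord)

lemma poly_fun_has_derivative:
  "poly_fun (p :: real^'n \<Rightarrow> 'k::real_normed_field) \<Longrightarrow>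
    \<exists>D. (\<forall>i. poly_fun (D i)) \<and> (\<forall>x. (p has_derivative (\<lambda>h. \<Sum>i\<in>UNIV. h $ i *\<^sub>R D i x)) (at x))"
proof (induction rule: poly_fun.induct)
  case (poly_fun_const c)
  show ?case by (intro exI[of _ "\<lambda>_ _. 0"]) (auto intro: poly_fun.intros)
next
  case (poly_fun_coord i)
  have "((\<lambda>x :: real^'n. of_real (x $ i) :: 'k) has_derivative (\<lambda>h. \<Sum>j\<in>UNIV. h $ j *\<^sub>R (if j = i then 1 else 0))) (at x)" for x
  proof -
    have "((\<lambda>x :: real^'n. of_real (x $ i) :: 'k) has_derivative (\<lambda>h. of_real (h $ i))) (at x)"
      by (intro bounded_linear_imp_has_derivative bounded_linear_compose[OF bounded_linear_of_real] bounded_linear_vec_nth)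
    moreover have "(\<Sum>j\<in>UNIV. h $ j *\<^sub>R (if j = i then 1 else 0)) = (of_real (h $ i) :: 'k)" for h :: "real^'n"
    proof -
      have "(\<Sum>j\<in>UNIV. h $ j *\<^sub>R (if j = i then 1 else 0)) = (\<Sum>j\<in>UNIV. if j = i then (of_real (h $ i) :: 'k) else 0)"
        by (intro sum.cong) (auto simp: of_real_def)
      thus ?thesis by simp
    qed
    ultimately show ?thesis by simp
  qed
  thus ?case by (intro exI[of _ "\<lambda>j _. if j = i then 1 else 0"]) (auto intro: poly_fun.intros)
next
  case (poly_fun_add f g)
  then obtain D E where "\<forall>i. poly_fun (D i)" "\<forall>i. poly_fun (E i)"
    and D: "\<And>x. (f has_derivative (\<lambda>h. \<Sum>i\<in>UNIV. h $ i *\<^sub>R D i x)) (at x)"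
    and E: "\<And>x. (g has_derivative (\<lambda>h. \<Sum>i\<in>UNIV. h $ i *\<^sub>R E i x)) (at x)" by blast
  moreover have "((\<lambda>x. f x + g x) has_derivative (\<lambda>h. \<Sum>i\<in>UNIV. h $ i *\<^sub>R (D i x + E i x))) (at x)" for x
    using has_derivative_add[OF D E] by (simp add: scaleR_add_right sum.distrib)
  ultimately show ?case
    by (intro exI[of _ "\<lambda>i x. D i x + E i x"]) (auto intro: poly_fun.intros)
next
  case (poly_fun_mult f g)
  then obtain D E where "\<forall>i. poly_fun (D i)" "\<forall>i. poly_fun (E i)"
    and D: "\<And>x. (f has_derivative (\<lambda>h. \<Sum>i\<in>UNIV. h $ i *\<^sub>R D i x)) (at x)"
    and E: "\<And>x. (g has_derivative (\<lambda>h. \<Sum>i\<in>UNIV. h $ i *\<^sub>R E i x)) (at x)" by blast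
  moreover have "((\<lambda>x. f x * g x) has_derivative (\<lambda>h. \<Sum>i\<in>UNIV. h $ i *\<^sub>R (f x * E i x + D i x * g x))) (at x)" for x
    using has_derivative_mult[OF D E]
    by (simp add: scaleR_add_right sum.distrib sum_distrib_left sum_distrib_right)
  moreover have "poly_fun (\<lambda>x. f x * E i x + D i x * g x)" for i
    using calculation(1,2) poly_fun_mult.hyps by (intro poly_fun.poly_fun_add poly_fun.poly_fun_mult) auto
  ultimately show ?case by (intro exI[of _ "\<lambda>i x. f x * E i x + D i x * g x"]) auto
qed

lemma partial_deriv_eq:
  fixes f :: "real^'n \<Rightarrow> 'k::real_normed_vector"
  assumes "(f has_derivative F) (at x)"
  shows "partial_deriv i f x = F (axis i 1)"
proof -
  have line: "((\<lambda>t. x + t *\<^sub>R axis i 1) has_derivative (\<lambda>t. t *\<^sub>R axis i 1)) (at (0::real))"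
    by (auto intro!: derivative_eq_intros)
  have "(f has_derivative F) (at ((\<lambda>t. x + t *\<^sub>R axis i 1) (0::real)))" using assms by simp
  from diff_chain_at[OF line this]
  have "((\<lambda>t. f (x + t *\<^sub>R axis i 1)) has_derivative (\<lambda>t. t *\<^sub>R F (axis i 1))) (at (0::real))"
    using linear_scale[OF has_derivative_linear[OF assms]] by (simp add: o_def)
  thus ?thesis unfolding partial_deriv_def
    by (intro vector_derivative_at) (simp add: has_vector_derivative_def)
qed

text \<open>The transpose of \<open>T\<close> is its inverse \<open>W\<close>, so the rows of the
  matrix of \<open>T\<close> are the vectors \<open>W (axis i 1)\<close>, and \<open>W\<close>
  preserves inner products.\<close>

lemma orthogonal_transformation_rows:
  fixes T :: "real^'n \<Rightarrow> real^'n"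
  assumes T: "orthogonal_transformation T"
  shows "(\<Sum>j\<in>UNIV. T (axis j 1) $ i * T (axis j 1) $ l) = (if i = l then 1 else 0)"
proof -
  define W where "W = inv T"
  have TW: "T (W x) = x" for x
    unfolding W_def using orthogonal_transformation_surj[OF T] by (simp add: surj_f_inv_f)
  have inner: "T a \<bullet> T b = a \<bullet> b" for a b using T by (simp add: orthogonal_transformation_def)
  have comp: "T (axis j 1) $ i = W (axis i 1) $ j" for i j
  proof -
    have "T (axis j 1) $ i = T (axis j 1) \<bullet> T (W (axis i 1))" by (simp add: TW inner_axis)
    also have "\<dots> = W (axis i 1) $ j" by (simp add: inner inner_axis')
    finally show ?thesis .
  qed
  have "(\<Sum>j\<in>UNIV. T (axis j 1) $ i * T (axis j 1) $ l) = W (axis i 1) \<bullet> W (axis l 1)"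
    by (simp add: comp inner_vec_def)
  also have "\<dots> = axis i 1 \<bullet> (axis l 1 :: real^'n)" using inner[of "W (axis i 1)" "W (axis l 1)"] by (simp add: TW)
  finally show ?thesis by (simp add: inner_axis_axis)
qed

text \<open>The chain rule applied twice yields the second derivatives \<open>E i l\<close> weighted
  by the inner products of the rows \<open>i\<close> and \<open>l\<close> of \<open>T\<close>;
  orthonormality of the rows leaves the diagonal.\<close>

lemma laplacian_orthogonal:
  fixes p :: "real^'n \<Rightarrow> 'k::real_normed_field" and T :: "real^'n \<Rightarrow> real^'n"
  assumes p: "poly_fun p" and T: "orthogonal_transformation T"
  shows "laplacian (\<lambda>x. p (T x)) x = laplacian p (T x)"
proof -
  have lin: "(T has_derivative T) (at x)" for x
    using orthogonal_transformation_linear[OF T]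
    by (intro bounded_linear_imp_has_derivative) (simp add: linear_conv_bounded_linear)
  obtain D where D: "\<And>i. poly_fun (D i)" "\<And>x. (p has_derivative (\<lambda>h. \<Sum>i\<in>UNIV. h $ i *\<^sub>R D i x)) (at x)"
    using poly_fun_has_derivative[OF p] by blast
  have "\<exists>E. \<forall>x. (D i has_derivative (\<lambda>h. \<Sum>l\<in>UNIV. h $ l *\<^sub>R E l x)) (at x)" for i
    using poly_fun_has_derivative[OF D(1)] by blast
  then obtain E where E: "\<And>i x. (D i has_derivative (\<lambda>h. \<Sum>l\<in>UNIV. h $ l *\<^sub>R E i l x)) (at x)" by metis
  have axis: "(\<Sum>l\<in>UNIV. axis i (1::real) $ l *\<^sub>R G l) = G i" for G :: "'n \<Rightarrow> 'k" and i
  proof -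
    have "(\<Sum>l\<in>UNIV. axis i (1::real) $ l *\<^sub>R G l) = (\<Sum>l\<in>UNIV. if l = i then G l else 0)"
      by (intro sum.cong) (auto simp: axis_def)
    thus ?thesis by simp
  qed
  let ?t = "\<lambda>i j. T (axis j 1) $ i"
  have p1: "partial_deriv i p = D i" for i by (rule ext) (simp add: partial_deriv_eq[OF D(2)] axis)
  have p2: "partial_deriv l (D i) x = E i l x" for i l x by (simp add: partial_deriv_eq[OF E] axis)
  have q: "partial_deriv j (\<lambda>x. p (T x)) = (\<lambda>x. \<Sum>i\<in>UNIV. ?t i j *\<^sub>R D i (T x))" for j
    using partial_deriv_eq[OF diff_chain_at[OF lin D(2)]] by (auto simp: o_def)
  have hd: "((\<lambda>x. \<Sum>i\<in>UNIV. ?t i j *\<^sub>R D i (T x)) has_derivative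
      (\<lambda>h. \<Sum>i\<in>UNIV. ?t i j *\<^sub>R (\<Sum>l\<in>UNIV. T h $ l *\<^sub>R E i l (T x)))) (at x)" for j
    using diff_chain_at[OF lin E] by (intro has_derivative_sum has_derivative_scaleR_right) (simp add: o_def)
  have q2: "partial_deriv j (partial_deriv j (\<lambda>x. p (T x))) x
    = (\<Sum>i\<in>UNIV. \<Sum>l\<in>UNIV. (?t i j * ?t l j) *\<^sub>R E i l (T x))" for j
    unfolding q partial_deriv_eq[OF hd] by (simp add: scaleR_sum_right)
  have "laplacian (\<lambda>x. p (T x)) x = (\<Sum>j\<in>UNIV. \<Sum>i\<in>UNIV. \<Sum>l\<in>UNIV. (?t i j * ?t l j) *\<^sub>R E i l (T x))"
    by (simp add: laplacian_def q2)
  also have "\<dots> = (\<Sum>i\<in>UNIV. \<Sum>j\<in>UNIV. \<Sum>l\<in>UNIV. (?t i j * ?t l j) *\<^sub>R E i l (T x))" by (rule sum.swap)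
  also have "\<dots> = (\<Sum>i\<in>UNIV. \<Sum>l\<in>UNIV. \<Sum>j\<in>UNIV. (?t i j * ?t l j) *\<^sub>R E i l (T x))"
    by (rule sum.cong[OF refl], rule sum.swap)
  also have "\<dots> = (\<Sum>i\<in>UNIV. \<Sum>l\<in>UNIV. if l = i then E i l (T x) else 0)"
    unfolding scaleR_sum_left[symmetric] orthogonal_transformation_rows[OF T]
    by (intro sum.cong refl) auto
  also have "\<dots> = laplacian p (T x)" by (simp add: laplacian_def p1 p2)
  finally show ?thesis .
qed

lemma spherical_harmonics_orthogonal:
  fixes f :: "real^'n \<Rightarrow> 'k::real_normed_field" and T :: "real^'n \<Rightarrow> real^'n"
  assumes f: "f \<in> spherical_harmonics k" and T: "orthogonal_transformation T"
  shows "(\<lambda>x. f (T x)) \<in> spherical_harmonics k"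
proof -
  from f obtain p where p: "f = (\<lambda>x. if x \<in> sphere 0 1 then p x else 0)" "p \<in> homogeneous_polynomials k" "\<forall>x. laplacian p x = 0"
    by (auto simp: spherical_harmonics_def)
  have "(\<lambda>x. f (T x)) = (\<lambda>x. if x \<in> sphere 0 1 then p (T x) else 0)"
    by (simp add: p(1) orthogonal_transformation_norm[OF T])
  moreover have "(\<lambda>x. p (T x)) \<in> homogeneous_polynomials k"
    by (rule homogeneous_polynomials_compose_linear[OF orthogonal_transformation_linear[OF T] p(2)])
  moreover have "\<forall>x. laplacian (\<lambda>x. p (T x)) x = 0"
    using p(3) by (simp add: laplacian_orthogonal[OF homogeneous_poly_fun[OF p(2)] T])
  ultimately show ?thesis
    unfolding spherical_harmonics_def mem_Collect_eq by (intro exI[of _ "\<lambda>x. p (T x)"] conjI)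
qed

lemma spherical_harmonics_bounded:
  fixes f :: "real^'n \<Rightarrow> 'k::{real_normed_field, euclidean_space}"
  assumes f: "f \<in> spherical_harmonics k"
  shows "f \<in> borel_measurable borel" "\<exists>B. \<forall>x. norm (f x) \<le> B" "x \<notin> sphere 0 1 \<Longrightarrow> f x = 0"
proof -
  from f obtain p where p: "f = (\<lambda>x. if x \<in> sphere 0 1 then p x else 0)" "p \<in> homogeneous_polynomials k"
    by (auto simp: spherical_harmonics_def)
  have "\<exists>F. (p has_derivative F) (at x)" for x
    using poly_fun_has_derivative[OF homogeneous_poly_fun[OF p(2)]] by blast
  hence cont: "continuous_on A p" for A
    by (meson continuous_at_imp_continuous_on has_derivative_continuous)
  have "p \<in> borel_measurable borel" by (rule borel_measurable_continuous_onI[OF cont])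
  thus "f \<in> borel_measurable borel" unfolding p(1) by (intro measurable_If_set) auto
  have "bounded (p ` sphere 0 1)" by (intro compact_imp_bounded compact_continuous_image cont compact_sphere)
  then obtain B where B: "\<And>x. x \<in> sphere 0 1 \<Longrightarrow> norm (p x) \<le> B" unfolding bounded_iff by blast
  have "norm (f x) \<le> max B 0" for x using B[of x] by (auto simp: p(1))
  thus "\<exists>B. \<forall>x. norm (f x) \<le> B" by blast
  show "x \<notin> sphere 0 1 \<Longrightarrow> f x = 0" by (simp add: p(1))
qed

subsection \<open>Norms of spherical harmonics\<close>

text \<open>Convexity of the power at \<open>(f + g) / (a + b)\<close>, the combination of
  \<open>f / a\<close> and \<open>g / b\<close> with weights \<open>a / (a + b)\<close> and
  \<open>b / (a + b)\<close>. The weights are free so that Minkowski's inequality can take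
  \<open>a\<close> and \<open>b\<close> close to the two norms. The cases \<open>f = 0\<close> and
  \<open>g = 0\<close> are elementary.\<close>

lemma powr_add_weighted:
  fixes f g a b p :: real
  assumes "f \<ge> 0" "g \<ge> 0" "a > 0" "b > 0" "p \<ge> 1"
  shows "(f + g) powr p \<le> (a + b) powr (p - 1) * (a powr (1 - p) * f powr p + b powr (1 - p) * g powr p)"
proof -
  have single: "g powr p \<le> (a + b) powr (p - 1) * (b powr (1 - p) * g powr p)"
    if "a > 0" "b > 0" for a b g :: real
  proof -
    have "1 \<le> ((a + b) / b) powr (p - 1)" using that assms by (intro ge_one_powr_ge_zero) auto
    also have "\<dots> = (a + b) powr (p - 1) * b powr (1 - p)"
      using that powr_minus_divide[of b "p - 1"] by (simp add: powr_divide)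
    finally have "1 * g powr p \<le> ((a + b) powr (p - 1) * b powr (1 - p)) * g powr p" by (intro mult_right_mono) auto
    thus ?thesis by (simp add: mult.assoc)
  qed
  consider "f = 0" | "g = 0" | "f > 0" "g > 0" using assms by linarith
  thus ?thesis
  proof cases
    case 1
    thus ?thesis using single[of a b g] assms by simp
  next
    case 2
    thus ?thesis using single[of b a f] assms by (simp add: add.commute)
  next
    case 3
    let ?t = "b / (a + b)"
    have t: "1 - ?t = a / (a + b)" using assms by (simp add: field_simps)
    have "((1 - ?t) *\<^sub>R (f / a) + ?t *\<^sub>R (g / b)) powr p \<le> (1 - ?t) * (f / a) powr p + ?t * (g / b) powr p"
      using 3 assms by (intro convex_onD[OF powr_convex]) auto
    moreover have "(1 - ?t) *\<^sub>R (f / a) + ?t *\<^sub>R (g / b) = (f + g) / (a + b)"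
      unfolding t using assms by (simp add: add_divide_distrib)
    ultimately have "((f + g) / (a + b)) powr p \<le> a / (a + b) * (f / a) powr p + b / (a + b) * (g / b) powr p"
      unfolding t by simp
    hence m1: "(a + b) powr p * ((f + g) / (a + b)) powr p
      \<le> (a + b) powr p * (a / (a + b) * (f / a) powr p + b / (a + b) * (g / b) powr p)"
      by (intro mult_left_mono) auto
    have m2: "(a + b) powr p * ((f + g) / (a + b)) powr p = (f + g) powr p"
      using assms by (simp add: powr_divide)
    have m3: "(a + b) powr p * (a / (a + b) * u + b / (a + b) * v) = (a + b) powr (p - 1) * (a * u + b * v)" for u v
    proof -
      have "(a + b) powr p = (a + b) powr (p - 1) * (a + b)"
        using assms powr_add[of "a + b" "p - 1" 1] by simp
      moreover have "(a + b) * (a / (a + b) * u + b / (a + b) * v) = a * u + b * v"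
        using assms by (simp add: distrib_left[of "a + b"])
      ultimately show ?thesis by (simp only: mult.assoc)
    qed
    have m4: "c * (x / c) powr p = c powr (1 - p) * x powr p" if "c > 0" "x > 0" for c x :: real
      using that by (simp add: powr_divide powr_diff)
    show ?thesis using m1 unfolding m2 m3 by (simp only: m4 3 assms)
  qed
qed

text \<open>Integrating \<open>powr_add_weighted\<close> with \<open>a\<close> and \<open>b\<close>
  equal to the two norms bounds the integral by \<open>(a + b) powr p\<close>. Half of
  \<open>\<epsilon>\<close> is added to each norm because the weights must be positive.\<close>

lemma minkowski_integral:
  fixes f g :: "'a \<Rightarrow> real"
  assumes nn: "\<And>x. f x \<ge> 0" "\<And>x. g x \<ge> 0" and p: "p \<ge> 1"
    and int: "integrable M (\<lambda>x. f x powr p)" "integrable M (\<lambda>x. g x powr p)"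
  shows "(LINT x|M. (f x + g x) powr p) powr (1 / p)
    \<le> (LINT x|M. f x powr p) powr (1 / p) + (LINT x|M. g x powr p) powr (1 / p)"
proof (rule field_le_epsilon)
  fix \<epsilon> :: real assume \<epsilon>: "\<epsilon> > 0"
  define I where "I = (LINT x|M. f x powr p)"
  define J where "J = (LINT x|M. g x powr p)"
  define a where "a = I powr (1 / p) + \<epsilon> / 2"
  define b where "b = J powr (1 / p) + \<epsilon> / 2"
  have ab: "a > 0" "b > 0" using \<epsilon> by (auto simp: a_def b_def intro: add_nonneg_pos)
  have I: "I \<ge> 0" "J \<ge> 0" by (auto simp: I_def J_def)
  have ap: "I \<le> a powr p" "J \<le> b powr p"
  proof -
    have "I = (I powr (1 / p)) powr p" "J = (J powr (1 / p)) powr p" using I p by (auto simp: powr_powr)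
    moreover have "(I powr (1 / p)) powr p \<le> a powr p" "(J powr (1 / p)) powr p \<le> b powr p"
      using p \<epsilon> by (auto intro!: powr_mono2 simp: a_def b_def)
    ultimately show "I \<le> a powr p" "J \<le> b powr p" by simp_all
  qed
  let ?c = "(a + b) powr (p - 1)"
  have "(LINT x|M. (f x + g x) powr p) \<le> (LINT x|M. ?c * (a powr (1 - p) * f x powr p + b powr (1 - p) * g x powr p))"
    using int by (intro integral_mono') (auto intro!: powr_add_weighted nn ab p)
  also have "\<dots> = ?c * (a powr (1 - p) * I + b powr (1 - p) * J)"
    using int by (simp add: I_def J_def)
  also have "\<dots> \<le> ?c * (a powr (1 - p) * a powr p + b powr (1 - p) * b powr p)"
    using ap by (intro mult_left_mono add_mono) auto
  also have "\<dots> = (a + b) powr p"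
    using ab powr_add[of "a + b" "p - 1" 1] by (simp flip: powr_add)
  finally have "(LINT x|M. (f x + g x) powr p) powr (1 / p) \<le> ((a + b) powr p) powr (1 / p)"
    using p by (intro powr_mono2) auto
  also have "\<dots> = a + b" using ab p by (simp add: powr_powr)
  also have "\<dots> = I powr (1 / p) + J powr (1 / p) + \<epsilon>" by (simp add: a_def b_def)
  finally show "(LINT x|M. (f x + g x) powr p) powr (1 / p)
    \<le> (LINT x|M. f x powr p) powr (1 / p) + (LINT x|M. g x powr p) powr (1 / p) + \<epsilon>"
    by (simp add: I_def J_def)
qed

lemma integrable_sphere_bounded:
  fixes f :: "real^'n \<Rightarrow> 'b::{banach,second_countable_topology}"
  assumes "f \<in> borel_measurable borel" "\<And>x. norm (f x) \<le> B"
  shows "integrable sphere_measure f"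
  using assms by (intro sphere_measure.integrable_const_bound[of _ B]) auto

context
  fixes k N :: nat and e :: "nat \<Rightarrow> real^'n \<Rightarrow> 'k::rc_field"
  assumes e: "orthonormal_basis_harm k N e"
begin

lemma basis_mem: "m < N \<Longrightarrow> e m \<in> spherical_harmonics k"
  using e by (simp add: orthonormal_basis_harm_def)

lemma basis_measurable [measurable]: "m < N \<Longrightarrow> e m \<in> borel_measurable borel"
  using spherical_harmonics_bounded(1)[OF basis_mem] .

lemma basis_bounded: obtains B where "\<And>m x. m < N \<Longrightarrow> norm (e m x) \<le> B" "B \<ge> 0"
proof -
  have "\<forall>m. \<exists>B. m < N \<longrightarrow> (\<forall>x. norm (e m x) \<le> B)" using spherical_harmonics_bounded(2)[OF basis_mem] by blast
  then obtain B where B: "\<And>m x. m < N \<Longrightarrow> norm (e m x) \<le> B m" by metis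
  have "norm (e m x) \<le> (\<Sum>m<N. \<bar>B m\<bar>)" if "m < N" for m x
    using B[OF that, of x] member_le_sum[of m "{..<N}" "\<lambda>m. \<bar>B m\<bar>"] that by auto
  thus ?thesis using that[of "\<Sum>m<N. \<bar>B m\<bar>"] by (simp add: sum_nonneg)
qed

lemma lin_comb_measurable [measurable]: "lin_comb N e a \<in> borel_measurable borel"
  unfolding lin_comb_def by measurable

lemma lin_comb_bounded: "\<exists>B. \<forall>x. norm (lin_comb N e a x) \<le> B"
proof -
  obtain B where B: "\<And>m x. m < N \<Longrightarrow> norm (e m x) \<le> B" "B \<ge> 0" by (rule basis_bounded) blast
  have "norm (lin_comb N e a x) \<le> (\<Sum>m<N. norm (a m) * B)" for x
    unfolding lin_comb_def using B
    by (intro order_trans[OF norm_sum] sum_mono) (simp add: norm_mult mult_left_mono)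
  thus ?thesis by blast
qed

lemma integrable_norm_lin_comb_power2: "integrable sphere_measure (\<lambda>x. (norm (lin_comb N e a x))\<^sup>2)"
proof -
  obtain B where B: "\<And>x. norm (lin_comb N e a x) \<le> B" using lin_comb_bounded[of a] by blast
  show ?thesis
    by (rule integrable_sphere_bounded[of _ "B\<^sup>2"]) (use B in \<open>auto intro!: power_mono\<close>)
qed

lemma integral_norm_lin_comb: "(LINT x|sphere_measure. (norm (lin_comb N e a x))\<^sup>2) = (vec_norm N a)\<^sup>2"
proof -
  obtain B where B: "\<And>m x. m < N \<Longrightarrow> norm (e m x) \<le> B" "B \<ge> 0" by (rule basis_bounded) blast
  have int: "integrable sphere_measure (\<lambda>x. e m x * conjugate (e m' x))" if "m < N" "m' < N" for m m'
  proof (rule integrable_sphere_bounded)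
    show "(\<lambda>x. e m x * conjugate (e m' x)) \<in> borel_measurable borel" using that by measurable
    show "norm (e m x * conjugate (e m' x)) \<le> B * B" for x
      using B that by (auto simp: norm_mult intro!: mult_mono)
  qed
  have "(of_real (LINT x|sphere_measure. (norm (lin_comb N e a x))\<^sup>2) :: 'k)
    = (LINT x|sphere_measure. of_real ((norm (lin_comb N e a x))\<^sup>2))" by (rule integral_of_real[symmetric]) (rule integrable_norm_lin_comb_power2)
  also have "\<dots> = (LINT x|sphere_measure. (\<Sum>m<N. \<Sum>m'<N. (a m * conjugate (a m')) * (e m x * conjugate (e m' x))))"
    by (intro Bochner_Integration.integral_cong refl)
      (simp add: mult_conjugate[symmetric] lin_comb_def sum_conjugate sum_product conjugate_dist_mul mult_ac del: of_real_power)
  also have "\<dots> = (\<Sum>m<N. \<Sum>m'<N. (a m * conjugate (a m')) * L2_inner (e m) (e m'))"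
  proof -
    have i: "integrable sphere_measure (\<lambda>x. (a m * conjugate (a m')) * (e m x * conjugate (e m' x)))"
      if "m < N" "m' < N" for m m' by (intro integrable_mult_right int that)
    have "(LINT x|sphere_measure. (\<Sum>m<N. \<Sum>m'<N. (a m * conjugate (a m')) * (e m x * conjugate (e m' x))))
      = (\<Sum>m<N. LINT x|sphere_measure. (\<Sum>m'<N. (a m * conjugate (a m')) * (e m x * conjugate (e m' x))))"
      by (rule Bochner_Integration.integral_sum) (auto intro!: Bochner_Integration.integrable_sum i)
    also have "\<dots> = (\<Sum>m<N. \<Sum>m'<N. LINT x|sphere_measure. (a m * conjugate (a m')) * (e m x * conjugate (e m' x)))"
      by (intro sum.cong refl Bochner_Integration.integral_sum) (auto intro!: i)
    also have "\<dots> = (\<Sum>m<N. \<Sum>m'<N. (a m * conjugate (a m')) * L2_inner (e m) (e m'))"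
      by (simp add: L2_inner_def)
    finally show ?thesis .
  qed
  also have "\<dots> = (\<Sum>m<N. \<Sum>m'<N. if m' = m then a m * conjugate (a m) else 0)"
    using e by (intro sum.cong refl) (auto simp: orthonormal_basis_harm_def)
  also have "\<dots> = of_real ((vec_norm N a)\<^sup>2)" by (simp add: vec_norm_inner del: of_real_power)
  finally show ?thesis by (simp only: of_real_eq_iff)
qed

text \<open>The square root of the diagonal of the reproducing kernel of the spherical harmonics of
  degree \<open>k\<close>, that is, the norm of evaluation at \<open>x\<close>.\<close>

definition kernel_norm :: "real^'n \<Rightarrow> real" where
  "kernel_norm x = vec_norm N (\<lambda>m. e m x)"

lemma norm_lin_comb_le: "norm (lin_comb N e a x) \<le> vec_norm N a * kernel_norm x"
  unfolding lin_comb_def kernel_norm_def by (rule norm_sum_mult_le)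

text \<open>Rotations preserve the space of harmonics, so the rotated function has coordinates
  \<open>b\<close>; since they also preserve the surface measure, the \<open>L^2\<close> norm, and
  with it the coordinate norm, is unchanged.\<close>

lemma lin_comb_orthogonal:
  assumes T: "orthogonal_transformation T"
  obtains b where "\<And>x. lin_comb N e a (T x) = lin_comb N e b x" "vec_norm N b = vec_norm N a"
proof -
  have "\<exists>A. (\<lambda>x. e m (T x)) = lin_comb N e A" if "m < N" for m
    using e spherical_harmonics_orthogonal[OF basis_mem[OF that] T] by (auto simp: orthonormal_basis_harm_def)
  then obtain A where A: "\<And>m. m < N \<Longrightarrow> (\<lambda>x. e m (T x)) = lin_comb N e (A m)" by metis
  define b where "b = (\<lambda>j. \<Sum>m<N. a m * A m j)"
  have b: "lin_comb N e a (T x) = lin_comb N e b x" for x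
  proof -
    have "lin_comb N e a (T x) = (\<Sum>m<N. a m * lin_comb N e (A m) x)"
      unfolding lin_comb_def[of N e a] using A by (intro sum.cong refl) (metis lessThan_iff)
    also have "\<dots> = (\<Sum>m<N. \<Sum>j<N. a m * A m j * e j x)"
      by (simp add: lin_comb_def sum_distrib_left mult.assoc)
    also have "\<dots> = (\<Sum>j<N. \<Sum>m<N. a m * A m j * e j x)" by (rule sum.swap)
    also have "\<dots> = lin_comb N e b x" by (simp add: lin_comb_def b_def sum_distrib_right)
    finally show ?thesis .
  qed
  note [measurable] = measurable_orthogonal_transformation[OF T]
  have "(LINT x|sphere_measure. (norm (lin_comb N e a (T x)))\<^sup>2) = (LINT x|sphere_measure. (norm (lin_comb N e a x))\<^sup>2)"
    using nn_integral_sphere_orthogonal[OF T, of "\<lambda>x. ennreal ((norm (lin_comb N e a x))\<^sup>2)"]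
    by (simp add: integral_eq_nn_integral)
  hence "(vec_norm N b)\<^sup>2 = (vec_norm N a)\<^sup>2" by (simp add: b integral_norm_lin_comb)
  hence "vec_norm N b = vec_norm N a" by (simp add: power2_eq_iff_nonneg)
  thus ?thesis using b that by blast
qed

text \<open>
  With \<open>c\<^sub>m = conjugate (e\<^sub>m(T x))\<close>, the value of \<open>u = \<Sum>\<^sub>m c\<^sub>m e\<^sub>m\<close> at \<open>T x\<close> is \<open>kernel_norm (T x)^2 = \<bar>c\<bar>^2\<close>; since
  \<open>u \<circ> T\<close> has the same norm as \<open>u\<close>, Cauchy--Schwarz at \<open>x\<close> bounds it by \<open>\<bar>c\<bar> * kernel_norm x\<close>.
\<close>

lemma kernel_norm_le:
  assumes T: "orthogonal_transformation T"
  shows "kernel_norm (T x) \<le> kernel_norm x"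
proof -
  define c where "c = (\<lambda>m. conjugate (e m (T x)))"
  obtain b where b: "\<And>x. lin_comb N e c (T x) = lin_comb N e b x" "vec_norm N b = vec_norm N c"
    using lin_comb_orthogonal[OF T, of c] by blast
  have c: "vec_norm N c = kernel_norm (T x)" by (simp add: vec_norm_def kernel_norm_def c_def)
  have "lin_comb N e c (T x) = of_real ((kernel_norm (T x))\<^sup>2)"
    by (simp add: lin_comb_def c_def kernel_norm_def vec_norm_inner mult.commute del: of_real_power)
  hence "(kernel_norm (T x))\<^sup>2 = norm (lin_comb N e b x)" by (simp add: b(1)[symmetric] del: of_real_power)
  also have "\<dots> \<le> kernel_norm (T x) * kernel_norm x" using norm_lin_comb_le[of b x] by (simp add: b c)
  finally have "kernel_norm (T x) * kernel_norm (T x) \<le> kernel_norm (T x) * kernel_norm x" by (simp add: power2_eq_square)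
  moreover have "kernel_norm (T x) \<ge> 0" "kernel_norm x \<ge> 0" by (simp_all add: kernel_norm_def)
  ultimately show ?thesis by (cases "kernel_norm (T x) = 0") auto
qed

text \<open>Any two points of the sphere are exchanged by rotations, so
  \<open>kernel_norm_le\<close> in both directions makes the kernel constant. Its value comes from
  integration: each of the \<open>N\<close> basis functions contributes 1.\<close>

lemma kernel_norm_eq:
  assumes x: "x \<in> sphere 0 1"
  shows "(kernel_norm x)\<^sup>2 = real N / measure (sphere_measure :: (real^'n) measure) (sphere 0 1)"
proof -
  have le: "kernel_norm y \<le> kernel_norm x" if "x \<in> sphere 0 1" "y \<in> sphere 0 1" for x y
  proof -
    have "norm x = norm y" using that by simp
    then obtain T where "orthogonal_transformation T" "T x = y" by (rule orthogonal_transformation_exists)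
    thus ?thesis using kernel_norm_le by metis
  qed
  have const: "kernel_norm y = kernel_norm x" if "y \<in> sphere 0 1" for y
    using le[OF x that] le[OF that x] by simp
  have m: "(\<lambda>y. (norm (e m y))\<^sup>2) \<in> borel_measurable borel" if "m < N" for m
    using that by measurable
  have lc: "lin_comb N e (\<lambda>i. if i = m then 1 else 0) = e m" if "m < N" for m
  proof
    fix y
    have "(\<Sum>i<N. (if i = m then 1 else 0) * e i y) = (\<Sum>i<N. if i = m then e m y else 0)"
      by (intro sum.cong) auto
    thus "lin_comb N e (\<lambda>i. if i = m then 1 else 0) y = e m y" using that by (simp add: lin_comb_def)
  qed
  have int1: "(LINT y|sphere_measure. (norm (e m y))\<^sup>2) = 1" if "m < N" for m
  proof -
    have "(vec_norm N (\<lambda>i. if i = m then 1 else 0 :: 'k))\<^sup>2 = (\<Sum>i<N. if i = m then 1 else 0)"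
      unfolding vec_norm_power2 by (intro sum.cong) auto
    thus ?thesis using integral_norm_lin_comb[of "\<lambda>i. if i = m then 1 else 0"] that by (simp add: lc)
  qed
  obtain B where B: "\<And>m x. m < N \<Longrightarrow> norm (e m x) \<le> B" "B \<ge> 0" by (rule basis_bounded) blast
  have int: "integrable sphere_measure (\<lambda>y. (norm (e m y))\<^sup>2)" if "m < N" for m
    using B that by (intro integrable_sphere_bounded[of _ "B\<^sup>2"] m) (auto intro!: power_mono)
  have "(LINT y|sphere_measure. (kernel_norm y)\<^sup>2) = (\<Sum>m<N. LINT y|sphere_measure. (norm (e m y))\<^sup>2)"
    unfolding kernel_norm_def vec_norm_power2 using int by (intro Bochner_Integration.integral_sum) auto
  also have "\<dots> = real N" by (simp add: int1)
  finally have "real N = (LINT y|(sphere_measure :: (real^'n) measure). (kernel_norm y)\<^sup>2)" by simp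
  also have "\<dots> = (LINT y|(sphere_measure :: (real^'n) measure). (kernel_norm x)\<^sup>2 * indicator (sphere 0 1) y)"
  proof (rule integral_cong_AE)
    have [measurable]: "kernel_norm \<in> borel_measurable borel"
      unfolding kernel_norm_def[abs_def] vec_norm_def L2_set_def by measurable
    show "(\<lambda>y. (kernel_norm y)\<^sup>2) \<in> borel_measurable sphere_measure" by measurable
    show "(\<lambda>y. (kernel_norm x)\<^sup>2 * indicator (sphere 0 1) y) \<in> borel_measurable sphere_measure"
      by (intro borel_measurable_times borel_measurable_const borel_measurable_indicator) (simp add: borel_closed)
    show "AE y in sphere_measure. (kernel_norm y)\<^sup>2 = (kernel_norm x)\<^sup>2 * indicator (sphere 0 1) y"
      using AE_sphere_measure by eventually_elim (simp add: const)
  qed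
  also have "\<dots> = (kernel_norm x)\<^sup>2 * measure (sphere_measure :: (real^'n) measure) (sphere 0 1)" by simp
  finally show ?thesis using measure_sphere_pos[where 'n='n] by (simp add: field_simps)
qed

lemma integrable_lin_comb_powr: "q \<ge> 0 \<Longrightarrow> integrable sphere_measure (\<lambda>x. norm (lin_comb N e a x) powr q)"
proof -
  assume q: "q \<ge> 0"
  obtain B where B: "\<And>x. norm (lin_comb N e a x) \<le> B" using lin_comb_bounded[of a] by blast
  show ?thesis
    by (rule integrable_sphere_bounded[of _ "B powr q"]) (use B q in \<open>auto intro!: powr_mono2\<close>)
qed

text \<open>Interpolation between \<open>L^2\<close> and the supremum norm: \<open>|u|^q\<close> is
  at most \<open>|u|^2\<close> times the \<open>(q - 2)\<close>-th power of the supremum bound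
  \<open>vec_norm N a * \<kappa>\<close>, where \<open>\<kappa>\<close> is the constant value of
  \<open>kernel_norm\<close> on the sphere.\<close>

lemma Lq_norm_lin_comb_le:
  assumes q: "q \<ge> 2"
  shows "Lq_norm q (lin_comb N e a)
    \<le> (real N / measure (sphere_measure :: (real^'n) measure) (sphere 0 1)) powr (1 / 2 - 1 / q) * vec_norm N a"
proof -
  define V where "V = measure (sphere_measure :: (real^'n) measure) (sphere 0 1)"
  define \<kappa> where "\<kappa> = sqrt (real N / V)"
  have V: "V > 0" unfolding V_def by (rule measure_sphere_pos)
  hence \<kappa>0: "\<kappa> \<ge> 0" by (simp add: \<kappa>_def)
  let ?c = "vec_norm N a" and ?u = "lin_comb N e a"
  have u: "norm (?u x) \<le> ?c * \<kappa>" for x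
  proof (cases "x \<in> sphere 0 1")
    case True
    have "kernel_norm x = \<kappa>" using kernel_norm_eq[OF True] unfolding \<kappa>_def V_def
      by (metis kernel_norm_def real_sqrt_unique vec_norm_nonneg)
    thus ?thesis using norm_lin_comb_le[of a x] by simp
  next
    case False
    have "?u x = 0" unfolding lin_comb_def
      using spherical_harmonics_bounded(3)[OF basis_mem False] by (intro sum.neutral) auto
    thus ?thesis using \<kappa>0 by simp
  qed
  have pw: "norm (?u x) powr q \<le> (?c * \<kappa>) powr (q - 2) * (norm (?u x))\<^sup>2" for x
  proof (cases "?u x = 0")
    case False
    have "norm (?u x) powr q = norm (?u x) powr (q - 2) * norm (?u x) powr 2" by (simp only: powr_add[symmetric]) simp
    also have "\<dots> \<le> (?c * \<kappa>) powr (q - 2) * norm (?u x) powr 2"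
      using u[of x] q by (intro mult_right_mono powr_mono2) auto
    finally show ?thesis using False by (simp add: powr_numeral)
  qed (use q in simp)
  have "(LINT x|sphere_measure. norm (?u x) powr q) \<le> (LINT x|sphere_measure. (?c * \<kappa>) powr (q - 2) * (norm (?u x))\<^sup>2)"
    using integrable_norm_lin_comb_power2 pw by (intro integral_mono') auto
  also have "\<dots> = (?c * \<kappa>) powr (q - 2) * ?c\<^sup>2" by (simp add: integral_norm_lin_comb)
  finally have "Lq_norm q ?u \<le> ((?c * \<kappa>) powr (q - 2) * ?c\<^sup>2) powr (1 / q)"
    unfolding Lq_norm_def using q by (intro powr_mono2) auto
  also have "\<dots> = (real N / V) powr (1 / 2 - 1 / q) * ?c"
  proof (cases "?c = 0")
    case False
    hence c: "?c > 0" using vec_norm_nonneg[of N a] by linarith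
    have "(?c * \<kappa>) powr (q - 2) * ?c\<^sup>2 = \<kappa> powr (q - 2) * ?c powr q"
      using c \<kappa>0 by (simp add: powr_mult powr_diff powr_numeral[symmetric] del: powr_numeral)
    hence "((?c * \<kappa>) powr (q - 2) * ?c\<^sup>2) powr (1 / q) = (\<kappa> powr (q - 2) * ?c powr q) powr (1 / q)" by simp
    also have "\<dots> = \<kappa> powr ((q - 2) * (1 / q)) * ?c"
      using c \<kappa>0 q by (simp add: powr_mult powr_powr)
    also have "\<kappa> powr ((q - 2) * (1 / q)) = (real N / V) powr (1 / 2 - 1 / q)"
    proof -
      have "\<kappa> = (real N / V) powr (1 / 2)" using V by (simp add: \<kappa>_def powr_half_sqrt)
      moreover have "1 / 2 * ((q - 2) * (1 / q)) = 1 / 2 - 1 / q" using q by (simp add: field_simps)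
      ultimately show ?thesis by (simp only: powr_powr)
    qed
    finally show ?thesis .
  qed (use q in simp)
  finally show ?thesis by (simp add: V_def)
qed

text \<open>The reverse triangle inequality in \<open>L^q\<close> reduces the claim to
  \<open>Lq_norm_lin_comb_le\<close> for the difference of the coordinate vectors.\<close>

lemma Lq_norm_lin_comb_lipschitz:
  assumes q: "q \<ge> 2"
  shows "\<bar>Lq_norm q (lin_comb N e a) - Lq_norm q (lin_comb N e b)\<bar>
    \<le> (real N / measure (sphere_measure :: (real^'n) measure) (sphere 0 1)) powr (1 / 2 - 1 / q) * vec_norm N (\<lambda>i. a i - b i)"
proof -
  have tri: "Lq_norm q (lin_comb N e a) \<le> Lq_norm q (lin_comb N e (\<lambda>i. a i - b i)) + Lq_norm q (lin_comb N e b)" for a b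
  proof -
    let ?d = "lin_comb N e (\<lambda>i. a i - b i)"
    have add: "lin_comb N e a x = ?d x + lin_comb N e b x" for x
      by (simp add: lin_comb_def algebra_simps flip: sum.distrib)
    obtain B B' where B: "\<And>x. norm (?d x) \<le> B" "\<And>x. norm (lin_comb N e b x) \<le> B'"
      using lin_comb_bounded[of "\<lambda>i. a i - b i"] lin_comb_bounded[of b] by blast
    have int: "integrable sphere_measure (\<lambda>x. (norm (?d x) + norm (lin_comb N e b x)) powr q)"
      by (rule integrable_sphere_bounded[of _ "(B + B') powr q"])
        (use B q in \<open>auto intro!: powr_mono2 add_mono\<close>)
    have "Lq_norm q (lin_comb N e a) \<le> (LINT x|sphere_measure. (norm (?d x) + norm (lin_comb N e b x)) powr q) powr (1 / q)"
      unfolding Lq_norm_def add using q int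
      by (intro powr_mono2 integral_mono') (auto intro!: powr_mono2 norm_triangle_ineq)
    also have "\<dots> \<le> Lq_norm q ?d + Lq_norm q (lin_comb N e b)"
      unfolding Lq_norm_def using q by (intro minkowski_integral integrable_lin_comb_powr) auto
    finally show ?thesis .
  qed
  have sym: "Lq_norm q (lin_comb N e (\<lambda>i. b i - a i)) = Lq_norm q (lin_comb N e (\<lambda>i. a i - b i))"
  proof -
    have "lin_comb N e (\<lambda>i. b i - a i) x = - lin_comb N e (\<lambda>i. a i - b i) x" for x
      by (simp add: lin_comb_def algebra_simps flip: sum_negf)
    thus ?thesis by (simp add: Lq_norm_def)
  qed
  have "\<bar>Lq_norm q (lin_comb N e a) - Lq_norm q (lin_comb N e b)\<bar> \<le> Lq_norm q (lin_comb N e (\<lambda>i. a i - b i))"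
    using tri[of a b] tri[of b a] sym by linarith
  also note Lq_norm_lin_comb_le[OF q]
  finally show ?thesis .
qed

lemma lin_comb_measurable_pair:
  "(\<lambda>z. lin_comb N e (fst z) (snd z)) \<in> borel_measurable ((vec_borel N) \<Otimes>\<^sub>M sphere_measure)"
proof -
  have "(\<lambda>z. fst z m * e m (snd z)) \<in> borel_measurable ((vec_borel N) \<Otimes>\<^sub>M sphere_measure)" if "m < N" for m
    using that by (intro borel_measurable_times measurable_compose[OF measurable_fst measurable_component_singleton]
      measurable_compose[OF measurable_snd]) (auto intro: basis_measurable)
  thus ?thesis unfolding lin_comb_def by (intro borel_measurable_sum) auto
qed

lemma Lq_norm_measurable:
  "(\<lambda>a. Lq_norm q (lin_comb N e a)) \<in> borel_measurable (vec_borel N)"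
proof -
  have "(\<lambda>a. LINT x|sphere_measure. norm (lin_comb N e a x) powr q) \<in> borel_measurable (vec_borel N)"
    by (rule sphere_measure.borel_measurable_lebesgue_integral)
      (use lin_comb_measurable_pair in \<open>simp add: case_prod_unfold\<close>)
  thus ?thesis unfolding Lq_norm_def by measurable
qed

end

subsection \<open>The deviation event\<close>

text \<open>By Pascal's rule the dimension is at least the binomial coefficient
  \<open>(k + d - 1) choose (d - 1)\<close>, which is at least \<open>k + 1\<close>. This growth
  makes inverse squares of the dimension summable over \<open>k\<close>.\<close>

lemma harm_dim_ge:
  assumes "d \<ge> 2"
  shows "harm_dim d k \<ge> k + 1"
proof -
  define j where "j = d - 2"
  have d: "d = Suc (Suc j)" using assms by (simp add: j_def)
  have ge: "(k + Suc j) choose (Suc j) \<ge> k + 1"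
  proof (induction j)
    case (Suc j)
    have "(k + Suc (Suc j)) choose (Suc (Suc j)) = ((k + Suc j) choose (Suc j)) + ((k + Suc j) choose (Suc (Suc j)))"
      by simp
    thus ?case using Suc.IH by linarith
  qed simp
  have "(k + d) choose d = ((k + Suc j) choose (Suc j)) + ((k + Suc j) choose d)" by (simp add: d)
  moreover have "(k + d - 2) choose d \<le> (k + Suc j) choose d" by (simp add: d)
  ultimately show ?thesis using ge by (simp add: harm_dim_def)
qed

text \<open>The inequality \<open>z \<le> exp z\<close> at \<open>z = \<beta> * y / s\<close>,
  raised to the power \<open>s\<close>.\<close>

lemma powr_le_exp:
  fixes y s \<beta> :: real
  assumes "y \<ge> 0" "s > 0" "\<beta> > 0"
  shows "y powr s \<le> (s / \<beta>) powr s * exp (\<beta> * y)"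
proof -
  have "\<beta> * y / s \<le> exp (\<beta> * y / s)" using exp_ge_add_one_self[of "\<beta> * y / s"] by linarith
  hence "(\<beta> * y / s) powr s \<le> exp (\<beta> * y / s) powr s" using assms by (intro powr_mono2) auto
  also have "\<dots> = exp (\<beta> * y)" using assms by (simp add: powr_def)
  finally have "(s / \<beta>) powr s * (\<beta> * y / s) powr s \<le> (s / \<beta>) powr s * exp (\<beta> * y)" by (intro mult_left_mono) auto
  moreover have "(s / \<beta>) powr s * (\<beta> * y / s) powr s = y powr s" using assms by (simp flip: powr_mult)
  ultimately show ?thesis by simp
qed

text \<open>
  The \<open>64\<close> comes from the concentration inequality; the minimum bounds \<open>Vol powr (1 - 2/q)\<close> from below
  uniformly in \<open>q \<ge> 2\<close>.
\<close>

definition dev_rate :: "'n::finite itself \<Rightarrow> real" where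
  "dev_rate _ = min 1 (measure (sphere_measure :: (real^'n) measure) (sphere 0 1)) / 64"

lemma dev_rate_pos: "dev_rate TYPE('n::finite) > 0"
  using measure_sphere_pos[where 'n='n] by (simp add: dev_rate_def)

text \<open>The Lipschitz constant satisfies \<open>L^2 = (N / V)^(1 - 2/q)\<close>, so the
  concentration exponent contains \<open>N / L^2 = N^(2/q) V^(1 - 2/q)\<close>.\<close>

lemma Lq_deviation:
  fixes e :: "nat \<Rightarrow> real^'n \<Rightarrow> 'k::rc_field"
  assumes e: "orthonormal_basis_harm k N e" and N: "N > 0" and q: "q \<ge> 2"
    and m: "is_Lq_median N e q m" and r: "r \<ge> 0"
  shows "measure (uniform_unit_sphere N) {a\<in>space (uniform_unit_sphere N). \<bar>Lq_norm q (lin_comb N e a) - m\<bar> > r}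
    \<le> 16 * exp (- (dev_rate TYPE('n) * real N powr (2 / q) * r\<^sup>2))"
proof -
  define V where "V = measure (sphere_measure :: (real^'n) measure) (sphere 0 1)"
  define L where "L = (real N / V) powr (1 / 2 - 1 / q)"
  have V: "V > 0" unfolding V_def by (rule measure_sphere_pos)
  have L: "L > 0" using V N by (simp add: L_def)
  have L2: "L\<^sup>2 = (real N / V) powr (1 - 2 / q)"
    unfolding L_def power2_eq_square by (simp flip: powr_add)
  have "min 1 V \<le> V powr (1 - 2 / q)"
  proof (cases "V \<le> 1")
    case True
    have "V = V powr 1" using V by simp
    also have "\<dots> \<le> V powr (1 - 2 / q)" using True V q by (intro powr_mono') auto
    finally show ?thesis by simp
  next
    case False
    hence "1 \<le> V powr (1 - 2 / q)" using q by (intro ge_one_powr_ge_zero) auto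
    thus ?thesis by simp
  qed
  hence "dev_rate TYPE('n) * real N powr (2 / q) * r\<^sup>2 \<le> (V powr (1 - 2 / q) / 64) * real N powr (2 / q) * r\<^sup>2"
    unfolding dev_rate_def V_def[symmetric] by (intro mult_right_mono divide_right_mono) auto
  also have "\<dots> = (real N * r\<^sup>2) / (64 * L\<^sup>2)"
  proof -
    have "real N powr (2 / q) * real N powr (1 - 2 / q) = real N" using N by (simp flip: powr_add)
    hence "V powr (1 - 2 / q) * real N powr (2 / q) * L\<^sup>2 = real N"
      using V N by (simp add: L2 powr_divide)
    thus ?thesis using L by (simp add: field_simps)
  qed
  finally have exp: "exp (- ((real N * r\<^sup>2) / (64 * L\<^sup>2))) \<le> exp (- (dev_rate TYPE('n) * real N powr (2 / q) * r\<^sup>2))"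
    by simp
  have "measure (uniform_unit_sphere N) {a\<in>space (uniform_unit_sphere N). \<bar>Lq_norm q (lin_comb N e a) - m\<bar> > r}
    \<le> 16 * exp (- (real N * r\<^sup>2) / (64 * L\<^sup>2))"
  proof (rule sphere_concentration)
    show "(\<lambda>a. Lq_norm q (lin_comb N e a)) \<in> borel_measurable (vec_borel N)" by (rule Lq_norm_measurable[OF e])
    show "\<bar>Lq_norm q (lin_comb N e a) - Lq_norm q (lin_comb N e b)\<bar> \<le> L * vec_norm N (\<lambda>i. a i - b i)" for a b
      unfolding L_def V_def by (rule Lq_norm_lin_comb_lipschitz[OF e q])
    show "is_median (uniform_unit_sphere N) (\<lambda>a. Lq_norm q (lin_comb N e a)) m"
      using m by (simp add: is_Lq_median_def)
  qed (fact L N r)+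
  thus ?thesis using exp unfolding minus_divide_left[symmetric] by linarith
qed

text \<open>The projection of the infinite product to its \<open>k\<close>-th factor has law
  \<open>\<nu> k\<close>, and column \<open>l\<close> of that factor is uniform on the sphere, so
  the event has the probability of a deviation on the sphere.\<close>

lemma emeasure_column_deviation:
  fixes e :: "nat \<Rightarrow> nat \<Rightarrow> real^'n \<Rightarrow> 'k::rc_field"
  assumes e: "\<And>k. orthonormal_basis_harm k (D k) (e k)" and \<nu>: "\<And>k. haar_prob (D k) (\<nu> k)"
    and M: "\<And>k. is_Lq_median (D k) (e k) q (M k)" and q: "q \<ge> 2" and r: "r \<ge> 0" and l: "l < D k"
  defines "E \<equiv> {U \<in> space (\<Pi>\<^sub>M k\<in>UNIV. \<nu> k). \<bar>Lq_norm q (basis_of (D k) (e k) (U k) l) - M k\<bar> > r}"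
  shows "E \<in> sets (\<Pi>\<^sub>M k\<in>UNIV. \<nu> k)"
    and "emeasure (\<Pi>\<^sub>M k\<in>UNIV. \<nu> k) E \<le> ennreal (16 * exp (- (dev_rate TYPE('n) * real (D k) powr (2 / q) * r\<^sup>2)))"
proof -
  interpret product_prob_space \<nu> UNIV
    using \<nu> by (intro product_prob_spaceI) (simp add: haar_prob_def)
  let ?P = "\<Pi>\<^sub>M k\<in>UNIV. \<nu> k" and ?N = "D k"
  let ?c = "\<lambda>U. \<lambda>m\<in>{..<?N}. U (m, l) :: 'k"
  let ?S = "{a\<in>space (uniform_unit_sphere ?N). \<bar>Lq_norm q (lin_comb ?N (e k) a) - M k\<bar> > r}"
  note [measurable] = Lq_norm_measurable[OF e]
  have S: "?S \<in> sets (\<Pi>\<^sub>M _\<in>{..<?N}. borel)"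
    unfolding sets_uniform_unit_sphere[symmetric] by measurable
  have c: "?c \<in> measurable (\<nu> k) (\<Pi>\<^sub>M _\<in>{..<?N}. borel)"
    and dc: "distr (\<nu> k) (\<Pi>\<^sub>M _\<in>{..<?N}. borel) ?c = uniform_unit_sphere ?N"
    by (rule distr_haar_column[OF \<nu> l])+
  have comp: "(\<lambda>U. U k) \<in> measurable ?P (\<nu> k)" by measurable
  note cc = measurable_compose[OF comp c]
  have basis: "basis_of ?N (e k) W l = lin_comb ?N (e k) (?c W)" for W
    by (simp add: basis_of_def lin_comb_def)
  have E: "E = (\<lambda>U. ?c (U k)) -` ?S \<inter> space ?P"
    unfolding E_def basis by (auto simp: space_uniform_unit_sphere)
  show "E \<in> sets ?P" unfolding E by (rule measurable_sets[OF cc S])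
  have "distr ?P (\<Pi>\<^sub>M _\<in>{..<?N}. borel) (\<lambda>U. ?c (U k)) = distr (distr ?P (\<nu> k) (\<lambda>U. U k)) (\<Pi>\<^sub>M _\<in>{..<?N}. borel) ?c"
    using distr_distr[OF c comp] by (simp add: comp_def)
  also have "\<dots> = uniform_unit_sphere ?N" using PiM_component[of k] by (simp add: dc)
  finally have "emeasure ?P E = emeasure (uniform_unit_sphere ?N) ?S"
    unfolding E using emeasure_distr[OF cc S] by simp
  also have "\<dots> = ennreal (measure (uniform_unit_sphere ?N) ?S)"
    using prob_space.finite_measure[OF prob_space_uniform_unit_sphere] by (intro finite_measure.emeasure_eq_measure)
  also have "\<dots> \<le> ennreal (16 * exp (- (dev_rate TYPE('n) * real ?N powr (2 / q) * r\<^sup>2)))"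
    using l by (intro ennreal_leI Lq_deviation[OF e _ q M r]) auto
  finally show "emeasure ?P E \<le> ennreal (16 * exp (- (dev_rate TYPE('n) * real ?N powr (2 / q) * r\<^sup>2)))" .
qed

text \<open>Put \<open>y = x powr (2 / q)\<close>. For \<open>y, r \<ge> 1\<close> one has
  \<open>y * r^2 \<ge> (y + r^2) / 2\<close>, so the exponential splits into one in \<open>y\<close>
  and one in \<open>r^2\<close>, each at half the rate. The factor in \<open>y\<close> absorbs
  \<open>x^3 = y powr s\<close> with \<open>s = 3 * q / 2\<close>: one power of \<open>x\<close>
  pays for the union over the columns, two for summability over the degrees. Only the resulting
  \<open>K\<close> depends on \<open>q\<close>.\<close>

lemma dimension_exp_decay:
  fixes q c :: real
  assumes q: "q \<ge> 2" and c: "c > 0"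
  obtains K where "K \<ge> 0"
    "\<And>x r. x \<ge> 1 \<Longrightarrow> r \<ge> 1 \<Longrightarrow> x * (16 * exp (- (c * x powr (2 / q) * r\<^sup>2))) \<le> K * exp (- (c / 2) * r\<^sup>2) / x\<^sup>2"
proof -
  define s where "s = 3 * q / 2"
  define \<beta> where "\<beta> = c / 2"
  define K where "K = 16 * (s / \<beta>) powr s"
  have s: "s > 0" "\<beta> > 0" using q c by (auto simp: s_def \<beta>_def)
  have "x * (16 * exp (- (c * x powr (2 / q) * r\<^sup>2))) \<le> K * exp (- (c / 2) * r\<^sup>2) / x\<^sup>2"
    if x: "x \<ge> 1" and r: "r \<ge> 1" for x r :: real
  proof -
    define y where "y = x powr (2 / q)"
    have y: "y \<ge> 1" using x q by (auto simp: y_def intro: ge_one_powr_ge_zero)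
    have "y powr s = x powr 3" using q by (simp add: y_def s_def powr_powr)
    hence x3: "x ^ 3 \<le> (s / \<beta>) powr s * exp (\<beta> * y)"
      using powr_le_exp[of y s \<beta>] s y x by simp
    have r2: "r\<^sup>2 \<ge> 1" using r by simp
    have "(y + r\<^sup>2) / 2 \<le> y * r\<^sup>2"
    proof -
      have "y * 1 \<le> y * r\<^sup>2" using y r2 by (intro mult_left_mono) auto
      moreover have "1 * r\<^sup>2 \<le> y * r\<^sup>2" using y by (intro mult_right_mono) auto
      ultimately show ?thesis by simp
    qed
    hence "\<beta> * y + \<beta> * r\<^sup>2 \<le> c * y * r\<^sup>2"
      using mult_left_mono[of "(y + r\<^sup>2) / 2" "y * r\<^sup>2" c] c by (simp add: \<beta>_def algebra_simps)
    hence "exp (- (c * y * r\<^sup>2)) \<le> exp (- (\<beta> * y) + - (\<beta> * r\<^sup>2))" by simp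
    also have "\<dots> = exp (- (\<beta> * y)) * exp (- (\<beta> * r\<^sup>2))" by (rule exp_add)
    finally have "x ^ 3 * (16 * exp (- (c * y * r\<^sup>2)))
      \<le> ((s / \<beta>) powr s * exp (\<beta> * y)) * (16 * (exp (- (\<beta> * y)) * exp (- (\<beta> * r\<^sup>2))))"
      using x3 by (intro mult_mono) auto
    also have "\<dots> = K * (exp (\<beta> * y) * exp (- (\<beta> * y))) * exp (- (\<beta> * r\<^sup>2))"
      by (simp only: K_def mult_ac)
    also have "exp (\<beta> * y) * exp (- (\<beta> * y)) = 1" by (simp flip: exp_add)
    finally have "x ^ 3 * (16 * exp (- (c * y * r\<^sup>2))) \<le> K * exp (- (\<beta> * r\<^sup>2))" by simp
    moreover have "x * (16 * exp (- (c * y * r\<^sup>2))) * x\<^sup>2 = x ^ 3 * (16 * exp (- (c * y * r\<^sup>2)))"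
      by (simp only: power3_eq_cube power2_eq_square mult_ac)
    moreover have "- (c / 2) * r\<^sup>2 = - (\<beta> * r\<^sup>2)" by (simp add: \<beta>_def)
    ultimately have "x * (16 * exp (- (c * y * r\<^sup>2))) * x\<^sup>2 \<le> K * exp (- (c / 2) * r\<^sup>2)" by (simp only:)
    thus ?thesis using x by (simp only: y_def pos_le_divide_eq zero_less_power)
  qed
  thus ?thesis using that[of K] by (simp add: K_def)
qed

text \<open>\<open>C\<close> is fixed before the bases, Haar measures, medians and \<open>r\<close>.
  It is built from \<open>q\<close> and \<open>dev_rate\<close> alone.\<close>

lemma deviation_event_bound:
  assumes d: "d \<ge> 2" and q: "q \<ge> 2"
  obtains C where "C > 0"
    "\<And>(e :: nat \<Rightarrow> nat \<Rightarrow> real^'n \<Rightarrow> 'k::rc_field) \<nu> M r.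
       (\<forall>k. orthonormal_basis_harm k (harm_dim d k) (e k)) \<Longrightarrow> (\<forall>k. haar_prob (harm_dim d k) (\<nu> k)) \<Longrightarrow>
       (\<forall>k. is_Lq_median (harm_dim d k) (e k) q (M k)) \<Longrightarrow> r \<ge> 0 \<Longrightarrow>
       measure (\<Pi>\<^sub>M k\<in>UNIV. \<nu> k) (deviation_event d e \<nu> q M r) \<le> C * exp (- (dev_rate TYPE('n) / 2) * r\<^sup>2)"
proof -
  let ?c = "dev_rate TYPE('n)"
  have c: "?c > 0" by (rule dev_rate_pos)
  obtain K where K: "K \<ge> 0" "\<And>x r. x \<ge> 1 \<Longrightarrow> r \<ge> 1 \<Longrightarrow>
      x * (16 * exp (- (?c * x powr (2 / q) * r\<^sup>2))) \<le> K * exp (- (?c / 2) * r\<^sup>2) / x\<^sup>2"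
    using dimension_exp_decay[OF q c] by metis
  have sq: "summable (\<lambda>k. 1 / (real k + 1)\<^sup>2)"
    using inverse_power_summable[of 2, where 'a=real, THEN summable_Suc_iff[THEN iffD2]]
    by (simp add: inverse_eq_divide add.commute)
  define Z where "Z = (\<Sum>k. 1 / (real k + 1)\<^sup>2)"
  have Z: "Z \<ge> 0" unfolding Z_def using sq by (intro suminf_nonneg) auto
  \<comment> \<open>\<open>K * Z\<close> comes from the union bound for \<open>r \<ge> 1\<close>;
    \<open>exp (?c / 2)\<close> makes the right-hand side at least 1 for \<open>r < 1\<close>, where
    a probability needs no further estimate.\<close>
  define C where "C = K * Z + exp (?c / 2)"
  have C: "C > 0" using mult_nonneg_nonneg[OF K(1) Z] by (simp add: C_def add_nonneg_pos)
  have "measure (\<Pi>\<^sub>M k\<in>UNIV. \<nu> k) (deviation_event d e \<nu> q M r) \<le> C * exp (- (?c / 2) * r\<^sup>2)"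
    if e: "\<forall>k. orthonormal_basis_harm k (harm_dim d k) (e k)" and \<nu>: "\<forall>k. haar_prob (harm_dim d k) (\<nu> k)"
      and M: "\<forall>k. is_Lq_median (harm_dim d k) (e k) q (M k)" and r: "r \<ge> 0"
    for e :: "nat \<Rightarrow> nat \<Rightarrow> real^'n \<Rightarrow> 'k" and \<nu> M r
  proof (cases "r \<ge> 1")
    case False
    interpret product_prob_space \<nu> UNIV
      using \<nu> by (intro product_prob_spaceI) (simp add: haar_prob_def)
    interpret P: prob_space "\<Pi>\<^sub>M k\<in>UNIV. \<nu> k" by (rule prob_space_PiM) (use \<nu> in \<open>simp add: haar_prob_def\<close>)
    have "r\<^sup>2 \<le> 1" using False r by (simp add: power_le_one)
    hence "?c / 2 * r\<^sup>2 \<le> ?c / 2 * 1" using c by (intro mult_left_mono) auto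
    hence "1 \<le> exp (?c / 2) * exp (- (?c / 2) * r\<^sup>2)" by (simp flip: exp_add)
    also have "\<dots> \<le> C * exp (- (?c / 2) * r\<^sup>2)" using mult_nonneg_nonneg[OF K(1) Z] by (intro mult_right_mono) (simp_all add: C_def)
    finally show ?thesis by (rule order_trans[OF P.prob_le_1])
  next
    case True
    let ?P = "\<Pi>\<^sub>M k\<in>UNIV. \<nu> k"
    let ?N = "harm_dim d"
    define E where "E = (\<lambda>k l. {U \<in> space ?P. \<bar>Lq_norm q (basis_of (?N k) (e k) (U k) l) - M k\<bar> > r})"
    have Es: "E k l \<in> sets ?P"
      and Em: "emeasure ?P (E k l) \<le> ennreal (16 * exp (- (?c * real (?N k) powr (2 / q) * r\<^sup>2)))"
      if "l < ?N k" for k l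
      unfolding E_def
      by (rule emeasure_column_deviation[OF e[rule_format] \<nu>[rule_format] M[rule_format] q r that])+
    have N: "real (?N k) \<ge> real k + 1" for k
    proof -
      have "real (k + 1) \<le> real (?N k)" using harm_dim_ge[OF d, of k] by (intro of_nat_mono)
      thus ?thesis by simp
    qed
    let ?b = "K * exp (- (?c / 2) * r\<^sup>2)"
    have b0: "?b \<ge> 0" using K(1) by simp
    have k: "emeasure ?P (\<Union>l\<in>{..<?N k}. E k l) \<le> ennreal (?b * (1 / (real k + 1)\<^sup>2))" for k
    proof -
      have "emeasure ?P (\<Union>l\<in>{..<?N k}. E k l) \<le> (\<Sum>l<?N k. emeasure ?P (E k l))"
        using Es by (intro emeasure_subadditive_finite) auto
      also have "\<dots> \<le> (\<Sum>l<?N k. ennreal (16 * exp (- (?c * real (?N k) powr (2 / q) * r\<^sup>2))))"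
        using Em by (intro sum_mono) auto
      also have "\<dots> = ennreal (real (?N k) * (16 * exp (- (?c * real (?N k) powr (2 / q) * r\<^sup>2))))"
        by (simp add: ennreal_mult ennreal_of_nat_eq_real_of_nat)
      also have "\<dots> \<le> ennreal (?b / (real (?N k))\<^sup>2)"
        using N[of k] True by (intro ennreal_leI K(2)) auto
      \<comment> \<open>The dimension is at least \<open>k + 1\<close>, which leaves a series
        summable in \<open>k\<close>.\<close>
      also have "\<dots> \<le> ennreal (?b / (real k + 1)\<^sup>2)"
        using N[of k] b0 by (intro ennreal_leI divide_left_mono power_mono) auto
      finally show ?thesis by simp
    qed
    \<comment> \<open>Being a countable union of measurable sets, the event is measurable, so
      \<open>measure\<close> really is its probability and not the default value 0.\<close>
    have "deviation_event d e \<nu> q M r = (\<Union>k. \<Union>l\<in>{..<?N k}. E k l)"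
      by (auto simp: deviation_event_def E_def)
    hence "emeasure ?P (deviation_event d e \<nu> q M r) \<le> (\<Sum>k. emeasure ?P (\<Union>l\<in>{..<?N k}. E k l))"
      using Es by (auto intro!: emeasure_subadditive_countably)
    also have "\<dots> \<le> (\<Sum>k. ennreal (?b * (1 / (real k + 1)\<^sup>2)))" by (intro suminf_le k) auto
    also have "\<dots> = ennreal (\<Sum>k. ?b * (1 / (real k + 1)\<^sup>2))"
      using b0 by (intro suminf_ennreal2 summable_mult sq) auto
    also have "(\<Sum>k. ?b * (1 / (real k + 1)\<^sup>2)) = ?b * Z" unfolding Z_def by (rule suminf_mult[OF sq])
    finally have "measure ?P (deviation_event d e \<nu> q M r) \<le> ?b * Z"
      unfolding measure_def using b0 Z by (intro enn2real_leI) auto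
    also have "\<dots> \<le> C * exp (- (?c / 2) * r\<^sup>2)" by (simp add: C_def algebra_simps)
    finally show ?thesis .
  qed
  thus ?thesis using that[OF C] by blast
qed

subsection \<open>Moments of a coordinate\<close>

lemma measure_eqI_atMost:
  fixes M N :: "real measure"
  assumes sets: "sets M = sets borel" "sets N = sets borel"
    and fin: "\<And>x. emeasure M {..x} < \<infinity>" and eq: "\<And>x. emeasure M {..x} = emeasure N {..x}"
  shows "M = N"
proof (rule measure_eqI_generator_eq)
  show "Int_stable (range (atMost :: real \<Rightarrow> real set))"
    by (auto simp: Int_stable_def)
  show "sets M = sigma_sets UNIV (range atMost)" "sets N = sigma_sets UNIV (range atMost)"
    using sets by (simp_all add: borel_eq_atMost)
  show "range (\<lambda>n::nat. {..real n}) \<subseteq> range atMost" by auto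
  show "(\<Union>n::nat. {..real n}) = UNIV" using real_arch_simple by auto
  show "emeasure M {..real n} \<noteq> \<infinity>" for n using fin[of "real n"] by simp
qed (auto simp: eq)

text \<open>Polar coordinates from homogeneity alone: the image under \<open>\<rho>\<close> of the
  measure with density \<open>g\<close> agrees on all half-lines with the measure of density
  \<open>G * n * s^(n - 1)\<close> on \<open>s \<ge> 0\<close>. That \<open>\<rho>\<close> is almost
  everywhere nonzero excludes an atom at 0.\<close>

lemma nn_integral_radial:
  fixes \<rho> :: "'a \<Rightarrow> real" and g :: "'a \<Rightarrow> ennreal" and n :: nat
  assumes [measurable]: "\<rho> \<in> borel_measurable M" "g \<in> borel_measurable M" "\<phi> \<in> borel_measurable borel"
    and \<rho>: "\<And>x. \<rho> x \<ge> 0" "AE x in M. \<rho> x \<noteq> 0" and n: "n > 0" and G: "G < top"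
    and scale: "\<And>s. s > 0 \<Longrightarrow> (\<integral>\<^sup>+x. g x * indicator {x. \<rho> x \<le> s} x \<partial>M) = ennreal (s ^ n) * G"
  shows "(\<integral>\<^sup>+x. g x * \<phi> (\<rho> x) \<partial>M)
    = G * (\<integral>\<^sup>+s. ennreal (real n * s ^ (n - 1)) * indicator {0..} s * \<phi> s \<partial>lborel)"
proof -
  define \<mu> where "\<mu> = distr (density M g) borel \<rho>"
  define \<mu>' where "\<mu>' = density lborel (\<lambda>s. G * (ennreal (real n * s ^ (n - 1)) * indicator {0..} s))"
  have e1: "emeasure \<mu> {..s} = (\<integral>\<^sup>+x. g x * indicator {x. \<rho> x \<le> s} x \<partial>M)" for s
  proof -
    have [measurable]: "\<rho> \<in> borel_measurable (density M g)" by simp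
    have "emeasure \<mu> {..s} = emeasure (density M g) {x\<in>space M. \<rho> x \<le> s}"
      unfolding \<mu>_def by (subst emeasure_distr) (auto intro!: arg_cong[where f = "emeasure (density M g)"])
    also have "\<dots> = (\<integral>\<^sup>+x. g x * indicator {x\<in>space M. \<rho> x \<le> s} x \<partial>M)"
      by (rule emeasure_density) measurable
    also have "\<dots> = (\<integral>\<^sup>+x. g x * indicator {x. \<rho> x \<le> s} x \<partial>M)"
      by (intro nn_integral_cong) (auto split: split_indicator)
    finally show ?thesis .
  qed
  have e2: "emeasure \<mu>' {..s} = G * (\<integral>\<^sup>+u. ennreal (real n * u ^ (n - 1)) * indicator {0..} u * indicator {..s} u \<partial>lborel)" for s
    unfolding \<mu>'_def by (subst emeasure_density) (simp_all add: nn_integral_cmult mult.assoc)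
  have eq: "emeasure \<mu> {..s} = emeasure \<mu>' {..s}" for s
  proof -
    consider "s < 0" | "s = 0" | "s > 0" by linarith
    thus ?thesis
    proof cases
      case 1
      have "emeasure \<mu> {..s} = (\<integral>\<^sup>+x. 0 \<partial>M)"
        unfolding e1 using 1 \<rho>(1) by (intro nn_integral_cong) (auto simp: indicator_def not_le intro: less_le_trans)
      moreover have "emeasure \<mu>' {..s} = G * (\<integral>\<^sup>+u. 0 \<partial>(lborel :: real measure))"
        unfolding e2 using 1 by (intro arg_cong2[where f = "(*)"] refl nn_integral_cong) (auto simp: indicator_def)
      ultimately show ?thesis by simp
    next
      case 2
      have "emeasure \<mu> {..s} = (\<integral>\<^sup>+x. 0 \<partial>M)"
        unfolding e1
      proof (rule nn_integral_cong_AE)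
        show "AE x in M. g x * indicator {x. \<rho> x \<le> s} x = 0"
          using \<rho>(2) by eventually_elim (use \<rho>(1) 2 in \<open>auto simp: indicator_def order_antisym_conv\<close>)
      qed
      moreover have "emeasure \<mu>' {..s} = G * (\<integral>\<^sup>+u. 0 \<partial>(lborel :: real measure))"
        unfolding e2
      proof (intro arg_cong2[where f = "(*)"] refl nn_integral_cong_AE)
        have "AE u in (lborel :: real measure). u \<noteq> 0" by (rule AE_lborel_singleton)
        thus "AE u in lborel. ennreal (real n * u ^ (n - 1)) * indicator {0..} u * indicator {..s} u = 0"
          by eventually_elim (use 2 in \<open>auto simp: indicator_def\<close>)
      qed
      ultimately show ?thesis by simp
    next
      case 3
      have "(\<integral>\<^sup>+u. ennreal (real n * u ^ (n - 1)) * indicator {0..} u * indicator {..s} u \<partial>lborel)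
        = (\<integral>\<^sup>+u. ennreal (real n * u ^ (n - 1)) * indicator {0..s} u \<partial>lborel)"
        by (intro nn_integral_cong) (auto simp: indicator_def)
      also have "\<dots> = ennreal (s ^ n - 0 ^ n)"
        by (rule nn_integral_FTC_Icc) (use 3 in \<open>auto intro!: derivative_eq_intros\<close>)
      finally show ?thesis unfolding e1 e2 using scale[OF 3] n by (simp add: mult.commute power_0_left)
    qed
  qed
  have "\<mu> = \<mu>'"
  proof (rule measure_eqI_atMost)
    show "emeasure \<mu> {..s} < \<infinity>" for s
    proof -
      have "emeasure \<mu> {..s} \<le> emeasure \<mu> {..max s 1}" by (intro emeasure_mono) (auto simp: \<mu>_def)
      also have "\<dots> = ennreal (max s 1 ^ n) * G" unfolding e1 by (rule scale) simp
      also have "\<dots> < \<infinity>" using G by (simp add: ennreal_mult_less_top)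
      finally show ?thesis .
    qed
  qed (simp_all add: \<mu>_def \<mu>'_def eq[unfolded \<mu>_def \<mu>'_def])
  have "(\<integral>\<^sup>+x. g x * \<phi> (\<rho> x) \<partial>M) = (\<integral>\<^sup>+s. \<phi> s \<partial>\<mu>)"
    unfolding \<mu>_def by (simp add: nn_integral_distr nn_integral_density)
  also have "\<dots> = (\<integral>\<^sup>+s. G * (ennreal (real n * s ^ (n - 1)) * indicator {0..} s) * \<phi> s \<partial>lborel)"
    unfolding \<open>\<mu> = \<mu>'\<close> \<mu>'_def by (subst nn_integral_density) simp_all
  also have "\<dots> = G * (\<integral>\<^sup>+s. ennreal (real n * s ^ (n - 1)) * indicator {0..} s * \<phi> s \<partial>lborel)"
    by (subst nn_integral_cmult[symmetric]) (simp_all add: mult.assoc)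
  finally show ?thesis .
qed

lemma nn_integral_Gamma:
  fixes n :: nat and p :: real
  assumes n: "n > 0" and p: "p \<ge> 0"
  shows "(\<integral>\<^sup>+s. ennreal (real n * s ^ (n - 1)) * indicator {0..} s * ennreal (s powr p * exp (- s)) \<partial>lborel)
    = ennreal (real n * Gamma (p + real n))"
proof -
  have "((\<lambda>t. real n * (t powr (p + real n - 1) / exp t)) has_integral real n * Gamma (p + real n)) {0..}"
    using Gamma_integral_real[of "p + real n"] n p by (intro has_integral_mult_right) simp
  hence "(\<integral>\<^sup>+s. ennreal (real n * (s powr (p + real n - 1) / exp s)) * indicator {0..} s \<partial>lborel) = ennreal (real n * Gamma (p + real n))"
    by (intro nn_integral_has_integral_lebesgue') auto
  moreover have "(\<integral>\<^sup>+s. ennreal (real n * s ^ (n - 1)) * indicator {0..} s * ennreal (s powr p * exp (- s)) \<partial>lborel)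
    = (\<integral>\<^sup>+s. ennreal (real n * (s powr (p + real n - 1) / exp s)) * indicator {0..} s \<partial>lborel)"
  proof (rule nn_integral_cong_AE)
    have "AE s in (lborel :: real measure). s \<noteq> 0" by (rule AE_lborel_singleton)
    thus "AE s in lborel. ennreal (real n * s ^ (n - 1)) * indicator {0..} s * ennreal (s powr p * exp (- s))
      = ennreal (real n * (s powr (p + real n - 1) / exp s)) * indicator {0..} s"
    proof eventually_elim
      case (elim s)
      show ?case
      proof (cases "s > 0")
        case True
        have "p + real n - 1 = p + real (n - 1)" using n by (simp add: of_nat_diff)
        hence "s powr (p + real n - 1) = s powr p * s ^ (n - 1)"
          using True by (simp only: powr_add powr_realpow)
        hence "real n * (s powr (p + real n - 1) / exp s) = (real n * s ^ (n - 1)) * (s powr p * exp (- s))"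
          by (simp add: exp_minus field_simps)
        thus ?thesis using True by (simp add: ennreal_mult)
      qed (use elim in simp)
    qed
  qed
  ultimately show ?thesis by simp
qed

text \<open>The radial variable is the squared norm. Its sublevel sets scale by \<open>s^N\<close>,
  because complex \<open>N\<close>-space has real dimension \<open>2 * N\<close>, and the Gaussian
  becomes \<open>exp (- s)\<close>, so Euler's integral appears without substitution.\<close>

lemma nn_integral_gaussian_radial:
  fixes g :: "(nat \<Rightarrow> complex) \<Rightarrow> ennreal"
  assumes g[measurable]: "g \<in> borel_measurable (vec_borel N)" and N: "N > 0" and p: "p \<ge> 0"
    and G: "(\<integral>\<^sup>+a. g (vec_sgn N a) * indicator (unit_ball N) a \<partial>vec_space N) < top"
  shows "(\<integral>\<^sup>+a. g (vec_sgn N a) * ennreal ((vec_norm N a)\<^sup>2 powr p * exp (- ((vec_norm N a)\<^sup>2))) \<partial>vec_space N)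
    = (\<integral>\<^sup>+a. g (vec_sgn N a) * indicator (unit_ball N) a \<partial>vec_space N) * ennreal (real N * Gamma (p + real N))"
proof -
  have "(\<integral>\<^sup>+a. g (vec_sgn N a) * (\<lambda>s. ennreal (s powr p * exp (- s))) ((vec_norm N a)\<^sup>2) \<partial>vec_space N)
    = (\<integral>\<^sup>+a. g (vec_sgn N a) * indicator (unit_ball N) a \<partial>vec_space N)
      * (\<integral>\<^sup>+s. ennreal (real N * s ^ (N - 1)) * indicator {0..} s * ennreal (s powr p * exp (- s)) \<partial>lborel)"
  proof (rule nn_integral_radial)
    show "(\<lambda>a. (vec_norm N a)\<^sup>2) \<in> borel_measurable (vec_space N :: (nat \<Rightarrow> complex) measure)" by measurable
    show "(\<lambda>a. g (vec_sgn N a)) \<in> borel_measurable (vec_space N)" by measurable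
    show "AE a in (vec_space N :: (nat \<Rightarrow> complex) measure). (vec_norm N a)\<^sup>2 \<noteq> 0"
      using AE_vec_norm_nonzero[OF N, where 'k=complex] by eventually_elim simp
    fix s :: real assume s: "s > 0"
    have "(vec_norm N a)\<^sup>2 \<le> s \<longleftrightarrow> vec_norm N a \<le> sqrt s" for a :: "nat \<Rightarrow> complex"
      using s by (metis real_le_rsqrt real_sqrt_ge_0_iff real_sqrt_pow2 vec_norm_nonneg power_mono less_imp_le)
    hence "(\<integral>\<^sup>+a. g (vec_sgn N a) * indicator {a. (vec_norm N a)\<^sup>2 \<le> s} a \<partial>vec_space N)
      = (\<integral>\<^sup>+a. g (vec_sgn N a) * indicator {a. vec_norm N a \<le> sqrt s} a \<partial>vec_space N)" by simp
    also have "\<dots> = ennreal (sqrt s ^ (N * DIM(complex))) * (\<integral>\<^sup>+a. g (vec_sgn N a) * indicator (unit_ball N) a \<partial>vec_space N)"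
      using s by (intro nn_integral_cone_scale g) simp
    also have "sqrt s ^ (N * DIM(complex)) = s ^ N"
      using s by (simp add: mult.commute[of N] power_mult)
    finally show "(\<integral>\<^sup>+a. g (vec_sgn N a) * indicator {a. (vec_norm N a)\<^sup>2 \<le> s} a \<partial>vec_space N)
      = ennreal (s ^ N) * (\<integral>\<^sup>+a. g (vec_sgn N a) * indicator (unit_ball N) a \<partial>vec_space N)" .
  qed (use N G in \<open>auto\<close>)
  also have "(\<integral>\<^sup>+s. ennreal (real N * s ^ (N - 1)) * indicator {0..} s * ennreal (s powr p * exp (- s)) \<partial>lborel)
    = ennreal (real N * Gamma (p + real N))" by (rule nn_integral_Gamma[OF N p])
  finally show ?thesis .
qed

lemma nn_integral_gaussian_product:
  fixes h :: "complex \<Rightarrow> ennreal"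
  assumes N: "N > 0" and h[measurable]: "h \<in> borel_measurable borel"
  shows "(\<integral>\<^sup>+a. h (a 0) * ennreal (exp (- ((vec_norm N a)\<^sup>2))) \<partial>vec_space N)
    = (\<integral>\<^sup>+z. h z * ennreal (exp (- ((norm z)\<^sup>2))) \<partial>lborel)
      * (\<integral>\<^sup>+z. ennreal (exp (- ((norm z)\<^sup>2))) \<partial>(lborel :: complex measure)) ^ (N - 1)"
proof -
  define f where "f = (\<lambda>(i::nat) z. if i = 0 then h z * ennreal (exp (- ((norm z)\<^sup>2))) else ennreal (exp (- ((norm z)\<^sup>2))))"
  have I: "{..<N} = insert 0 {1..<N}" using N by auto
  have "h (a 0) * ennreal (exp (- ((vec_norm N a)\<^sup>2))) = (\<Prod>i<N. f i (a i))" for a :: "nat \<Rightarrow> complex"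
  proof -
    have "exp (- ((vec_norm N a)\<^sup>2)) = (\<Prod>i<N. exp (- ((norm (a i))\<^sup>2)))"
      by (simp add: vec_norm_power2 exp_sum flip: sum_negf)
    hence "ennreal (exp (- ((vec_norm N a)\<^sup>2))) = (\<Prod>i<N. ennreal (exp (- ((norm (a i))\<^sup>2))))"
      by (simp add: prod_ennreal)
    also have "\<dots> = ennreal (exp (- ((norm (a 0))\<^sup>2))) * (\<Prod>i\<in>{1..<N}. ennreal (exp (- ((norm (a i))\<^sup>2))))"
      unfolding I by simp
    also have "(\<Prod>i\<in>{1..<N}. ennreal (exp (- ((norm (a i))\<^sup>2)))) = (\<Prod>i\<in>{1..<N}. f i (a i))"
      by (intro prod.cong refl) (auto simp: f_def)
    finally have "h (a 0) * ennreal (exp (- ((vec_norm N a)\<^sup>2))) = f 0 (a 0) * (\<Prod>i\<in>{1..<N}. f i (a i))"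
      by (simp add: f_def mult.assoc)
    also have "\<dots> = (\<Prod>i<N. f i (a i))" unfolding I by simp
    finally show ?thesis .
  qed
  hence "(\<integral>\<^sup>+a. h (a 0) * ennreal (exp (- ((vec_norm N a)\<^sup>2))) \<partial>vec_space N)
    = (\<integral>\<^sup>+a. (\<Prod>i<N. f i (a i)) \<partial>(\<Pi>\<^sub>M _\<in>{..<N}. lborel))" by (simp only: vec_space_def)
  also have "\<dots> = (\<Prod>i<N. \<integral>\<^sup>+z. f i z \<partial>lborel)"
    by (rule lborel_prod.product_nn_integral_prod) (auto simp: f_def)
  also have "\<dots> = (\<integral>\<^sup>+z. f 0 z \<partial>lborel) * (\<Prod>i\<in>{1..<N}. \<integral>\<^sup>+z. f i z \<partial>lborel)" unfolding I by simp
  also have "(\<Prod>i\<in>{1..<N}. \<integral>\<^sup>+z. f i z \<partial>lborel)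
    = (\<Prod>i\<in>{1..<N}. \<integral>\<^sup>+z. ennreal (exp (- ((norm z)\<^sup>2))) \<partial>(lborel :: complex measure))"
    by (intro prod.cong refl) (auto simp: f_def)
  finally show ?thesis by (simp add: f_def)
qed

text \<open>
  The integral of \<open>\<bar>a\<^sub>0\<bar> powr q * exp (-\<bar>a\<bar>^2)\<close> is computed in polar coordinates and as a product over the
  coordinates. The remaining integral over \<^typ>\<open>complex\<close> is the case \<open>N = 1\<close>, in which the moment is \<open>1\<close>.
\<close>

lemma sphere_moment:
  fixes q :: real
  assumes N: "N > 0" and q: "q > 0"
  shows "(\<integral>\<^sup>+a. ennreal (norm (a 0) powr q) \<partial>(uniform_unit_sphere N :: (nat \<Rightarrow> complex) measure))
    = ennreal (Gamma (q / 2 + 1) * Gamma (real N) / Gamma (q / 2 + real N))"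
proof -
  define \<beta> where "\<beta> = (\<lambda>N. emeasure (vec_space N) (unit_ball N :: (nat \<Rightarrow> complex) set))"
  define A where "A = (\<lambda>N. \<integral>\<^sup>+a. ennreal (norm (a 0) powr q) \<partial>(uniform_unit_sphere N :: (nat \<Rightarrow> complex) measure))"
  define I where "I = (\<lambda>q. \<integral>\<^sup>+z. ennreal (norm z powr q) * ennreal (exp (- ((norm z)\<^sup>2))) \<partial>(lborel :: complex measure))"
  define J where "J = (\<integral>\<^sup>+z. ennreal (exp (- ((norm z)\<^sup>2))) \<partial>(lborel :: complex measure))"
  have \<beta>: "\<beta> N \<noteq> 0" "\<beta> N < top" for N unfolding \<beta>_def by (rule emeasure_unit_ball)+
  have A1: "A N \<le> 1" if "N > 0" for N
  proof -
    interpret prob_space "uniform_unit_sphere N :: (nat \<Rightarrow> complex) measure" by (rule prob_space_uniform_unit_sphere)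
    have "A N \<le> (\<integral>\<^sup>+a. 1 \<partial>(uniform_unit_sphere N :: (nat \<Rightarrow> complex) measure))"
      unfolding A_def
    proof (rule nn_integral_mono_AE)
      show "AE a in (uniform_unit_sphere N :: (nat \<Rightarrow> complex) measure). ennreal (norm (a 0) powr q) \<le> 1"
        using AE_uniform_unit_sphere[OF that, where 'k=complex]
      proof eventually_elim
        case (elim a)
        hence "norm (a 0) \<le> 1" using norm_le_vec_norm[of 0 N a] that by simp
        hence "norm (a 0) powr q \<le> 1 powr q" using q by (intro powr_mono2) auto
        thus ?case by simp
      qed
    qed
    thus ?thesis by (simp add: emeasure_space_1)
  qed
  have mq: "(\<lambda>a :: nat \<Rightarrow> complex. ennreal (norm (a 0) powr q)) \<in> borel_measurable (vec_borel N)" if "N > 0" for N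
  proof -
    have "(\<lambda>a :: nat \<Rightarrow> complex. a 0) \<in> borel_measurable (vec_borel N)"
      using that by (intro measurable_component_singleton) auto
    thus ?thesis by measurable
  qed
  have 1: "I q * J ^ (N - 1) = A N * \<beta> N * ennreal (real N * Gamma (q / 2 + real N))" if N: "N > 0" for N
  proof -
    have ball: "(\<integral>\<^sup>+a. ennreal (norm (vec_sgn N a 0) powr q) * indicator (unit_ball N) a \<partial>(vec_space N :: (nat \<Rightarrow> complex) measure)) = A N * \<beta> N"
      unfolding A_def \<beta>_def by (rule nn_integral_uniform_unit_sphere[OF mq[OF N], symmetric])
    have "I q * J ^ (N - 1)
      = (\<integral>\<^sup>+a. ennreal (norm (a 0) powr q) * ennreal (exp (- ((vec_norm N a)\<^sup>2))) \<partial>(vec_space N :: (nat \<Rightarrow> complex) measure))"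
      unfolding I_def J_def by (rule nn_integral_gaussian_product[OF N, symmetric]) measurable
    also have "\<dots> = (\<integral>\<^sup>+a. ennreal (norm (vec_sgn N a 0) powr q) * ennreal ((vec_norm N a)\<^sup>2 powr (q / 2) * exp (- ((vec_norm N a)\<^sup>2))) \<partial>(vec_space N :: (nat \<Rightarrow> complex) measure))"
    proof (rule nn_integral_cong_AE)
      show "AE a in (vec_space N :: (nat \<Rightarrow> complex) measure). ennreal (norm (a 0) powr q) * ennreal (exp (- ((vec_norm N a)\<^sup>2)))
        = ennreal (norm (vec_sgn N a 0) powr q) * ennreal ((vec_norm N a)\<^sup>2 powr (q / 2) * exp (- ((vec_norm N a)\<^sup>2)))"
        using AE_vec_norm_nonzero[OF N, where 'k=complex]
      proof eventually_elim
        case (elim a)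
        hence pos: "vec_norm N a > 0" using vec_norm_nonneg[of N a] by linarith
        have "(vec_norm N a)\<^sup>2 powr (q / 2) = vec_norm N a powr q"
          using pos by (simp add: powr_powr flip: powr_numeral)
        moreover have "norm (vec_sgn N a 0) = norm (a 0) / vec_norm N a"
          using N pos by (simp add: vec_sgn_def divide_inverse mult.commute)
        ultimately have "norm (vec_sgn N a 0) powr q * (vec_norm N a)\<^sup>2 powr (q / 2) = norm (a 0) powr q"
          using pos by (simp add: powr_divide)
        thus ?case by (simp add: mult.assoc[symmetric] flip: ennreal_mult)
      qed
    qed
    also have "\<dots> = A N * \<beta> N * ennreal (real N * Gamma (q / 2 + real N))"
      unfolding ball[symmetric]
      using q A1[OF N] \<beta>(2)[of N]
      by (intro nn_integral_gaussian_radial mq N) (auto simp: ball ennreal_mult_less_top le_less_trans[OF _ ennreal_one_less_top])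
    finally show ?thesis .
  qed
  \<comment> \<open>The analogue of \<open>1\<close> without the factor \<open>|a_0|^q\<close>;
    dividing the two identities removes the unknown volume of the ball.\<close>
  have 0: "J ^ N = \<beta> N * ennreal (real N * Gamma (real N))" if N: "N > 0" for N
  proof -
    have ball: "(\<integral>\<^sup>+a. 1 * indicator (unit_ball N) a \<partial>(vec_space N :: (nat \<Rightarrow> complex) measure)) = \<beta> N"
      by (simp add: \<beta>_def sets_vec_space)
    have "J ^ N = J * J ^ (N - 1)" using N by (simp flip: power_Suc)
    also have "\<dots> = (\<integral>\<^sup>+a. 1 * ennreal (exp (- ((vec_norm N a)\<^sup>2))) \<partial>(vec_space N :: (nat \<Rightarrow> complex) measure))"
      unfolding J_def using nn_integral_gaussian_product[OF N, of "\<lambda>_. 1"] by simp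
    also have "\<dots> = (\<integral>\<^sup>+a. 1 * ennreal ((vec_norm N a)\<^sup>2 powr 0 * exp (- ((vec_norm N a)\<^sup>2))) \<partial>(vec_space N :: (nat \<Rightarrow> complex) measure))"
    proof (rule nn_integral_cong_AE)
      show "AE a in (vec_space N :: (nat \<Rightarrow> complex) measure). 1 * ennreal (exp (- ((vec_norm N a)\<^sup>2)))
        = 1 * ennreal ((vec_norm N a)\<^sup>2 powr 0 * exp (- ((vec_norm N a)\<^sup>2)))"
        using AE_vec_norm_nonzero[OF N, where 'k=complex] by eventually_elim simp
    qed
    also have "\<dots> = \<beta> N * ennreal (real N * Gamma (0 + real N))"
      unfolding ball[symmetric] using \<beta>(2)[of N] by (intro nn_integral_gaussian_radial N) (auto simp: ball[simplified])
    finally show ?thesis by simp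
  qed
  have A_1: "A 1 = 1"
  proof -
    interpret prob_space "uniform_unit_sphere 1 :: (nat \<Rightarrow> complex) measure" by (rule prob_space_uniform_unit_sphere)
    have "A 1 = (\<integral>\<^sup>+a. 1 \<partial>(uniform_unit_sphere 1 :: (nat \<Rightarrow> complex) measure))"
      unfolding A_def
    proof (rule nn_integral_cong_AE)
      show "AE a in (uniform_unit_sphere 1 :: (nat \<Rightarrow> complex) measure). ennreal (norm (a 0) powr q) = 1"
        using AE_uniform_unit_sphere[of 1, where 'k=complex, OF zero_less_one]
        by eventually_elim (simp add: vec_norm_def lessThan_Suc)
    qed
    thus ?thesis using emeasure_space_1 by (simp del: One_nat_def)
  qed
  have "I q = J * ennreal (Gamma (q / 2 + 1))"
    using 1[of 1] 0[of 1] A_1 by simp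
  hence "I q * J ^ (N - 1) = ennreal (Gamma (q / 2 + 1)) * J ^ N"
    using N by (cases N) (simp_all add: mult_ac)
  hence eq: "A N * \<beta> N * ennreal (real N * Gamma (q / 2 + real N))
    = ennreal (Gamma (q / 2 + 1)) * (\<beta> N * ennreal (real N * Gamma (real N)))"
    using 1[OF N] 0[OF N] by simp
  obtain x where x: "A N = ennreal x" "x \<ge> 0" using A1[OF N] by (metis ennreal_cases ennreal_one_neq_top top_unique)
  obtain b where b: "\<beta> N = ennreal b" "b > 0" using \<beta>[of N] by (cases "\<beta> N") (auto simp: less_le)
  have G: "Gamma (q / 2 + real N) > 0" "Gamma (q / 2 + 1) > 0" "Gamma (real N) > 0"
    using q N by (auto intro!: Gamma_real_pos)
  have "x * b * (real N * Gamma (q / 2 + real N)) = Gamma (q / 2 + 1) * (b * (real N * Gamma (real N)))"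
    using eq x b G by (simp flip: ennreal_mult)
  hence "x * Gamma (q / 2 + real N) = Gamma (q / 2 + 1) * Gamma (real N)" using b N by (simp add: field_simps)
  hence "x = Gamma (q / 2 + 1) * Gamma (real N) / Gamma (q / 2 + real N)" using G by (simp add: field_simps)
  thus ?thesis using x by (simp add: A_def)
qed

subsection \<open>Mean and median\<close>

text \<open>Layer-cake integration over the levels \<open>u\<close>. Levels up to 1 contribute at
  most 1. For \<open>u \<ge> 1\<close> the threshold is \<open>t = sqrt (ln u / \<beta>)\<close>,
  and the factor 2 in the tail exponent turns the tail into \<open>C / u^2\<close>, whose integral
  is \<open>C\<close>.\<close>

lemma nn_integral_exp_of_tail:
  fixes Y :: "'a \<Rightarrow> real"
  assumes "prob_space M" and Y[measurable]: "Y \<in> borel_measurable M" and \<beta>: "\<beta> > 0" and C: "C \<ge> 0"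
    and tail: "\<And>t. t \<ge> 0 \<Longrightarrow> measure M {x\<in>space M. \<bar>Y x\<bar> > t} \<le> C * exp (- (2 * \<beta> * t\<^sup>2))"
  shows "(\<integral>\<^sup>+x. ennreal (exp (\<beta> * (Y x)\<^sup>2)) \<partial>M) \<le> ennreal (1 + C)"
proof -
  interpret prob_space M by fact
  let ?f = "\<lambda>x. ennreal (exp (\<beta> * (Y x)\<^sup>2))"
  have le: "indicator {0..} u * emeasure M {x\<in>space M. ennreal u < ?f x}
    \<le> indicator {0..1} u + ennreal (C * inverse (u\<^sup>2)) * indicator {1..} u" for u :: real
  proof (cases "u \<ge> 1")
    case True
    define t where "t = sqrt (ln u / \<beta>)"
    have t: "t \<ge> 0" "\<beta> * t\<^sup>2 = ln u" using True \<beta> by (auto simp: t_def)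
    have "{x\<in>space M. ennreal u < ?f x} \<subseteq> {x\<in>space M. \<bar>Y x\<bar> > t}"
    proof
      fix x assume "x \<in> {x\<in>space M. ennreal u < ?f x}"
      hence x: "x \<in> space M" "u < exp (\<beta> * (Y x)\<^sup>2)" using True by (auto simp: ennreal_less_iff)
      hence "ln u < \<beta> * (Y x)\<^sup>2" using True by (metis exp_gt_zero ln_exp ln_less_cancel_iff less_le_trans zero_less_one)
      hence "t\<^sup>2 < \<bar>Y x\<bar>\<^sup>2" using \<beta> by (simp flip: t(2))
      hence "t < \<bar>Y x\<bar>" by (rule power2_less_imp_less) simp
      thus "x \<in> {x\<in>space M. \<bar>Y x\<bar> > t}" using x by simp
    qed
    hence "emeasure M {x\<in>space M. ennreal u < ?f x} \<le> emeasure M {x\<in>space M. \<bar>Y x\<bar> > t}"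
      by (intro emeasure_mono) measurable
    also have "\<dots> \<le> ennreal (C * exp (- (2 * \<beta> * t\<^sup>2)))"
      unfolding emeasure_eq_measure by (intro ennreal_leI tail t)
    also have "- (2 * \<beta> * t\<^sup>2) = - (ln u + ln u)" by (simp flip: t(2))
    also have "exp (- (ln u + ln u)) = inverse (u\<^sup>2)"
    proof -
      have "exp (ln u) = u" using True by simp
      thus ?thesis by (simp only: exp_minus exp_add power2_eq_square)
    qed
    finally show ?thesis using True by (auto simp: indicator_def intro: order_trans)
  next
    case False
    thus ?thesis using emeasure_le_1 by (auto simp: indicator_def intro: order_trans)
  qed
  have "(\<integral>\<^sup>+x. ?f x \<partial>M) = (\<integral>\<^sup>+u. indicator {0..} u * emeasure M {x\<in>space M. ennreal u < ?f x} \<partial>lborel)"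
    by (rule nn_integral_layer_cake) (unfold_locales, measurable)
  also have "\<dots> \<le> (\<integral>\<^sup>+u. indicator {0..1::real} u + ennreal (C * inverse (u\<^sup>2)) * indicator {1..} u \<partial>lborel)"
    by (intro nn_integral_mono le)
  also have "\<dots> = (\<integral>\<^sup>+u. indicator {0..1::real} u \<partial>lborel) + (\<integral>\<^sup>+u. ennreal (C * inverse (u\<^sup>2)) * indicator {1..} u \<partial>lborel)"
    by (rule nn_integral_add) measurable
  also have "(\<integral>\<^sup>+u. ennreal (C * inverse (u\<^sup>2)) * indicator {1::real..} u \<partial>lborel) = ennreal (0 - - C / 1)"
  proof (rule nn_integral_FTC_atLeast)
    show "((\<lambda>u::real. - C / u) has_real_derivative C * inverse (u\<^sup>2)) (at u)" if "1 \<le> u" for u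
      using that by (auto intro!: derivative_eq_intros simp: power2_eq_square field_simps)
    show "((\<lambda>u::real. - C / u) \<longlongrightarrow> 0) at_top"
      by (rule real_tendsto_divide_at_top[OF tendsto_const filterlim_ident])
  qed (use C in auto)
  also have "(\<integral>\<^sup>+u. indicator {0..1::real} u \<partial>lborel) + ennreal (0 - - C / 1) = ennreal (1 + C)"
    using C by (simp add: ennreal_plus)
  finally show ?thesis .
qed

text \<open>The power is dominated by \<open>exp (b / 2 * Y^2)\<close> through
  \<open>powr_le_exp\<close>, applied to \<open>Y^2\<close> with exponent \<open>q / 2\<close>.
  After a \<open>q\<close>-th root the constant \<open>(q / b) powr (q / 2)\<close> becomes
  \<open>sqrt (q / b)\<close>, the source of the factor \<open>sqrt q\<close>.\<close>

lemma integral_powr_of_tail: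
  fixes Y :: "'a \<Rightarrow> real"
  assumes M: "prob_space M" and Y[measurable]: "Y \<in> borel_measurable M" and b: "b > 0" and C: "C \<ge> 0" and q: "q > 0"
    and tail: "\<And>t. t \<ge> 0 \<Longrightarrow> measure M {x\<in>space M. \<bar>Y x\<bar> > t} \<le> C * exp (- (b * t\<^sup>2))"
  shows "integrable M (\<lambda>x. \<bar>Y x\<bar> powr q)" "(LINT x|M. \<bar>Y x\<bar> powr q) \<le> (1 + C) * (q / b) powr (q / 2)"
proof -
  let ?k = "(q / b) powr (q / 2)"
  have pw: "\<bar>Y x\<bar> powr q \<le> ?k * exp (b / 2 * (Y x)\<^sup>2)" for x
  proof (cases "Y x = 0")
    case False
    have "\<bar>Y x\<bar> powr q = (\<bar>Y x\<bar> powr 2) powr (q / 2)" by (simp only: powr_powr) simp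
    also have "\<bar>Y x\<bar> powr 2 = (Y x)\<^sup>2" using False by (simp add: powr_numeral)
    also have "(Y x)\<^sup>2 powr (q / 2) \<le> ((q / 2) / (b / 2)) powr (q / 2) * exp (b / 2 * (Y x)\<^sup>2)"
      using q b by (intro powr_le_exp) auto
    finally show ?thesis by simp
  qed (use q in simp)
  have "(\<integral>\<^sup>+x. ennreal (\<bar>Y x\<bar> powr q) \<partial>M) \<le> (\<integral>\<^sup>+x. ennreal ?k * ennreal (exp (b / 2 * (Y x)\<^sup>2)) \<partial>M)"
    using pw by (intro nn_integral_mono) (simp flip: ennreal_mult)
  also have "\<dots> = ennreal ?k * (\<integral>\<^sup>+x. ennreal (exp (b / 2 * (Y x)\<^sup>2)) \<partial>M)" by (rule nn_integral_cmult) measurable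
  also have "\<dots> \<le> ennreal ?k * ennreal (1 + C)"
    using tail b C by (intro mult_left_mono nn_integral_exp_of_tail[OF M Y]) auto
  also have "\<dots> = ennreal ((1 + C) * ?k)" using C by (subst ennreal_mult[symmetric]) (auto simp: mult.commute)
  finally have le: "(\<integral>\<^sup>+x. ennreal (\<bar>Y x\<bar> powr q) \<partial>M) \<le> ennreal ((1 + C) * ?k)" .
  show "integrable M (\<lambda>x. \<bar>Y x\<bar> powr q)"
  proof (rule integrableI_nonneg)
    show "(\<integral>\<^sup>+x. ennreal (\<bar>Y x\<bar> powr q) \<partial>M) < \<infinity>" using le by (auto intro: le_less_trans)
  qed auto
  show "(LINT x|M. \<bar>Y x\<bar> powr q) \<le> (1 + C) * ?k"
    using le C by (subst integral_eq_nn_integral) (auto intro!: enn2real_leI)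
qed

text \<open>A unitary matrix whose first column is the normalised conjugate of \<open>w\<close>
  turns the pairing with \<open>w\<close> into \<open>vec_norm N w\<close> times the first
  coordinate, and the uniform measure is unitarily invariant.\<close>

lemma nn_integral_inner_powr:
  fixes w :: "nat \<Rightarrow> complex"
  assumes N: "N > 0" and q: "q > 0" and w: "vec_norm N w > 0"
  shows "(\<integral>\<^sup>+a. ennreal (norm (\<Sum>m<N. a m * w m) powr q) \<partial>uniform_unit_sphere N)
    = ennreal (vec_norm N w powr q * (Gamma (q / 2 + 1) * Gamma (real N) / Gamma (q / 2 + real N)))"
proof -
  define y where "y = (\<lambda>m. conjugate (w m) /\<^sub>R vec_norm N w)"
  have "vec_norm N y = \<bar>inverse (vec_norm N w)\<bar> * vec_norm N (\<lambda>m. conjugate (w m))"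
    unfolding y_def by (rule vec_norm_scaleR)
  also have "vec_norm N (\<lambda>m. conjugate (w m)) = vec_norm N w" by (simp add: vec_norm_def)
  finally have "vec_norm N y = 1" using w by simp
  then obtain V where V: "V \<in> unitary_group N" "\<And>m. m < N \<Longrightarrow> V (m, 0) = y m"
    using exists_unitary_column[of N y 0] N by metis
  let ?f = "\<lambda>a :: nat \<Rightarrow> complex. ennreal (norm (a 0) powr q)"
  have f: "?f \<in> borel_measurable (vec_borel N)"
  proof -
    have "(\<lambda>a :: nat \<Rightarrow> complex. a 0) \<in> borel_measurable (vec_borel N)"
      using N by (intro measurable_component_singleton) auto
    thus ?thesis by measurable
  qed
  have eq: "ennreal (norm (\<Sum>m<N. a m * w m) powr q) = ennreal (vec_norm N w powr q) * ?f (mat_vec N (mat_adjoint N V) a)" for a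
  proof -
    have "mat_vec N (mat_adjoint N V) a 0 = (\<Sum>m<N. conjugate (y m) * a m)"
      using N V(2) by (simp add: mat_vec_def mat_adjoint_def)
    also have "\<dots> = (\<Sum>m<N. a m * w m) /\<^sub>R vec_norm N w"
      by (simp add: y_def scaleR_sum_right mult.commute)
    finally have "norm (\<Sum>m<N. a m * w m) = vec_norm N w * norm (mat_vec N (mat_adjoint N V) a 0)"
      using w by simp
    thus ?thesis by (simp add: powr_mult flip: ennreal_mult)
  qed
  have "(\<integral>\<^sup>+a. ennreal (norm (\<Sum>m<N. a m * w m) powr q) \<partial>uniform_unit_sphere N)
    = ennreal (vec_norm N w powr q) * (\<integral>\<^sup>+a. ?f (mat_vec N (mat_adjoint N V) a) \<partial>uniform_unit_sphere N)"
    unfolding eq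
  proof (rule nn_integral_cmult)
    have "(\<lambda>a. ?f (mat_vec N (mat_adjoint N V) a)) \<in> borel_measurable (vec_borel N)"
      by (rule measurable_compose[OF measurable_mat_vec f])
    thus "(\<lambda>a. ?f (mat_vec N (mat_adjoint N V) a)) \<in> borel_measurable (uniform_unit_sphere N)"
      by (simp cong: measurable_cong_sets)
  qed
  also have "(\<integral>\<^sup>+a. ?f (mat_vec N (mat_adjoint N V) a) \<partial>uniform_unit_sphere N) = (\<integral>\<^sup>+a. ?f a \<partial>uniform_unit_sphere N)"
    by (intro nn_integral_uniform_unit_sphere_unitary mat_adjoint_unitary V(1) f)
  also have "\<dots> = ennreal (Gamma (q / 2 + 1) * Gamma (real N) / Gamma (q / 2 + real N))" by (rule sphere_moment[OF N q])
  finally show ?thesis by (simp flip: ennreal_mult')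
qed

lemma Lq_norm_moment:
  fixes e :: "nat \<Rightarrow> real^'n \<Rightarrow> complex"
  assumes e: "orthonormal_basis_harm k N e" and N: "N > 0" and q: "q > 0"
  defines "V \<equiv> measure (sphere_measure :: (real^'n) measure) (sphere 0 1)"
  shows "(LINT a|uniform_unit_sphere N. Lq_norm q (lin_comb N e a) powr q)
    = V * ((real N / V) powr (q / 2) * (Gamma (q / 2 + 1) * Gamma (real N) / Gamma (q / 2 + real N)))"
proof -
  let ?\<sigma> = "uniform_unit_sphere N :: (nat \<Rightarrow> complex) measure"
  let ?S = "sphere_measure :: (real^'n) measure"
  let ?g = "(real N / V) powr (q / 2) * (Gamma (q / 2 + 1) * Gamma (real N) / Gamma (q / 2 + real N))"
  interpret \<sigma>: prob_space ?\<sigma> by (rule prob_space_uniform_unit_sphere)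
  interpret pair_sigma_finite ?\<sigma> ?S ..
  have V: "V > 0" unfolding V_def by (rule measure_sphere_pos)
  have G: "?g \<ge> 0" using q N by (auto intro!: mult_nonneg_nonneg divide_nonneg_nonneg less_imp_le Gamma_real_pos)
  have F: "ennreal (Lq_norm q (lin_comb N e a) powr q) = (\<integral>\<^sup>+x. ennreal (norm (lin_comb N e a x) powr q) \<partial>?S)" for a
  proof -
    have "Lq_norm q (lin_comb N e a) powr q = (LINT x|?S. norm (lin_comb N e a x) powr q)"
      unfolding Lq_norm_def powr_powr using q by simp
    thus ?thesis using integrable_lin_comb_powr[OF e, of q a] q by (simp add: nn_integral_eq_integral)
  qed
  have sph: "(\<integral>\<^sup>+a. ennreal (norm (lin_comb N e a x) powr q) \<partial>?\<sigma>) = ennreal ?g" if x: "x \<in> sphere 0 1" for x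
  proof -
    have K: "(vec_norm N (\<lambda>m. e m x))\<^sup>2 = real N / V"
      using kernel_norm_eq[OF e x] unfolding kernel_norm_def[OF e] V_def .
    hence pos: "vec_norm N (\<lambda>m. e m x) > 0"
      using N V vec_norm_nonneg[of N "\<lambda>m. e m x"] by (metis divide_pos_pos less_le of_nat_0_less_iff power_zero_numeral less_irrefl)
    have "vec_norm N (\<lambda>m. e m x) powr q = (vec_norm N (\<lambda>m. e m x) powr 2) powr (q / 2)" by (simp only: powr_powr) simp
    also have "vec_norm N (\<lambda>m. e m x) powr 2 = real N / V" using pos K by (simp add: powr_numeral)
    finally show ?thesis
      unfolding lin_comb_def using nn_integral_inner_powr[OF N q pos] by simp
  qed
  have "(\<integral>\<^sup>+a. ennreal (Lq_norm q (lin_comb N e a) powr q) \<partial>?\<sigma>)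
    = (\<integral>\<^sup>+x. (\<integral>\<^sup>+a. ennreal (norm (lin_comb N e a x) powr q) \<partial>?\<sigma>) \<partial>?S)"
    unfolding F
  proof (rule Fubini'[symmetric])
    have "(\<lambda>z. lin_comb N e (fst z) (snd z)) \<in> borel_measurable (?\<sigma> \<Otimes>\<^sub>M ?S)"
      using lin_comb_measurable_pair[OF e] by (simp cong: measurable_cong_sets sets_pair_measure_cong)
    thus "(\<lambda>(a, x). ennreal (norm (lin_comb N e a x) powr q)) \<in> borel_measurable (?\<sigma> \<Otimes>\<^sub>M ?S)"
      unfolding case_prod_unfold by measurable
  qed
  also have "\<dots> = (\<integral>\<^sup>+x. ennreal ?g \<partial>?S)"
    by (rule nn_integral_cong_AE) (use AE_sphere_measure in eventually_elim, rule sph)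
  also have "\<dots> = ennreal ?g * emeasure ?S (sphere 0 1)"
  proof -
    have "emeasure ?S (space ?S) = emeasure ?S (sphere 0 1)"
      using AE_sphere_measure by (intro emeasure_eq_AE) (auto simp: borel_closed)
    thus ?thesis by simp
  qed
  also have "\<dots> = ennreal (V * ?g)"
    using G V by (simp add: V_def sphere_measure.emeasure_eq_measure mult.commute flip: ennreal_mult)
  finally have "(\<integral>\<^sup>+a. ennreal (Lq_norm q (lin_comb N e a) powr q) \<partial>?\<sigma>) = ennreal (V * ?g)" .
  moreover have "(\<lambda>a. Lq_norm q (lin_comb N e a) powr q) \<in> borel_measurable ?\<sigma>"
    using Lq_norm_measurable[OF e, of q] by (simp cong: measurable_cong_sets)
  ultimately have "(LINT a|?\<sigma>. Lq_norm q (lin_comb N e a) powr q) = enn2real (ennreal (V * ?g))"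
    by (subst integral_eq_nn_integral) auto
  also have "\<dots> = V * ?g" by (rule enn2real_ennreal, rule mult_nonneg_nonneg[OF less_imp_le[OF V] G])
  finally show ?thesis .
qed

text \<open>The functional equation \<open>Gamma (q / 2 + 1) = q / 2 * Gamma (q / 2)\<close>
  identifies the closed formula with the \<open>q\<close>-th root of the moment in
  \<open>Lq_norm_moment\<close>.\<close>

lemma A_const_eq:
  fixes V q :: real
  assumes V: "V > 0" and N: "N > 0" and q: "q > 0"
  shows "A_const V N q = (V * ((real N / V) powr (q / 2) * (Gamma (q / 2 + 1) * Gamma (real N) / Gamma (q / 2 + real N)))) powr (1 / q)"
proof -
  let ?G = "Gamma (q / 2 + 1) * Gamma (real N) / Gamma (q / 2 + real N)"
  have pos: "Gamma (q / 2 + real N) > 0" "Gamma (q / 2 + 1) > 0" "Gamma (real N) > 0"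
    using q N by (auto intro!: Gamma_real_pos)
  have g: "Gamma (q / 2 + 1) = q / 2 * Gamma (q / 2)" using q by (intro Gamma_plus1) (auto simp: nonpos_Ints_def)
  have "q * (Gamma (q / 2) * Gamma (real N) / (2 * Gamma (q / 2 + real N))) = ?G" unfolding g by simp
  hence "A_const V N q = real N powr (1 / 2) / V powr (1 / 2 - 1 / q) * ?G powr (1 / q)" by (simp add: A_const_def)
  also have "real N powr (1 / 2) / V powr (1 / 2 - 1 / q) = V powr (1 / q) * (real N / V) powr (1 / 2)"
  proof -
    have "V powr (1 / 2) = V powr (1 / q) * V powr (1 / 2 - 1 / q)" by (simp flip: powr_add)
    thus ?thesis using V by (simp add: powr_divide)
  qed
  also have "(real N / V) powr (1 / 2) = ((real N / V) powr (q / 2)) powr (1 / q)" using q by (simp add: powr_powr)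
  also have "V powr (1 / q) * ((real N / V) powr (q / 2)) powr (1 / q) * ?G powr (1 / q)
    = (V * ((real N / V) powr (q / 2) * ?G)) powr (1 / q)" by (simp only: powr_mult mult.assoc)
  finally show ?thesis .
qed

text \<open>The reverse triangle inequality in \<open>L^q\<close> between \<open>F\<close> and the
  constant \<open>m\<close>, whose norm over a probability space is \<open>m\<close> itself. Of the
  median only nonnegativity enters here.\<close>

lemma median_moment_distance:
  fixes F :: "'a \<Rightarrow> real"
  assumes M: "prob_space M" and F: "F \<in> borel_measurable M" "\<And>x. F x \<ge> 0" and m: "m \<ge> 0" and q: "q \<ge> 1"
    and int: "integrable M (\<lambda>x. F x powr q)" "integrable M (\<lambda>x. \<bar>F x - m\<bar> powr q)"
  shows "\<bar>(LINT x|M. F x powr q) powr (1 / q) - m\<bar> \<le> (LINT x|M. \<bar>F x - m\<bar> powr q) powr (1 / q)"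
proof -
  interpret prob_space M by fact
  have const: "(LINT x|M. m powr q) powr (1 / q) = m" using m q by (simp add: prob_space powr_powr)
  note F(1)[measurable]
  have sum_int: "integrable M (\<lambda>x. (g x + h x) powr q)"
    if [measurable]: "g \<in> borel_measurable M" "h \<in> borel_measurable M" and nn: "\<And>x. g x \<ge> 0" "\<And>x. h x \<ge> 0"
      and gh: "integrable M (\<lambda>x. g x powr q)" "integrable M (\<lambda>x. h x powr q)" for g h :: "'a \<Rightarrow> real"
  proof (rule Bochner_Integration.integrable_bound)
    show "integrable M (\<lambda>x. (1 + 1) powr (q - 1) * (1 powr (1 - q) * g x powr q + 1 powr (1 - q) * h x powr q))"
      using gh by simp
    show "AE x in M. norm ((g x + h x) powr q)
      \<le> norm ((1 + 1) powr (q - 1) * (1 powr (1 - q) * g x powr q + 1 powr (1 - q) * h x powr q))"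
      using powr_add_weighted[OF nn zero_less_one zero_less_one q] by (intro AE_I2) simp
  qed measurable
  have "(LINT x|M. F x powr q) powr (1 / q) \<le> (LINT x|M. (\<bar>F x - m\<bar> + m) powr q) powr (1 / q)"
    using q F(2) m int by (intro powr_mono2 integral_mono sum_int) (auto intro!: powr_mono2)
  also have "\<dots> \<le> (LINT x|M. \<bar>F x - m\<bar> powr q) powr (1 / q) + (LINT x|M. m powr q) powr (1 / q)"
    using q m int by (intro minkowski_integral) auto
  finally have 1: "(LINT x|M. F x powr q) powr (1 / q) \<le> (LINT x|M. \<bar>F x - m\<bar> powr q) powr (1 / q) + m"
    by (simp only: const)
  have "m = (LINT x|M. m powr q) powr (1 / q)" by (rule const[symmetric])
  also have "\<dots> \<le> (LINT x|M. (\<bar>F x - m\<bar> + F x) powr q) powr (1 / q)"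
    using q F(2) m int F(1) by (intro powr_mono2 integral_mono sum_int) (auto intro!: powr_mono2)
  also have "\<dots> \<le> (LINT x|M. \<bar>F x - m\<bar> powr q) powr (1 / q) + (LINT x|M. F x powr q) powr (1 / q)"
    using q F(2) int by (intro minkowski_integral) auto
  finally show ?thesis using 1 by linarith
qed

text \<open>The 17 is \<open>1 + C\<close> from \<open>integral_powr_of_tail\<close> with the tail
  factor \<open>C = 16\<close>.\<close>

lemma A_const_median_distance:
  fixes e :: "nat \<Rightarrow> real^'n \<Rightarrow> complex"
  assumes e: "orthonormal_basis_harm k N e" and N: "N > 0" and q: "q \<ge> 2" and m: "is_Lq_median N e q m"
  shows "\<bar>A_const (measure (sphere_measure :: (real^'n) measure) (sphere 0 1)) N q - m\<bar>
    \<le> 17 / sqrt (dev_rate TYPE('n)) / real N powr (1 / q) * sqrt q"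
proof -
  let ?\<sigma> = "uniform_unit_sphere N :: (nat \<Rightarrow> complex) measure"
  let ?V = "measure (sphere_measure :: (real^'n) measure) (sphere 0 1)"
  let ?c = "dev_rate TYPE('n)"
  define F where "F = (\<lambda>a. Lq_norm q (lin_comb N e a))"
  interpret prob_space ?\<sigma> by (rule prob_space_uniform_unit_sphere)
  have c: "?c > 0" by (rule dev_rate_pos)
  define b where "b = ?c * real N powr (2 / q)"
  have b: "b > 0" using c N by (simp add: b_def)
  have F[measurable]: "F \<in> borel_measurable ?\<sigma>"
    unfolding F_def using Lq_norm_measurable[OF e, of q] by (simp cong: measurable_cong_sets)
  have F0: "F a \<ge> 0" for a by (simp add: F_def Lq_norm_def)
  \<comment> \<open>For a negative \<open>m\<close> the event \<open>F a \<le> m\<close> would be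
    empty, contradicting its probability of at least 1/2.\<close>
  have m0: "m \<ge> 0"
  proof (rule ccontr)
    assume "\<not> m \<ge> 0"
    hence empty: "{a\<in>space ?\<sigma>. F a \<le> m} = {}" using F0 by (auto simp: not_le intro: less_le_trans)
    have "measure ?\<sigma> {a\<in>space ?\<sigma>. F a \<le> m} \<ge> 1 / 2"
      using m by (simp add: is_Lq_median_def is_median_def F_def)
    thus False unfolding empty by simp
  qed
  have tail: "measure ?\<sigma> {a\<in>space ?\<sigma>. \<bar>F a - m\<bar> > t} \<le> 16 * exp (- (b * t\<^sup>2))" if "t \<ge> 0" for t
    using Lq_deviation[OF e N q m that] by (simp add: F_def b_def)
  have Fm: "(\<lambda>a. F a - m) \<in> borel_measurable ?\<sigma>" by measurable
  note dev = integral_powr_of_tail[OF prob_space_axioms Fm b _ _ tail, of q]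
  have dev1: "integrable ?\<sigma> (\<lambda>a. \<bar>F a - m\<bar> powr q)" and dev2: "(LINT a|?\<sigma>. \<bar>F a - m\<bar> powr q) \<le> 17 * (q / b) powr (q / 2)"
    using dev q by auto
  have moment: "(LINT a|?\<sigma>. F a powr q)
    = ?V * ((real N / ?V) powr (q / 2) * (Gamma (q / 2 + 1) * Gamma (real N) / Gamma (q / 2 + real N)))"
    unfolding F_def using q by (intro Lq_norm_moment[OF e N]) auto
  have "?V * ((real N / ?V) powr (q / 2) * (Gamma (q / 2 + 1) * Gamma (real N) / Gamma (q / 2 + real N))) > 0"
    using measure_sphere_pos[where 'n='n] N q by (auto intro!: mult_pos_pos divide_pos_pos Gamma_real_pos)
  \<comment> \<open>A non-integrable function has Bochner integral 0 by convention, so the positive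
    value of the moment forces integrability.\<close>
  hence intF: "integrable ?\<sigma> (\<lambda>a. F a powr q)"
    using moment not_integrable_integral_eq[of ?\<sigma> "\<lambda>a. F a powr q"] by fastforce
  have "A_const ?V N q = (LINT a|?\<sigma>. F a powr q) powr (1 / q)"
    unfolding moment using q N by (intro A_const_eq measure_sphere_pos) auto
  hence "\<bar>A_const ?V N q - m\<bar> \<le> (LINT a|?\<sigma>. \<bar>F a - m\<bar> powr q) powr (1 / q)"
    using median_moment_distance[OF prob_space_axioms F F0 m0 _ intF dev1] q by simp
  also have "\<dots> \<le> (17 * (q / b) powr (q / 2)) powr (1 / q)"
    using dev2 q by (intro powr_mono2) auto
  also have "\<dots> = 17 powr (1 / q) * sqrt (q / b)"
    using q b by (simp add: powr_mult powr_powr powr_half_sqrt)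
  \<comment> \<open>The root of 17 is bounded by 17 itself, which makes the constant independent of
    \<open>q\<close>.\<close>
  also have "\<dots> \<le> 17 powr 1 * sqrt (q / b)" using q b by (intro mult_right_mono powr_mono) auto
  also have "sqrt (q / b) = sqrt q / (sqrt ?c * real N powr (1 / q))"
  proof -
    have "sqrt (real N powr (2 / q)) = real N powr (1 / q)" by (simp add: powr_powr flip: powr_half_sqrt)
    thus ?thesis by (simp add: b_def real_sqrt_divide real_sqrt_mult)
  qed
  finally show ?thesis by (simp add: field_simps)
qed

theorem mainTheorem7:
  fixes d :: nat
  assumes "CARD('n::finite) = d + 1" and "d \<ge> 2"
  shows
    "(\<exists>c>0. \<forall>q\<ge>2. \<exists>Cq>0. \<forall>r\<ge>0.
        (\<forall>(e :: nat \<Rightarrow> nat \<Rightarrow> real^'n \<Rightarrow> complex) \<nu> M.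
           (\<forall>k. orthonormal_basis_harm k (harm_dim d k) (e k)) \<longrightarrow>
           (\<forall>k. haar_prob (harm_dim d k) (\<nu> k)) \<longrightarrow>
           (\<forall>k. is_Lq_median (harm_dim d k) (e k) q (M k)) \<longrightarrow>
           measure (\<Pi>\<^sub>M k\<in>UNIV. \<nu> k) (deviation_event d e \<nu> q M r) \<le> Cq * exp (- c * r\<^sup>2)) \<and>
        (\<forall>(e :: nat \<Rightarrow> nat \<Rightarrow> real^'n \<Rightarrow> real) \<nu> M.
           (\<forall>k. orthonormal_basis_harm k (harm_dim d k) (e k)) \<longrightarrow>
           (\<forall>k. haar_prob (harm_dim d k) (\<nu> k)) \<longrightarrow>
           (\<forall>k. is_Lq_median (harm_dim d k) (e k) q (M k)) \<longrightarrow>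
           measure (\<Pi>\<^sub>M k\<in>UNIV. \<nu> k) (deviation_event d e \<nu> q M r) \<le> Cq * exp (- c * r\<^sup>2))) \<and>
     (\<exists>C. \<forall>q\<ge>2. \<forall>k. \<forall>(e :: nat \<Rightarrow> real^'n \<Rightarrow> complex) m.
        orthonormal_basis_harm k (harm_dim d k) e \<longrightarrow>
        is_Lq_median (harm_dim d k) e q m \<longrightarrow>
        \<bar>A_const (measure (sphere_measure :: (real^'n) measure) (sphere 0 1)) (harm_dim d k) q - m\<bar>
          \<le> C / real (harm_dim d k) powr (1 / q) * sqrt q)"
proof (intro conjI)
  let ?c = "dev_rate TYPE('n) / 2"
  show "\<exists>c>0. \<forall>q\<ge>2. \<exists>Cq>0. \<forall>r\<ge>0.
        (\<forall>(e :: nat \<Rightarrow> nat \<Rightarrow> real^'n \<Rightarrow> complex) \<nu> M.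
           (\<forall>k. orthonormal_basis_harm k (harm_dim d k) (e k)) \<longrightarrow>
           (\<forall>k. haar_prob (harm_dim d k) (\<nu> k)) \<longrightarrow>
           (\<forall>k. is_Lq_median (harm_dim d k) (e k) q (M k)) \<longrightarrow>
           measure (\<Pi>\<^sub>M k\<in>UNIV. \<nu> k) (deviation_event d e \<nu> q M r) \<le> Cq * exp (- c * r\<^sup>2)) \<and>
        (\<forall>(e :: nat \<Rightarrow> nat \<Rightarrow> real^'n \<Rightarrow> real) \<nu> M.
           (\<forall>k. orthonormal_basis_harm k (harm_dim d k) (e k)) \<longrightarrow>
           (\<forall>k. haar_prob (harm_dim d k) (\<nu> k)) \<longrightarrow>
           (\<forall>k. is_Lq_median (harm_dim d k) (e k) q (M k)) \<longrightarrow>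
           measure (\<Pi>\<^sub>M k\<in>UNIV. \<nu> k) (deviation_event d e \<nu> q M r) \<le> Cq * exp (- c * r\<^sup>2))"
  proof (rule exI[of _ ?c], intro conjI allI impI)
    show "?c > 0" using dev_rate_pos[where 'n='n] by simp
    fix q :: real assume q: "q \<ge> 2"
    obtain C where C: "C > 0" "\<And>(e :: nat \<Rightarrow> nat \<Rightarrow> real^'n \<Rightarrow> complex) \<nu> M r.
       (\<forall>k. orthonormal_basis_harm k (harm_dim d k) (e k)) \<Longrightarrow> (\<forall>k. haar_prob (harm_dim d k) (\<nu> k)) \<Longrightarrow>
       (\<forall>k. is_Lq_median (harm_dim d k) (e k) q (M k)) \<Longrightarrow> r \<ge> 0 \<Longrightarrow>
       measure (\<Pi>\<^sub>M k\<in>UNIV. \<nu> k) (deviation_event d e \<nu> q M r) \<le> C * exp (- ?c * r\<^sup>2)"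
      by (rule deviation_event_bound[OF assms(2) q, where 'n='n and 'k=complex]) blast
    obtain C' where C': "C' > 0" "\<And>(e :: nat \<Rightarrow> nat \<Rightarrow> real^'n \<Rightarrow> real) \<nu> M r.
       (\<forall>k. orthonormal_basis_harm k (harm_dim d k) (e k)) \<Longrightarrow> (\<forall>k. haar_prob (harm_dim d k) (\<nu> k)) \<Longrightarrow>
       (\<forall>k. is_Lq_median (harm_dim d k) (e k) q (M k)) \<Longrightarrow> r \<ge> 0 \<Longrightarrow>
       measure (\<Pi>\<^sub>M k\<in>UNIV. \<nu> k) (deviation_event d e \<nu> q M r) \<le> C' * exp (- ?c * r\<^sup>2)"
      by (rule deviation_event_bound[OF assms(2) q, where 'n='n and 'k=real]) blast
    \<comment> \<open>The two scalar fields yield separate constants but the same rate; the maximum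
      of the constants serves both.\<close>
    have mono: "C * exp (- ?c * r\<^sup>2) \<le> max C C' * exp (- ?c * r\<^sup>2)" "C' * exp (- ?c * r\<^sup>2) \<le> max C C' * exp (- ?c * r\<^sup>2)" for r
      by (intro mult_right_mono; simp)+
    show "\<exists>Cq>0. \<forall>r\<ge>0.
        (\<forall>(e :: nat \<Rightarrow> nat \<Rightarrow> real^'n \<Rightarrow> complex) \<nu> M.
           (\<forall>k. orthonormal_basis_harm k (harm_dim d k) (e k)) \<longrightarrow>
           (\<forall>k. haar_prob (harm_dim d k) (\<nu> k)) \<longrightarrow>
           (\<forall>k. is_Lq_median (harm_dim d k) (e k) q (M k)) \<longrightarrow>
           measure (\<Pi>\<^sub>M k\<in>UNIV. \<nu> k) (deviation_event d e \<nu> q M r) \<le> Cq * exp (- ?c * r\<^sup>2)) \<and>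
        (\<forall>(e :: nat \<Rightarrow> nat \<Rightarrow> real^'n \<Rightarrow> real) \<nu> M.
           (\<forall>k. orthonormal_basis_harm k (harm_dim d k) (e k)) \<longrightarrow>
           (\<forall>k. haar_prob (harm_dim d k) (\<nu> k)) \<longrightarrow>
           (\<forall>k. is_Lq_median (harm_dim d k) (e k) q (M k)) \<longrightarrow>
           measure (\<Pi>\<^sub>M k\<in>UNIV. \<nu> k) (deviation_event d e \<nu> q M r) \<le> Cq * exp (- ?c * r\<^sup>2))"
    proof (intro exI[of _ "max C C'"] conjI allI impI)
      show "max C C' > 0" using C(1) by simp
    qed (rule order_trans[OF C(2) mono(1)] order_trans[OF C'(2) mono(2)]; assumption)+
  qed
  show "\<exists>C. \<forall>q\<ge>2. \<forall>k. \<forall>(e :: nat \<Rightarrow> real^'n \<Rightarrow> complex) m.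
        orthonormal_basis_harm k (harm_dim d k) e \<longrightarrow>
        is_Lq_median (harm_dim d k) e q m \<longrightarrow>
        \<bar>A_const (measure (sphere_measure :: (real^'n) measure) (sphere 0 1)) (harm_dim d k) q - m\<bar>
          \<le> C / real (harm_dim d k) powr (1 / q) * sqrt q"
  proof (intro exI allI impI)
    fix q :: real and k :: nat and e :: "nat \<Rightarrow> real^'n \<Rightarrow> complex" and m
    assume "2 \<le> q" "orthonormal_basis_harm k (harm_dim d k) e" "is_Lq_median (harm_dim d k) e q m"
    thus "\<bar>A_const (measure (sphere_measure :: (real^'n) measure) (sphere 0 1)) (harm_dim d k) q - m\<bar>
      \<le> 17 / sqrt (dev_rate TYPE('n)) / real (harm_dim d k) powr (1 / q) * sqrt q"
      using harm_dim_ge[OF assms(2), of k] by (intro A_const_median_distance) auto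
  qed
qed

end
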